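(* Let $\gamma>0$ and let $\varphi_1\in C(\mathbb{T})$ be a continuous function on the unit circle $\mathbb{T}=\{|z|=1\}$. Define the symbol $\varphi(z)=\varphi_1(e^{i\theta})\,\varphi_0(r)$ for $z=re^{i\theta}\in\mathbb{D}$, where $$\varphi_0(r)=\frac{1}{\left(1+\log\frac{1}{1-r}\right)^{\gamma}},\qquad r\in[0,1).$$ Then the singular values $s_n(T_\varphi)$, $n\ge 1$, of the (compact) Toeplitz operator $T_\varphi$ on the Bergman space satisfy $$\lim_{n\to+\infty}(\log(n+1))^{\gamma}\,s_n(T_\varphi)=\|\varphi_1\|_{L^\infty(\mathbb{T})}.$$
   Context: $\mathbb{D}=\{|z|<1\}$, $dA=dx\,dy/\pi$ the normalized area measure. The Bergman space $L^2_a(\mathbb{D})$ is the closed subspace of $L^2(\mathbb{D},dA)$ consisting of analytic functions; $P_+:L^2(\mathbb{D})\to L^2_a(\mathbb{D})$ is the orthogonal projection, $(P_+f)(z)=\int_{\mathbb{D}}\frac{f(w)}{(1-z\bar w)^2}\,dA(w)$. For $\varphi\in L^\infty(\mathbb{D})$ the Toeplitz operator is $T_\varphi f=P_+(\varphi f)$, $f\in L^2_a(\mathbb{D})$. Singular values $s_n(A)=\lambda_n(A^*A)^{1/2}$ of a compact operator are listed in non-increasing order with multiplicity, starting at $n=1$. *)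

theory Defs
  imports "HOL-Analysis.Analysis"
begin

definition dA_int :: "(complex \<Rightarrow> complex) \<Rightarrow> complex" where
  "dA_int g = complex_of_real (1 / pi) * (LINT w:ball 0 1|lborel. g w)"

definition binner :: "(complex \<Rightarrow> complex) \<Rightarrow> (complex \<Rightarrow> complex) \<Rightarrow> complex" where
  "binner f g = dA_int (\<lambda>w. f w * cnj (g w))"

definition bnorm :: "(complex \<Rightarrow> complex) \<Rightarrow> real" where
  "bnorm f = sqrt ((1 / pi) * (LINT w:ball 0 1|lborel. (cmod (f w))\<^sup>2))"

definition bergman :: "(complex \<Rightarrow> complex) set" where
  "bergman = {f. f holomorphic_on ball 0 1 \<and>
                 set_integrable lborel (ball 0 1) (\<lambda>w. (cmod (f w))\<^sup>2)}"

text \<open>Toeplitz operator T_phi f = P_+(phi f), with P_+ given by the Bergman kernel integral.\<close>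
definition toeplitz :: "(complex \<Rightarrow> complex) \<Rightarrow> (complex \<Rightarrow> complex) \<Rightarrow> (complex \<Rightarrow> complex)" where
  "toeplitz \<phi> f = (\<lambda>z. dA_int (\<lambda>w. \<phi> w * f w / (1 - z * cnj w)\<^sup>2))"

definition compact_bergman_op :: "((complex \<Rightarrow> complex) \<Rightarrow> (complex \<Rightarrow> complex)) \<Rightarrow> bool" where
  "compact_bergman_op T \<longleftrightarrow>
     (\<forall>f\<in>bergman. T f \<in> bergman) \<and>
     (\<forall>f :: nat \<Rightarrow> complex \<Rightarrow> complex. (\<forall>k. f k \<in> bergman \<and> bnorm (f k) \<le> 1) \<longrightarrow>
        (\<exists>r :: nat \<Rightarrow> nat. strict_mono r \<and>
           (\<forall>e::real>0. \<exists>N::nat. \<forall>m\<ge>N. \<forall>k\<ge>N. bnorm (\<lambda>z. T (f (r m)) z - T (f (r k)) z) < e)))"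

text \<open>f is an eigenvector of T^*T with eigenvalue t (T^*T f = t f, expressed through
  the defining property of the adjoint: <Tf,Tg> = t <f,g> for all g in the Bergman space).\<close>
definition eigvec_TsT :: "((complex \<Rightarrow> complex) \<Rightarrow> (complex \<Rightarrow> complex)) \<Rightarrow> real \<Rightarrow> (complex \<Rightarrow> complex) \<Rightarrow> bool" where
  "eigvec_TsT T t f \<longleftrightarrow> f \<in> bergman \<and> (\<exists>z\<in>ball 0 1. f z \<noteq> 0) \<and>
     (\<forall>g\<in>bergman. binner (T f) (T g) = complex_of_real t * binner f g)"

text \<open>Eigenvalues of T^*T that are >= t, counted with multiplicity, number at least n:
  there are n linearly independent (as functions on D) eigenvectors with eigenvalues >= t.\<close>
definition eig_count_ge :: "((complex \<Rightarrow> complex) \<Rightarrow> (complex \<Rightarrow> complex)) \<Rightarrow> real \<Rightarrow> nat \<Rightarrow> bool" where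
  "eig_count_ge T t n \<longleftrightarrow>
     (\<exists>f :: nat \<Rightarrow> complex \<Rightarrow> complex. \<exists>s :: nat \<Rightarrow> real.
        (\<forall>i<n. s i \<ge> t \<and> eigvec_TsT T (s i) (f i)) \<and>
        (\<forall>c :: nat \<Rightarrow> complex. (\<forall>z\<in>ball 0 1. (\<Sum>i<n. c i * f i z) = 0) \<longrightarrow> (\<forall>i<n. c i = 0)))"

text \<open>n-th eigenvalue (n >= 1) of T^*T in non-increasing order with multiplicity (0 if there are
  fewer than n positive eigenvalues), and the n-th singular value s_n(T) = lambda_n(T^*T)^(1/2).\<close>
definition lambda_TsT :: "((complex \<Rightarrow> complex) \<Rightarrow> (complex \<Rightarrow> complex)) \<Rightarrow> nat \<Rightarrow> real" where
  "lambda_TsT T n = Sup ({t. t > 0 \<and> eig_count_ge T t n} \<union> {0})"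

definition sing_val :: "((complex \<Rightarrow> complex) \<Rightarrow> (complex \<Rightarrow> complex)) \<Rightarrow> nat \<Rightarrow> real" where
  "sing_val T n = sqrt (lambda_TsT T n)"

definition phi0 :: "real \<Rightarrow> real \<Rightarrow> real" where
  "phi0 \<gamma> r = 1 / (1 + ln (1 / (1 - r))) powr \<gamma>"

text \<open>phi(r e^{i theta}) = phi_1(e^{i theta}) phi_0(r); e^{i theta} = sgn z (value at z = 0 is immaterial).\<close>
definition symb :: "real \<Rightarrow> (complex \<Rightarrow> complex) \<Rightarrow> complex \<Rightarrow> complex" where
  "symb \<gamma> \<phi>1 z = \<phi>1 (sgn z) * complex_of_real (phi0 \<gamma> (cmod z))"

end

theory Submission
  imports Defs "HOL-Probability.Probability" "HOL-Complex_Analysis.Complex_Analysis"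
    "HOL-Real_Asymp.Real_Asymp"
begin

text \<open>Write \<open>\<lambda>\<^sub>n\<close> for the \<open>n\<close>-th eigenvalue of \<open>T* T\<close>, and \<open>M\<close> for the maximum of the modulus of
  \<open>\<phi>\<^sub>1\<close> on the circle.

  Upper bound: \<open>\<parallel>T f\<parallel> \<le> \<parallel>\<phi> f\<parallel>\<close>, and on the subspace of codimension \<open>n - 1\<close> of functions vanishing to
  order \<open>n - 1\<close> at the origin only the fraction \<open>\<rho>^(2n)\<close> of the mass lies in \<open>|z| \<le> \<rho>\<close>. Hence
  \<open>\<lambda>\<^sub>n \<le> M^2 (\<phi>\<^sub>0(\<rho>)^2 + \<rho>^(2n))\<close>, and one takes \<open>1 - \<rho> = (ln n)^2 / n\<close>.

  Lower bound: the polynomials \<open>f = ((1 + cnj \<zeta> z) / 2)^L q(z^K)\<close>, with \<open>\<zeta>\<close> a maximum point of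
  \<open>|\<phi>\<^sub>1|\<close> and \<open>q\<close> ranging over an \<open>n\<close>-dimensional space, concentrate near \<open>\<zeta>\<close> uniformly in \<open>n\<close>,
  since \<open>|q(z^K)|\<close> is invariant under rotation by \<open>2\<pi>/K\<close>. So \<open>|\<langle>T f, f\<rangle>|\<close> is nearly at least
  \<open>M \<integral> \<phi>\<^sub>0 |f|^2\<close>; and as \<open>deg f\<close> is at most a constant times \<open>n\<close>, at least the fraction
  \<open>\<rho>^(C n)\<close> of the mass of \<open>f\<close> lies in \<open>|z| \<le> \<rho>\<close>. One takes \<open>1 - \<rho> = 1 / (n ln n)\<close>; only the
  logarithm of \<open>1 - \<rho>\<close> matters, so both bounds have the same leading term.\<close>

section \<open>Two Hermitian forms on a function space\<close>

text \<open>The adjoint is never formed: eigenvalues are expressed through the two forms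
  \<open>binner f g\<close> and \<open>binner (T f) (T g)\<close>, and both halves of the min-max
  principle are proved for such a pair. Upper bounds need only a count of linear conditions. Lower
  bounds must produce genuine eigenvectors out of a test space, and this is where compactness
  enters. The forms are merely semidefinite, because functions that agree on the disc are not
  identified.

  The obstacle in the lower bound is that a fixed peak polynomial times an arbitrary q of large
  degree need not concentrate at \<zeta>: q may be tiny there and huge elsewhere. Passing to q(z^K)
  with K fixed removes this freedom at the price of a constant factor in the degree. The argument of
  the symbol is harmless: a unimodular factor makes its value at \<zeta> positive, and
  Cauchy-Schwarz turns a bound for the quadratic form of T into one for the norm of T f.\<close>

locale semi_inner =
  fixes V :: "('a \<Rightarrow> complex) set" and ip :: "('a \<Rightarrow> complex) \<Rightarrow> ('a \<Rightarrow> complex) \<Rightarrow> complex"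
  assumes V_zero: "(\<lambda>_. 0) \<in> V"
    and V_add: "\<And>f g. f \<in> V \<Longrightarrow> g \<in> V \<Longrightarrow> (\<lambda>x. f x + g x) \<in> V"
    and V_scale: "\<And>f c. f \<in> V \<Longrightarrow> (\<lambda>x. c * f x) \<in> V"
    and add_left: "\<And>f g h. f \<in> V \<Longrightarrow> g \<in> V \<Longrightarrow> h \<in> V \<Longrightarrow> ip (\<lambda>x. f x + g x) h = ip f h + ip g h"
    and scale_left: "\<And>f h c. f \<in> V \<Longrightarrow> h \<in> V \<Longrightarrow> ip (\<lambda>x. c * f x) h = c * ip f h"
    and commute: "\<And>f g. f \<in> V \<Longrightarrow> g \<in> V \<Longrightarrow> ip g f = cnj (ip f g)"
    and nonneg: "\<And>f. f \<in> V \<Longrightarrow> 0 \<le> Re (ip f f)"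
begin

definition nsq :: "('a \<Rightarrow> complex) \<Rightarrow> real" where "nsq f = Re (ip f f)"

lemma nsq_nonneg: "f \<in> V \<Longrightarrow> 0 \<le> nsq f"
  using nonneg by (simp add: nsq_def)

lemma ip_self: assumes "f \<in> V" shows "ip f f = complex_of_real (nsq f)"
proof -
  have "Im (ip f f) = Im (cnj (ip f f))" using commute[OF assms assms] by (rule arg_cong)
  then have "Im (ip f f) = 0" by simp
  then show ?thesis by (simp add: nsq_def complex_eq_iff)
qed

lemma add_right: "f \<in> V \<Longrightarrow> g \<in> V \<Longrightarrow> h \<in> V \<Longrightarrow> ip h (\<lambda>x. f x + g x) = ip h f + ip h g"
  using commute[OF V_add, of f g h] commute[of f h] commute[of g h] by (simp add: add_left)

lemma scale_right: "f \<in> V \<Longrightarrow> h \<in> V \<Longrightarrow> ip h (\<lambda>x. c * f x) = cnj c * ip h f"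
  using commute[OF V_scale, of f h c] commute[of f h] by (simp add: scale_left)

lemma V_diff: assumes "f \<in> V" "g \<in> V" shows "(\<lambda>x. f x - g x) \<in> V"
  using V_add[OF assms(1) V_scale[OF assms(2), of "-1"]] by simp

lemma diff_left: "f \<in> V \<Longrightarrow> g \<in> V \<Longrightarrow> h \<in> V \<Longrightarrow> ip (\<lambda>x. f x - g x) h = ip f h - ip g h"
  using add_left[of f "\<lambda>x. (-1) * g x" h] V_scale[of g "-1"] scale_left[of g h "-1"] by simp

lemma zero_left: "h \<in> V \<Longrightarrow> ip (\<lambda>_. 0) h = 0"
  using scale_left[of h h 0] by simp

lemma zero_right: "h \<in> V \<Longrightarrow> ip h (\<lambda>_. 0) = 0"
  using scale_right[of h h 0] by simp

lemma V_sum: "(\<And>i. i \<in> I \<Longrightarrow> f i \<in> V) \<Longrightarrow> (\<lambda>x. \<Sum>i\<in>I. f i x) \<in> V"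
  by (induction I rule: infinite_finite_induct) (auto simp: V_zero intro!: V_add)

lemma V_lincomb: "(\<And>i. i \<in> I \<Longrightarrow> f i \<in> V) \<Longrightarrow> (\<lambda>x. \<Sum>i\<in>I. c i * f i x) \<in> V"
  by (rule V_sum) (auto intro: V_scale)

lemma sum_left: "(\<And>i. i \<in> I \<Longrightarrow> f i \<in> V) \<Longrightarrow> h \<in> V \<Longrightarrow> ip (\<lambda>x. \<Sum>i\<in>I. f i x) h = (\<Sum>i\<in>I. ip (f i) h)"
  by (induction I rule: infinite_finite_induct) (auto simp: zero_left add_left V_sum)

lemma sum_right: "(\<And>i. i \<in> I \<Longrightarrow> f i \<in> V) \<Longrightarrow> h \<in> V \<Longrightarrow> ip h (\<lambda>x. \<Sum>i\<in>I. f i x) = (\<Sum>i\<in>I. ip h (f i))"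
  by (induction I rule: infinite_finite_induct) (auto simp: zero_right add_right V_sum)

lemma lincomb_left:
  "(\<And>i. i \<in> I \<Longrightarrow> f i \<in> V) \<Longrightarrow> h \<in> V \<Longrightarrow> ip (\<lambda>x. \<Sum>i\<in>I. c i * f i x) h = (\<Sum>i\<in>I. c i * ip (f i) h)"
  by (subst sum_left) (auto simp: V_scale scale_left)

lemma lincomb_right:
  "(\<And>i. i \<in> I \<Longrightarrow> f i \<in> V) \<Longrightarrow> h \<in> V \<Longrightarrow> ip h (\<lambda>x. \<Sum>i\<in>I. c i * f i x) = (\<Sum>i\<in>I. cnj (c i) * ip h (f i))"
  by (subst sum_right) (auto simp: V_scale scale_right)

lemma nsq_add_scale:
  assumes "f \<in> V" "g \<in> V"
  shows "nsq (\<lambda>x. f x + c * g x) = nsq f + 2 * Re (cnj c * ip f g) + (cmod c)\<^sup>2 * nsq g"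
proof -
  have "ip (\<lambda>x. f x + c * g x) (\<lambda>x. f x + c * g x) =
      ip f f + cnj c * ip f g + (c * cnj (ip f g) + (c * cnj c) * ip g g)"
    using assms by (simp add: add_left add_right scale_left scale_right V_scale V_add commute[of f g] algebra_simps)
  also have "c * cnj c = of_real ((cmod c)\<^sup>2)"
    by (simp only: complex_norm_square)
  also have "ip g g = of_real (nsq g)" by (rule ip_self) fact
  finally show ?thesis
    by (simp add: nsq_def algebra_simps)
qed

lemma nsq_scale: assumes "f \<in> V" shows "nsq (\<lambda>x. c * f x) = (cmod c)\<^sup>2 * nsq f"
  using nsq_add_scale[OF V_zero assms, of c] assms by (simp add: zero_left nsq_def V_zero)

text \<open>If \<open>nsq g = 0\<close>, the square norm of f + c g is affine in c, and
  nonnegativity forces its slope to vanish. Besides being the degenerate case of Cauchy-Schwarz,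
  this later yields the eigenvalue equation at a maximizer.\<close>

lemma null_left: assumes "f \<in> V" "g \<in> V" "nsq g = 0" shows "ip f g = 0"
proof (rule ccontr)
  assume n: "ip f g \<noteq> 0"
  \<comment> \<open>Chosen so that the affine function takes the value -1.\<close>
  define t where "t = (nsq f + 1) / (2 * (cmod (ip f g))\<^sup>2)"
  define c where "c = - complex_of_real t * ip f g"
  have "cnj c * ip f g = - of_real (t * (cmod (ip f g))\<^sup>2)"
    using complex_norm_square[of "ip f g"] by (simp add: c_def mult.commute mult.left_commute)
  then have "Re (cnj c * ip f g) = - (t * (cmod (ip f g))\<^sup>2)" by simp
  also have "\<dots> = - ((nsq f + 1) / 2)" using n by (simp add: t_def)
  finally have "nsq (\<lambda>x. f x + c * g x) = -1"
    using nsq_add_scale[OF assms(1,2), of c] assms(3) by (simp add: field_simps)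
  then show False
    using nsq_nonneg[OF V_add[OF assms(1) V_scale[OF assms(2), of c]]] by simp
qed

lemma Cauchy_Schwarz: assumes "f \<in> V" "g \<in> V" shows "(cmod (ip f g))\<^sup>2 \<le> nsq f * nsq g"
proof (cases "nsq g = 0")
  case True
  then show ?thesis using null_left[OF assms] by simp
next
  case False
  then have p: "nsq g > 0" using nsq_nonneg[OF assms(2)] by simp
  define c where "c = - ip f g / of_real (nsq g)"
  have "cnj c * ip f g = - of_real ((cmod (ip f g))\<^sup>2 / nsq g)"
    using complex_norm_square[of "ip f g"] by (simp add: c_def mult.commute)
  then have "Re (cnj c * ip f g) = - ((cmod (ip f g))\<^sup>2 / nsq g)" by simp
  moreover have "(cmod c)\<^sup>2 * nsq g = (cmod (ip f g))\<^sup>2 / nsq g"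
    using p by (simp add: c_def norm_divide power_divide power2_eq_square)
  ultimately have "nsq (\<lambda>x. f x + c * g x) = nsq f - (cmod (ip f g))\<^sup>2 / nsq g"
    using nsq_add_scale[OF assms, of c] by simp
  then have "0 \<le> nsq f - (cmod (ip f g))\<^sup>2 / nsq g"
    using nsq_nonneg[OF V_add[OF assms(1) V_scale[OF assms(2), of c]]] by simp
  then show ?thesis using p by (simp add: field_simps)
qed

lemma nsq_parallelogram:
  assumes "f \<in> V" "g \<in> V"
  shows "nsq (\<lambda>x. f x + g x) + nsq (\<lambda>x. f x - g x) = 2 * nsq f + 2 * nsq g"
  using nsq_add_scale[OF assms, of 1] nsq_add_scale[OF assms, of "-1"] by simp

lemma nsq_diff_le:
  assumes "f \<in> V" "g \<in> V"
  shows "nsq (\<lambda>x. f x - g x) \<le> 2 * nsq f + 2 * nsq g"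
  using nsq_parallelogram[OF assms] nsq_nonneg[OF V_add[OF assms]] by simp

lemma tendsto_ip_left:
  assumes "\<And>k. f k \<in> V" "g \<in> V" "h \<in> V" "(\<lambda>k. nsq (\<lambda>x. f k x - g x)) \<longlonglongrightarrow> 0"
  shows "(\<lambda>k. ip (f k) h) \<longlonglongrightarrow> ip g h"
proof -
  have "(\<lambda>k. nsq (\<lambda>x. f k x - g x) * nsq h) \<longlonglongrightarrow> 0"
    using tendsto_mult_right[OF assms(4), of "nsq h"] by simp
  then have "(\<lambda>k. (cmod (ip (f k) h - ip g h))\<^sup>2) \<longlonglongrightarrow> 0"
  proof (rule tendsto_sandwich[rotated 2, OF tendsto_const])
    show "\<forall>\<^sub>F n in sequentially. (cmod (ip (f n) h - ip g h))\<^sup>2 \<le> nsq (\<lambda>x. f n x - g x) * nsq h"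
      using Cauchy_Schwarz[OF V_diff[OF assms(1,2)] assms(3)] assms by (simp add: diff_left)
  qed simp
  then have "(\<lambda>k. cmod (ip (f k) h - ip g h)) \<longlonglongrightarrow> 0"
    by (drule_tac tendsto_real_sqrt) simp
  then have "(\<lambda>k. ip (f k) h - ip g h) \<longlonglongrightarrow> 0" by (rule tendsto_norm_zero_cancel)
  then show ?thesis by (rule LIM_zero_cancel)
qed

lemma tendsto_nsq:
  assumes "\<And>k. f k \<in> V" "g \<in> V" "(\<lambda>k. nsq (\<lambda>x. f k x - g x)) \<longlonglongrightarrow> 0"
  shows "(\<lambda>k. nsq (f k)) \<longlonglongrightarrow> nsq g"
proof -
  have *: "nsq (f k) = nsq (\<lambda>x. f k x - g x) - nsq g + 2 * Re (ip (f k) g)" for k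
  proof -
    have "nsq (\<lambda>x. f k x - g x) = nsq (f k) - 2 * Re (ip (f k) g) + nsq g"
      using nsq_add_scale[OF assms(1)[of k] assms(2), of "-1"] by simp
    then show ?thesis by simp
  qed
  have "(\<lambda>k. nsq (\<lambda>x. f k x - g x) - nsq g + 2 * Re (ip (f k) g)) \<longlonglongrightarrow> 0 - nsq g + 2 * Re (ip g g)"
    by (intro tendsto_intros assms tendsto_ip_left)
  moreover have "0 - nsq g + 2 * Re (ip g g) = nsq g" by (simp add: nsq_def)
  ultimately show ?thesis by (simp only: *)
qed

lemma semi_inner_subspace:
  assumes "W \<subseteq> V" "(\<lambda>_. 0) \<in> W" "\<And>f g. f \<in> W \<Longrightarrow> g \<in> W \<Longrightarrow> (\<lambda>x. f x + g x) \<in> W"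
    "\<And>f c. f \<in> W \<Longrightarrow> (\<lambda>x. c * f x) \<in> W"
  shows "semi_inner W ip"
  using assms by unfold_locales (auto simp: subset_iff add_left scale_left nonneg intro: commute)

end

section \<open>The min-max principle for a pair of forms\<close>

lemma homogeneous_system_nontrivial:
  fixes l :: "nat \<Rightarrow> 'b \<Rightarrow> 'a::field"
  assumes "finite I" "m < card I"
  shows "\<exists>c. (\<exists>i\<in>I. c i \<noteq> 0) \<and> (\<forall>k<m. (\<Sum>i\<in>I. c i * l k i) = 0)"
  using assms
proof (induction m arbitrary: I)
  case 0
  then obtain i where "i \<in> I" by fastforce
  then show ?case by (intro exI[of _ "\<lambda>_. 1"]) auto
next
  case (Suc m)
  then obtain c where c: "\<exists>i\<in>I. c i \<noteq> 0" "\<forall>k<m. (\<Sum>i\<in>I. c i * l k i) = 0"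
    by (meson Suc_lessD)
  then obtain p where p: "p \<in> I" "c p \<noteq> 0" by blast
  \<comment> \<open>A second solution d of the first m equations, zero at p, is independent of c
    because \<open>c p \<noteq> 0\<close>; some combination of c and d also satisfies the last
    equation.\<close>
  have "m < card (I - {p})" using Suc.prems p by simp
  then obtain d0 where d0: "\<exists>i\<in>I - {p}. d0 i \<noteq> 0" "\<forall>k<m. (\<Sum>i\<in>I - {p}. d0 i * l k i) = 0"
    using Suc.IH[of "I - {p}"] Suc.prems by auto
  define d where "d = (\<lambda>i. if i = p then 0 else d0 i)"
  have d: "(\<Sum>i\<in>I. d i * l k i) = (\<Sum>i\<in>I - {p}. d0 i * l k i)" for k
    using Suc.prems p by (subst sum.remove[of I p]) (auto simp: d_def intro!: sum.cong)
  define L where "L = (\<lambda>c. \<Sum>i\<in>I. c i * l m i)"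
  show ?case
  proof (cases "L d = 0")
    case True
    have "\<forall>k<Suc m. (\<Sum>i\<in>I. d i * l k i) = 0"
      using True d d0 unfolding L_def by (auto simp: less_Suc_eq)
    moreover have "\<exists>i\<in>I. d i \<noteq> 0" using d0 by (auto simp: d_def)
    ultimately show ?thesis by blast
  next
    case False
    define e where "e = (\<lambda>i. L d * c i - L c * d i)"
    have e: "(\<Sum>i\<in>I. e i * l k i) = L d * (\<Sum>i\<in>I. c i * l k i) - L c * (\<Sum>i\<in>I. d i * l k i)" for k
      by (simp add: e_def left_diff_distrib sum_subtractf sum_distrib_left mult.assoc)
    have "\<forall>k<Suc m. (\<Sum>i\<in>I. e i * l k i) = 0"
      using c d d0 unfolding e by (auto simp: less_Suc_eq L_def)
    moreover have "e p \<noteq> 0" using False p by (simp add: e_def d_def)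
    ultimately show ?thesis using p by blast
  qed
qed

text \<open>\<open>a\<close> is the norm form and \<open>b f g\<close> stands for the inner product
  of T f and T g. The compactness axiom asks for a limit inside the \<open>a\<close>-unit ball but
  for convergence in the \<open>b\<close>-seminorm alone: weak compactness of the ball and
  compactness of T are packed into one statement.\<close>

locale compact_form = a: semi_inner V a + b: semi_inner V b
  for V :: "('a \<Rightarrow> complex) set" and a b +
  fixes C :: real
  assumes bounded: "\<And>f. f \<in> V \<Longrightarrow> b.nsq f \<le> C * a.nsq f"
    and compact: "\<And>f :: nat \<Rightarrow> 'a \<Rightarrow> complex. (\<And>k. f k \<in> V) \<Longrightarrow> (\<And>k. a.nsq (f k) \<le> 1) \<Longrightarrow>
      \<exists>r g. strict_mono r \<and> g \<in> V \<and> a.nsq g \<le> 1 \<and> (\<lambda>k. b.nsq (\<lambda>x. f (r k) x - g x)) \<longlonglongrightarrow> 0"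
begin

definition eigpair :: "real \<Rightarrow> ('a \<Rightarrow> complex) \<Rightarrow> bool" where
  "eigpair s f \<longleftrightarrow> f \<in> V \<and> a.nsq f > 0 \<and> (\<forall>h\<in>V. b f h = of_real s * a f h)"

lemma eigpair_nsq: assumes "eigpair s f" shows "b.nsq f = s * a.nsq f"
  using assms by (simp add: eigpair_def a.nsq_def b.nsq_def)

lemma eigpair_le: assumes "eigpair s f" shows "s \<le> C"
proof -
  have "s * a.nsq f \<le> C * a.nsq f" using bounded[of f] assms eigpair_nsq[OF assms] by (simp add: eigpair_def)
  then show ?thesis using assms by (simp add: eigpair_def)
qed

lemma eigpair_orthogonal:
  assumes "eigpair s f" "eigpair t g" "s \<noteq> t" shows "a f g = 0"
proof -
  have V: "f \<in> V" "g \<in> V" using assms by (auto simp: eigpair_def)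
  have "of_real s * a f g = b f g" using assms V by (simp add: eigpair_def)
  also have "\<dots> = cnj (b g f)" by (rule b.commute[OF V(2,1)])
  also have "b g f = of_real t * a g f" using assms V by (simp add: eigpair_def)
  also have "cnj (of_real t * a g f) = of_real t * a f g" using a.commute[OF V] by simp
  finally show ?thesis using assms(3) by simp
qed

text \<open>Eigenvectors for different eigenvalues being orthogonal, \<^term>\<open>b f f - t * a f f\<close> is the
  \<^term>\<open>a\<close>-square norm of the combination with coefficients \<^term>\<open>sqrt (s i - t) * c i\<close>.\<close>

lemma eigen_span_lower:
  fixes n :: nat and c :: "nat \<Rightarrow> complex"
  assumes ev: "\<And>i. i < n \<Longrightarrow> eigpair (s i) (f i) \<and> s i \<ge> t"
  defines "F \<equiv> \<lambda>x. \<Sum>i<n. c i * f i x"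
  shows "b.nsq F \<ge> t * a.nsq F"
proof -
  have V: "f i \<in> V" if "i < n" for i using ev that by (auto simp: eigpair_def)
  define d where "d = (\<lambda>i. complex_of_real (sqrt (s i - t)) * c i)"
  define G where "G = (\<lambda>x. \<Sum>i<n. d i * f i x)"
  have FV: "F \<in> V" unfolding F_def by (rule a.V_lincomb) (auto intro: V)
  have GV: "G \<in> V" unfolding G_def by (rule a.V_lincomb) (auto intro: V)
  \<comment> \<open>Stated for any form and any coefficients, since it is applied to
    \<open>b\<close> and \<open>a\<close> with coefficients c and to \<open>a\<close> with
    coefficients d.\<close>
  have expand: "q F' F' = (\<Sum>i<n. \<Sum>j<n. (e i * cnj (e j)) * q (f i) (f j))"
    if q: "semi_inner V q" and F': "F' = (\<lambda>x. \<Sum>i<n. e i * f i x)" for q e F'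
  proof -
    interpret q: semi_inner V q by fact
    have F'V: "F' \<in> V" unfolding F' by (rule a.V_lincomb) (auto intro: V)
    have "q F' F' = (\<Sum>i<n. e i * q (f i) F')"
      by (subst (1) F') (rule q.lincomb_left, auto simp: V F'V)
    also have "\<dots> = (\<Sum>i<n. e i * (\<Sum>j<n. cnj (e j) * q (f i) (f j)))"
    proof (intro sum.cong refl)
      fix i assume i: "i \<in> {..<n}"
      have "q (f i) F' = (\<Sum>j<n. cnj (e j) * q (f i) (f j))"
        by (subst (1) F') (rule q.lincomb_right, use i V in auto)
      then show "e i * q (f i) F' = e i * (\<Sum>j<n. cnj (e j) * q (f i) (f j))" by simp
    qed
    finally show ?thesis by (simp add: sum_distrib_left mult.assoc)
  qed
  have 1: "b F F - of_real t * a F F = (\<Sum>i<n. \<Sum>j<n. (c i * cnj (c j)) * (of_real (s i - t) * a (f i) (f j)))"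
  proof -
    have "b (f i) (f j) = of_real (s i) * a (f i) (f j)" if "i < n" "j < n" for i j
      using ev that V by (auto simp: eigpair_def)
    then have "b F F = (\<Sum>i<n. \<Sum>j<n. (c i * cnj (c j)) * (of_real (s i) * a (f i) (f j)))"
      by (subst expand[OF b.semi_inner_axioms F_def[THEN meta_eq_to_obj_eq]]) (auto intro!: sum.cong)
    then show ?thesis
      by (subst expand[OF a.semi_inner_axioms F_def[THEN meta_eq_to_obj_eq]])
        (simp add: sum_subtractf[symmetric] sum_distrib_left algebra_simps)
  qed
  also have "\<dots> = (\<Sum>i<n. \<Sum>j<n. (d i * cnj (d j)) * a (f i) (f j))"
  proof (intro sum.cong refl)
    fix i j assume ij: "i \<in> {..<n}" "j \<in> {..<n}"
    show "(c i * cnj (c j)) * (of_real (s i - t) * a (f i) (f j)) = (d i * cnj (d j)) * a (f i) (f j)"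
    \<comment> \<open>Within one eigenvalue the two square roots multiply to \<open>s i - t\<close>,
      whatever the inner product is; across eigenvalues both sides vanish.\<close>
    proof (cases "s i = s j")
      case True
      have "s j - t \<ge> 0" using ev[of j] ij by auto
      then have "complex_of_real (sqrt (s j - t)) * complex_of_real (sqrt (s j - t)) = of_real (s j - t)"
        by (simp flip: of_real_mult)
      then show ?thesis using True by (simp add: d_def)
    next
      case False
      then have "a (f i) (f j) = 0" using ev ij eigpair_orthogonal[of "s i" "f i" "s j" "f j"] by simp
      then show ?thesis by simp
    qed
  qed
  also have "\<dots> = a G G" by (subst expand[OF a.semi_inner_axioms G_def]) simp
  finally have "Re (b F F - of_real t * a F F) = Re (a G G)" by (rule arg_cong)
  then have "Re (b F F) - t * Re (a F F) = Re (a G G)" by simp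
  then show ?thesis using a.nonneg[OF GV] by (simp add: a.nsq_def b.nsq_def)
qed

text \<open>Rayleigh quotient argument: \<open>b.nsq\<close> is maximized over the
  \<open>a\<close>-unit ball of W, the \<open>a\<close>-orthogonal complement of the eigenvectors
  found so far. The vector v makes the maximum at least t, and the first-order condition at a
  maximizer is the eigenvalue equation.\<close>

lemma maximal_eigpair:
  fixes k :: nat
  assumes e: "\<And>i. i < k \<Longrightarrow> eigpair (s i) (e i) \<and> s i > 0"
    and ortho: "\<And>i j. i < k \<Longrightarrow> j < k \<Longrightarrow> i \<noteq> j \<Longrightarrow> a (e i) (e j) = 0"
    and v: "v \<in> V" "\<And>i. i < k \<Longrightarrow> a v (e i) = 0" "a.nsq v > 0" "b.nsq v \<ge> t * a.nsq v" and t: "t > 0"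
  shows "\<exists>g \<mu>. eigpair \<mu> g \<and> \<mu> \<ge> t \<and> (\<forall>i<k. a g (e i) = 0)"
proof -
  define W where "W = {f \<in> V. \<forall>i<k. a f (e i) = 0}"
  have eV: "e i \<in> V" if "i < k" for i using e that by (auto simp: eigpair_def)
  have W0: "(\<lambda>_. 0) \<in> W" by (auto simp: W_def a.V_zero a.zero_left eV)
  have Wadd: "(\<lambda>x. f x + g x) \<in> W" if "f \<in> W" "g \<in> W" for f g
    using that by (auto simp: W_def a.V_add a.add_left eV)
  have Wsc: "(\<lambda>x. c * f x) \<in> W" if "f \<in> W" for f c
    using that by (auto simp: W_def a.V_scale a.scale_left eV)
  have WV: "W \<subseteq> V" by (auto simp: W_def)
  \<comment> \<open>W is also \<open>b\<close>-orthogonal to the \<open>e i\<close>, because they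
    are eigenvectors.\<close>
  have Wb: "b f (e i) = 0" if "f \<in> W" "i < k" for f i
  proof -
    have "b f (e i) = cnj (b (e i) f)" using that WV eV by (auto intro: b.commute)
    also have "\<dots> = of_real (s i) * cnj (a (e i) f)" using e that WV by (auto simp: eigpair_def)
    also have "\<dots> = of_real (s i) * a f (e i)" using a.commute[of "e i" f] that WV eV by auto
    finally show ?thesis using that by (simp add: W_def)
  qed
  \<comment> \<open>The ball instead of the sphere: a limit of maximizing vectors is only known to
    stay in the ball.\<close>
  define S where "S = b.nsq ` {f \<in> W. a.nsq f \<le> 1}"
  define \<mu> where "\<mu> = Sup S"
  have Sne: "S \<noteq> {}" using W0 by (auto simp: S_def a.nsq_def a.zero_left a.V_zero intro!: exI[of _ "\<lambda>_. 0"])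
  have Sb: "bdd_above S"
  proof (rule bdd_aboveI)
    fix x assume "x \<in> S"
    then obtain f where f: "f \<in> W" "a.nsq f \<le> 1" "x = b.nsq f" by (auto simp: S_def)
    then have fV: "f \<in> V" using WV by auto
    have "x \<le> C * a.nsq f" using f bounded fV by simp
    also have "\<dots> \<le> \<bar>C\<bar> * 1" using f a.nsq_nonneg[OF fV] by (intro mult_mono) auto
    finally show "x \<le> \<bar>C\<bar>" by simp
  qed
  have bound: "b.nsq f \<le> \<mu> * a.nsq f" if f: "f \<in> W" for f
  proof (cases "a.nsq f = 0")
    case True
    then show ?thesis using bounded[of f] f WV by auto
  next
    case False
    then have p: "a.nsq f > 0" using a.nsq_nonneg f WV by fastforce
    define c where "c = complex_of_real (1 / sqrt (a.nsq f))"
    have c2: "(cmod c)\<^sup>2 = 1 / a.nsq f" using p by (simp add: c_def norm_divide power_divide)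
    have fV: "f \<in> V" using f WV by auto
    have "b.nsq (\<lambda>x. c * f x) \<in> S"
      unfolding S_def using Wsc[OF f, of c] p c2 by (auto simp: a.nsq_scale[OF fV])
    then have "b.nsq (\<lambda>x. c * f x) \<le> \<mu>" unfolding \<mu>_def using Sb by (rule cSup_upper)
    then show ?thesis using p by (simp add: b.nsq_scale[OF fV] c2 field_simps)
  qed
  have vW: "v \<in> W" using v by (simp add: W_def)
  have mu_t: "\<mu> \<ge> t"
  proof -
    have "t * a.nsq v \<le> \<mu> * a.nsq v" using bound[OF vW] v by linarith
    then show ?thesis using v by simp
  qed
  have "\<exists>f\<in>W. a.nsq f \<le> 1 \<and> b.nsq f > \<mu> - 1 / real (Suc j)" for j
  proof -
    have "\<mu> - 1 / real (Suc j) < Sup S" by (simp add: \<mu>_def)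
    then obtain x where "x \<in> S" "x > \<mu> - 1 / real (Suc j)" using less_cSupE[OF _ Sne] by blast
    then show ?thesis by (auto simp: S_def)
  qed
  then obtain f where f: "\<And>j. f j \<in> W" "\<And>j. a.nsq (f j) \<le> 1" "\<And>j. b.nsq (f j) > \<mu> - 1 / real (Suc j)"
    by metis
  have fV: "f j \<in> V" for j using f WV by auto
  obtain r g where r: "strict_mono r" and g: "g \<in> V" "a.nsq g \<le> 1"
    and lim: "(\<lambda>j. b.nsq (\<lambda>x. f (r j) x - g x)) \<longlonglongrightarrow> 0"
    using compact[of f] fV f(2) by blast
  \<comment> \<open>Convergence holds for \<open>b\<close> only, so orthogonality is carried to the
    limit through \<open>b\<close> and brought back to \<open>a\<close> by cancelling
    \<open>s i > 0\<close>.\<close>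
  have gW: "g \<in> W"
  proof -
    have "a g (e i) = 0" if i: "i < k" for i
    proof -
      have "(\<lambda>j. b (f (r j)) (e i)) \<longlonglongrightarrow> b g (e i)"
        using b.tendsto_ip_left[OF fV g(1) eV[OF i] lim] .
      then have "b g (e i) = 0" using Wb[OF f(1) i] by (simp add: LIMSEQ_const_iff)
      then have "b (e i) g = 0" using b.commute[of g "e i"] g eV i by simp
      then have "a (e i) g = 0" using e[OF i] g by (auto simp: eigpair_def)
      then show ?thesis using a.commute[of "e i" g] g eV i by simp
    qed
    then show ?thesis using g by (simp add: W_def)
  qed
  have nb: "b.nsq g \<ge> \<mu>"
  proof (rule LIMSEQ_le)
    show "(\<lambda>j. b.nsq (f (r j))) \<longlonglongrightarrow> b.nsq g" using b.tendsto_nsq[OF fV g(1) lim] .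
    show "(\<lambda>j. \<mu> - 1 / real (Suc j)) \<longlonglongrightarrow> \<mu>"
      using tendsto_diff[OF tendsto_const LIMSEQ_inverse_real_of_nat, of \<mu>] by (simp add: inverse_eq_divide)
    show "\<exists>N. \<forall>n\<ge>N. \<mu> - 1 / real (Suc n) \<le> b.nsq (f (r n))"
    proof (intro exI allI impI)
      fix n :: nat
      have "1 / real (Suc (r n)) \<le> 1 / real (Suc n)"
        using seq_suble[OF r, of n] by (intro divide_left_mono) auto
      then show "\<mu> - 1 / real (Suc n) \<le> b.nsq (f (r n))" using f(3)[of "r n"] by linarith
    qed
  qed
  have mu0: "\<mu> > 0" using mu_t t by simp
  \<comment> \<open>From \<open>\<mu> \<le> b.nsq g \<le> \<mu> * a.nsq g \<le> \<mu>\<close>; since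
    \<mu> > 0 this also excludes \<open>a.nsq g = 0\<close>.\<close>
  have eq: "b.nsq g = \<mu> * a.nsq g"
  proof (rule antisym)
    show "b.nsq g \<le> \<mu> * a.nsq g" by (rule bound) fact
    show "\<mu> * a.nsq g \<le> b.nsq g" using nb g(2) mult_left_mono[of "a.nsq g" 1 \<mu>] mu0 by linarith
  qed
  have gpos: "a.nsq g > 0" using eq nb mu0 a.nsq_nonneg[OF g(1)] by (cases "a.nsq g = 0") auto
  \<comment> \<open>By maximality q is semidefinite on W, and g is a null vector of it;
    \<open>null_left\<close> puts g into the kernel of q, which is the eigenvalue equation tested on
    W.\<close>
  define q where "q = (\<lambda>f h. of_real \<mu> * a f h - b f h)"
  have qW: "semi_inner W q"
  proof
    fix f g h :: "'a \<Rightarrow> complex" and c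
    assume "f \<in> W" "g \<in> W" "h \<in> W"
    then show "q (\<lambda>x. f x + g x) h = q f h + q g h"
      using WV by (simp add: q_def a.add_left b.add_left subset_iff algebra_simps)
  next
    fix f h :: "'a \<Rightarrow> complex" and c
    assume "f \<in> W" "h \<in> W"
    then show "q (\<lambda>x. c * f x) h = c * q f h"
      using WV by (simp add: q_def a.scale_left b.scale_left subset_iff algebra_simps)
  next
    fix f g :: "'a \<Rightarrow> complex"
    assume "f \<in> W" "g \<in> W"
    then show "q g f = cnj (q f g)"
      using WV a.commute[of f g] b.commute[of f g] by (simp add: q_def subset_iff)
  next
    fix f :: "'a \<Rightarrow> complex"
    assume "f \<in> W"
    then show "0 \<le> Re (q f f)"
      using bound[of f] by (simp add: q_def a.nsq_def b.nsq_def)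
  qed (use W0 Wadd Wsc in auto)
  interpret q: semi_inner W q by (rule qW)
  have q0: "q.nsq g = 0" unfolding q.nsq_def using eq by (simp add: q_def a.nsq_def b.nsq_def)
  have qg: "b g h = of_real \<mu> * a g h" if h: "h \<in> W" for h
  proof -
    have "q h g = 0" using q.null_left[OF h gW q0] .
    then have "q g h = 0" using q.commute[OF h gW] by simp
    then show ?thesis by (simp add: q_def)
  qed
  \<comment> \<open>From W to V: h differs from an element of W by its projection p onto the span of
    the \<open>e i\<close>, and both \<open>a g p\<close> and \<open>b g p\<close> vanish.\<close>
  have "b g h = of_real \<mu> * a g h" if h: "h \<in> V" for h
  proof -
    define c where "c = (\<lambda>i. a h (e i) / a (e i) (e i))"
    define p where "p = (\<lambda>x. \<Sum>i<k. c i * e i x)"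
    have pV: "p \<in> V" unfolding p_def by (rule a.V_lincomb) (auto intro: eV)
    have ap: "a p (e j) = a h (e j)" if j: "j < k" for j
    proof -
      have "a p (e j) = (\<Sum>i<k. c i * a (e i) (e j))"
        unfolding p_def by (rule a.lincomb_left) (auto simp: eV j)
      also have "\<dots> = (\<Sum>i<k. if i = j then c j * a (e j) (e j) else 0)"
        by (intro sum.cong refl) (auto simp: ortho j)
      also have "\<dots> = c j * a (e j) (e j)" using j by simp
      also have "\<dots> = a h (e j)"
        using e[OF j] by (auto simp: c_def eigpair_def a.nsq_def)
      finally show ?thesis .
    qed
    have W': "(\<lambda>x. h x - p x) \<in> W"
      by (auto simp: W_def a.V_diff h pV a.diff_left eV ap)
    have ap0: "a g p = 0"
      unfolding p_def using gW by (subst a.lincomb_right) (auto simp: eV g W_def)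
    have bp0: "b g p = 0"
      unfolding p_def using Wb[OF gW] by (subst b.lincomb_right) (auto simp: eV g)
    have hh: "h = (\<lambda>x. (h x - p x) + p x)" by simp
    have "b g h = b g (\<lambda>x. h x - p x) + b g p"
      by (subst hh) (rule b.add_right, use a.V_diff h pV g in auto)
    moreover have "a g h = a g (\<lambda>x. h x - p x) + a g p"
      by (subst hh) (rule a.add_right, use a.V_diff h pV g in auto)
    ultimately show ?thesis using qg[OF W'] ap0 bp0 by simp
  qed
  then have "eigpair \<mu> g" using g gpos by (auto simp: eigpair_def)
  then show ?thesis using mu_t gW by (auto simp: W_def)
qed

text \<open>Lower half of the min-max principle. As long as only k < n eigenvectors are known, the
  n-dimensional test space contains a nonzero vector orthogonal to all of them, and
  \<open>maximal_eigpair\<close> turns it into the next eigenvector.\<close>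

lemma eigpairs_exist:
  fixes n :: nat
  assumes v: "\<And>i. i < n \<Longrightarrow> v i \<in> V"
    and pos: "\<And>c. (\<exists>i<n. c i \<noteq> 0) \<Longrightarrow> a.nsq (\<lambda>x. \<Sum>i<n. c i * v i x) > 0"
    and low: "\<And>c. b.nsq (\<lambda>x. \<Sum>i<n. c i * v i x) \<ge> t * a.nsq (\<lambda>x. \<Sum>i<n. c i * v i x)"
    and t: "t > 0"
  shows "\<exists>e s. (\<forall>i<n. eigpair (s i) (e i) \<and> s i \<ge> t) \<and> (\<forall>i<n. \<forall>j<n. i \<noteq> j \<longrightarrow> a (e i) (e j) = 0)"
proof -
  have "\<exists>e s. (\<forall>i<k. eigpair (s i) (e i) \<and> s i \<ge> t) \<and> (\<forall>i<k. \<forall>j<k. i \<noteq> j \<longrightarrow> a (e i) (e j) = 0)"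
    if "k \<le> n" for k
    using that
  proof (induction k)
    case 0
    then show ?case by simp
  next
    case (Suc k)
    then have "k \<le> n" by simp
    from Suc.IH[OF this] obtain e s where e: "\<forall>i<k. eigpair (s i) (e i) \<and> s i \<ge> t" "\<forall>i<k. \<forall>j<k. i \<noteq> j \<longrightarrow> a (e i) (e j) = 0"
      by (elim exE conjE) (rule that)
    have eV: "e i \<in> V" if "i < k" for i using e(1) that by (auto simp: eigpair_def)
    obtain c where c: "\<exists>i\<in>{..<n}. c i \<noteq> 0" "\<forall>j<k. (\<Sum>i<n. c i * a (v i) (e j)) = 0"
      using homogeneous_system_nontrivial[of "{..<n}" k "\<lambda>j i. a (v i) (e j)"] Suc.prems by auto
    define w where "w = (\<lambda>x. \<Sum>i<n. c i * v i x)"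
    have wV: "w \<in> V" unfolding w_def by (rule a.V_lincomb) (auto intro: v)
    have we: "a w (e j) = 0" if "j < k" for j
      unfolding w_def using c that by (subst a.lincomb_left) (auto simp: v eV)
    have "\<exists>g \<mu>. eigpair \<mu> g \<and> \<mu> \<ge> t \<and> (\<forall>i<k. a g (e i) = 0)"
    proof (rule maximal_eigpair)
      show "a.nsq w > 0" unfolding w_def using c by (intro pos) auto
      show "b.nsq w \<ge> t * a.nsq w" unfolding w_def by (rule low)
      show "eigpair (s i) (e i) \<and> 0 < s i" if "i < k" for i using e(1)[rule_format, OF that] t by auto
      show "a (e i) (e j) = 0" if "i < k" "j < k" "i \<noteq> j" for i j using e(2) that by blast
    qed (fact wV we t)+
    then obtain g \<mu> where g: "eigpair \<mu> g" "\<mu> \<ge> t" "\<And>i. i < k \<Longrightarrow> a g (e i) = 0" by blast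
    have gV: "g \<in> V" using g by (simp add: eigpair_def)
    have g': "a (e i) g = 0" if "i < k" for i
      using a.commute[OF gV eV[OF that]] g(3)[OF that] by simp
    show ?case
    proof (intro exI[of _ "e(k := g)"] exI[of _ "s(k := \<mu>)"] conjI allI impI)
      fix i assume "i < Suc k"
      then show "eigpair ((s(k := \<mu>)) i) ((e(k := g)) i)" "t \<le> (s(k := \<mu>)) i"
        using e(1) g(1,2) by (auto simp: less_Suc_eq)
    next
      fix i j assume "i < Suc k" "j < Suc k" "i \<noteq> j"
      then show "a ((e(k := g)) i) ((e(k := g)) j) = 0"
        using e(2) g(3) g' by (auto simp: less_Suc_eq)
    qed
  qed
  from this[OF order_refl] show ?thesis .
qed

end

section \<open>Normalized area measure on the disc\<close>

lemma lborel_complex_eq_distr: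
  "(lborel :: complex measure) = distr (lborel \<Otimes>\<^sub>M lborel) borel (\<lambda>(x, y). Complex x y)"
proof -
  have m: "(\<lambda>(x, y). Complex x y) \<in> borel_measurable (lborel \<Otimes>\<^sub>M lborel)"
    unfolding Complex_eq split_beta' by measurable
  show ?thesis
  proof (rule lborel_eqI)
    fix l u :: complex
    assume lu: "\<And>b. b \<in> Basis \<Longrightarrow> l \<bullet> b \<le> u \<bullet> b"
    have le: "Re l \<le> Re u" "Im l \<le> Im u" using lu[of 1] lu[of \<i>] by (auto simp: Basis_complex_def inner_complex_def)
    have pre: "(\<lambda>(x, y). Complex x y) -` box l u \<inter> space (lborel \<Otimes>\<^sub>M lborel) = {Re l<..<Re u} \<times> {Im l<..<Im u}"
      by (auto simp: box_def Basis_complex_def inner_complex_def space_pair_measure)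
    have "emeasure (distr (lborel \<Otimes>\<^sub>M lborel) borel (\<lambda>(x, y). Complex x y)) (box l u) =
        emeasure (lborel \<Otimes>\<^sub>M lborel) ({Re l<..<Re u} \<times> {Im l<..<Im u})"
      using m by (subst emeasure_distr) (auto simp: pre)
    also have "\<dots> = ennreal (Re u - Re l) * ennreal (Im u - Im l)"
      using le by (subst lborel.emeasure_pair_measure_Times) auto
    also have "\<dots> = (\<Prod>b\<in>Basis. (u - l) \<bullet> b)"
      using le by (simp add: Basis_complex_def inner_complex_def ennreal_mult')
    finally show "emeasure (distr (lborel \<Otimes>\<^sub>M lborel) borel (\<lambda>(x, y). Complex x y)) (box l u) =
        (\<Prod>b\<in>Basis. (u - l) \<bullet> b)" .
  qed simp
qed

text \<open>Both orders of integration are recorded, one for each direction of shear below.\<close>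

lemma nn_integral_lborel_complex:
  fixes f :: "complex \<Rightarrow> ennreal"
  assumes "f \<in> borel_measurable borel"
  shows "(\<integral>\<^sup>+z. f z \<partial>lborel) = (\<integral>\<^sup>+y. \<integral>\<^sup>+x. f (Complex x y) \<partial>lborel \<partial>lborel)"
    and "(\<integral>\<^sup>+z. f z \<partial>lborel) = (\<integral>\<^sup>+x. \<integral>\<^sup>+y. f (Complex x y) \<partial>lborel \<partial>lborel)"
proof -
  have m: "(\<lambda>(x, y). Complex x y) \<in> borel_measurable (lborel \<Otimes>\<^sub>M lborel)"
    unfolding Complex_eq split_beta' by measurable
  have fm: "(\<lambda>p. f (case p of (x, y) \<Rightarrow> Complex x y)) \<in> borel_measurable (lborel \<Otimes>\<^sub>M lborel)"
    using measurable_compose[OF m, of f borel] assms by simp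
  have 1: "(\<integral>\<^sup>+z. f z \<partial>lborel) = (\<integral>\<^sup>+p. f (case p of (x, y) \<Rightarrow> Complex x y) \<partial>(lborel \<Otimes>\<^sub>M lborel))"
    using assms m by (subst lborel_complex_eq_distr) (simp add: nn_integral_distr)
  show "(\<integral>\<^sup>+z. f z \<partial>lborel) = (\<integral>\<^sup>+y. \<integral>\<^sup>+x. f (Complex x y) \<partial>lborel \<partial>lborel)"
    unfolding 1 using lborel_pair.nn_integral_snd[OF fm] by simp
  show "(\<integral>\<^sup>+z. f z \<partial>lborel) = (\<integral>\<^sup>+x. \<integral>\<^sup>+y. f (Complex x y) \<partial>lborel \<partial>lborel)"
    unfolding 1 using lborel.nn_integral_fst[OF fm] by simp
qed

definition preserves_area :: "(complex \<Rightarrow> complex) \<Rightarrow> bool" where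
  "preserves_area T \<longleftrightarrow> T \<in> borel_measurable borel \<and> distr lborel borel T = lborel"

lemma preserves_area_comp:
  assumes "preserves_area S" "preserves_area T"
  shows "preserves_area (\<lambda>z. S (T z))"
proof -
  have m: "S \<in> borel_measurable borel" "T \<in> borel_measurable borel"
    using assms by (auto simp: preserves_area_def)
  have "distr lborel borel (\<lambda>z. S (T z)) = distr (distr lborel borel T) borel S"
    using m by (subst distr_distr) (auto simp: comp_def)
  then show ?thesis using assms m by (auto simp: preserves_area_def)
qed

lemma preserves_areaI:
  assumes m: "T \<in> borel_measurable borel"
    and nn: "\<And>f :: complex \<Rightarrow> ennreal. f \<in> borel_measurable borel \<Longrightarrow> (\<integral>\<^sup>+z. f (T z) \<partial>lborel) = (\<integral>\<^sup>+z. f z \<partial>lborel)"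
  shows "preserves_area T"
proof -
  have "distr lborel borel T = lborel"
  proof (rule measure_eqI)
    fix A assume "A \<in> sets (distr lborel borel T)"
    then have A[measurable]: "A \<in> sets borel" by simp
    have "emeasure (distr lborel borel T) A = (\<integral>\<^sup>+z. indicator A z \<partial>distr lborel borel T)" by simp
    also have "\<dots> = (\<integral>\<^sup>+z. indicator A (T z) \<partial>lborel)"
      using m by (subst nn_integral_distr) auto
    also have "\<dots> = emeasure lborel A" by (subst nn) auto
    finally show "emeasure (distr lborel borel T) A = emeasure lborel A" .
  qed simp
  then show ?thesis using m by (simp add: preserves_area_def)
qed

text \<open>On each line parallel to the shear the map is a translation, so Fubini reduces the claim
  to translation invariance on the real line.\<close>

lemma preserves_area_shear:
  "preserves_area (\<lambda>z. z + of_real (a * Im z))"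
  "preserves_area (\<lambda>z. z + \<i> * of_real (a * Re z))"
proof -
  have tr: "(\<integral>\<^sup>+x. g (x + c) \<partial>lborel) = (\<integral>\<^sup>+x. g x \<partial>lborel)" if "g \<in> borel_measurable borel" for g :: "real \<Rightarrow> ennreal" and c
    using nn_integral_real_affine[OF that, of 1 c] by (simp add: add.commute)
  show "preserves_area (\<lambda>z. z + of_real (a * Im z))"
  proof (rule preserves_areaI)
    fix f :: "complex \<Rightarrow> ennreal" assume f[measurable]: "f \<in> borel_measurable borel"
    have "(\<integral>\<^sup>+z. f (z + of_real (a * Im z)) \<partial>lborel) =
        (\<integral>\<^sup>+y. \<integral>\<^sup>+x. f (Complex x y + of_real (a * Im (Complex x y))) \<partial>lborel \<partial>lborel)"
      by (rule nn_integral_lborel_complex(1)) measurable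
    also have "\<dots> = (\<integral>\<^sup>+y. \<integral>\<^sup>+x. f (Complex (x + a * y) y) \<partial>lborel \<partial>lborel)"
      by (intro nn_integral_cong arg_cong[of _ _ f]) (simp add: complex_eq_iff)
    also have "\<dots> = (\<integral>\<^sup>+y. \<integral>\<^sup>+x. f (Complex x y) \<partial>lborel \<partial>lborel)"
    proof (rule nn_integral_cong)
      fix y :: real
      have "(\<lambda>x. f (Complex x y)) \<in> borel_measurable borel" unfolding Complex_eq by measurable
      then show "(\<integral>\<^sup>+x. f (Complex (x + a * y) y) \<partial>lborel) = (\<integral>\<^sup>+x. f (Complex x y) \<partial>lborel)" using tr[of "\<lambda>x. f (Complex x y)" "a * y"] by simp
    qed
    also have "\<dots> = (\<integral>\<^sup>+z. f z \<partial>lborel)" by (rule nn_integral_lborel_complex(1)[symmetric]) fact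
    finally show "(\<integral>\<^sup>+z. f (z + of_real (a * Im z)) \<partial>lborel) = (\<integral>\<^sup>+z. f z \<partial>lborel)" .
  qed measurable
  show "preserves_area (\<lambda>z. z + \<i> * of_real (a * Re z))"
  proof (rule preserves_areaI)
    fix f :: "complex \<Rightarrow> ennreal" assume f[measurable]: "f \<in> borel_measurable borel"
    have "(\<integral>\<^sup>+z. f (z + \<i> * of_real (a * Re z)) \<partial>lborel) =
        (\<integral>\<^sup>+x. \<integral>\<^sup>+y. f (Complex x y + \<i> * of_real (a * Re (Complex x y))) \<partial>lborel \<partial>lborel)"
      by (rule nn_integral_lborel_complex(2)) measurable
    also have "\<dots> = (\<integral>\<^sup>+x. \<integral>\<^sup>+y. f (Complex x (y + a * x)) \<partial>lborel \<partial>lborel)"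
      by (intro nn_integral_cong arg_cong[of _ _ f]) (simp add: complex_eq_iff)
    also have "\<dots> = (\<integral>\<^sup>+x. \<integral>\<^sup>+y. f (Complex x y) \<partial>lborel \<partial>lborel)"
    proof (rule nn_integral_cong)
      fix x :: real
      have "(\<lambda>y. f (Complex x y)) \<in> borel_measurable borel" unfolding Complex_eq by measurable
      then show "(\<integral>\<^sup>+y. f (Complex x (y + a * x)) \<partial>lborel) = (\<integral>\<^sup>+y. f (Complex x y) \<partial>lborel)" using tr[of "\<lambda>y. f (Complex x y)" "a * x"] by simp
    qed
    also have "\<dots> = (\<integral>\<^sup>+z. f z \<partial>lborel)" by (rule nn_integral_lborel_complex(2)[symmetric]) fact
    finally show "(\<integral>\<^sup>+z. f (z + \<i> * of_real (a * Re z)) \<partial>lborel) = (\<integral>\<^sup>+z. f z \<partial>lborel)" .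
  qed measurable
qed

text \<open>A rotation other than \<open>z \<mapsto> -z\<close> is a product of three shears, with
  \<open>t = tan (\<theta> / 2)\<close> written as \<open>sin \<theta> / (1 + cos \<theta>)\<close>.\<close>

lemma preserves_area_rotation:
  assumes "cmod \<omega> = 1"
  shows "preserves_area (\<lambda>z. \<omega> * z)"
proof -
  have *: "preserves_area (\<lambda>z. \<omega> * z)" if w: "cmod \<omega> = 1" "Re \<omega> \<noteq> -1" for \<omega>
  proof -
    define c s where "c = Re \<omega>" and "s = Im \<omega>"
    define t where "t = s / (1 + c)"
    have cs: "c\<^sup>2 + s\<^sup>2 = 1" using w by (simp add: c_def s_def cmod_def)
    have c: "1 + c \<noteq> 0" using w by (simp add: c_def)
    have t1: "t * (1 + c) = s" using c by (simp add: t_def)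
    have "s * t * (1 + c) = s * s" using t1 by (simp add: mult.assoc)
    also have "\<dots> = (1 - c) * (1 + c)" using cs by (simp add: power2_eq_square algebra_simps)
    finally have t2: "s * t = 1 - c" using c by simp
    define S1 where "S1 = (\<lambda>z. z + complex_of_real ((-t) * Im z))"
    define S2 where "S2 = (\<lambda>z. z + \<i> * complex_of_real (s * Re z))"
    have "\<omega> * z = S1 (S2 (S1 z))" for z
    proof -
      obtain x y where z: "z = Complex x y" by (cases z)
      have o: "\<omega> = Complex c s" by (simp add: c_def s_def)
      have i: "Im (S1 (S2 (S1 z))) = y + s * (x - t * y)" by (simp add: S1_def S2_def z)
      also have "\<dots> = s * x + (1 - s * t) * y" by (simp add: algebra_simps)
      finally have i': "Im (S1 (S2 (S1 z))) = s * x + c * y" by (simp add: t2)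
      have "Re (S1 (S2 (S1 z))) = (x - t * y) - t * (y + s * (x - t * y))" by (simp add: S1_def S2_def z)
      also have "\<dots> = (1 - s * t) * x - t * (1 + (1 - s * t)) * y" by (simp add: algebra_simps)
      also have "\<dots> = c * x - s * y" by (simp add: t1 t2)
      finally show ?thesis using i' by (simp add: complex_eq_iff o z)
    qed
    moreover have "preserves_area S1" "preserves_area S2"
      unfolding S1_def S2_def by (rule preserves_area_shear)+
    ultimately show ?thesis
      using preserves_area_comp[of S1 "\<lambda>z. S2 (S1 z)"] preserves_area_comp[of S2 S1] by simp
  qed
  show ?thesis
  proof (cases "Re \<omega> = -1")
    case False
    then show ?thesis using * assms by blast
  next
    \<comment> \<open>Here the denominator 1 + cos \<theta> vanishes; a half turn is two quarter
      turns.\<close>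
    case True
    then have "\<omega> = \<i> * \<i>" using assms by (auto simp: cmod_def complex_eq_iff)
    then have "(\<lambda>z. \<omega> * z) = (\<lambda>z. \<i> * (\<i> * z))" by (auto simp: mult.assoc)
    then show ?thesis using preserves_area_comp[OF *[of \<i>] *[of \<i>]] by simp
  qed
qed

section \<open>Area measure on the disc as a probability measure\<close>

definition dA :: "complex measure" where
  "dA = density (restrict_space lborel (ball 0 1)) (\<lambda>_. ennreal (1 / pi))"

lemma space_dA [simp]: "space dA = ball 0 1"
  by (simp add: dA_def space_restrict_space)

lemma sets_dA [measurable_cong]: "sets dA = sets (restrict_space borel (ball 0 1))"
  by (simp add: dA_def sets_restrict_space)

lemma emeasure_dA: "A \<in> sets dA \<Longrightarrow> emeasure dA A = ennreal (1 / pi) * emeasure lborel A"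
  by (auto simp: dA_def emeasure_density_const emeasure_restrict_space sets_restrict_space)

lemma sets_dA_I: "A \<in> sets borel \<Longrightarrow> A \<subseteq> ball 0 1 \<Longrightarrow> A \<in> sets dA"
  by (auto simp: sets_dA sets_restrict_space)

lemma prob_space_dA: "prob_space dA"
proof
  show "emeasure dA (space dA) = 1"
    by (simp add: emeasure_dA sets_dA_I emeasure_ball unit_ball_vol_2 flip: ennreal_mult')
qed

interpretation dA: prob_space dA by (rule prob_space_dA)

lemma borel_measurable_dA_eq: "borel_measurable dA = borel_measurable (restrict_space borel (ball 0 1))"
  by (rule measurable_cong_sets[OF sets_dA refl])

lemma measurable_dA_borel: "f \<in> borel_measurable borel \<Longrightarrow> f \<in> borel_measurable dA"
  using measurable_restrict_space1[of f borel borel "ball 0 1"] by (simp only: borel_measurable_dA_eq)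

lemma continuous_on_measurable_dA:
  "continuous_on (ball 0 1) f \<Longrightarrow> f \<in> borel_measurable dA"
  using borel_measurable_continuous_on_restrict[of "ball 0 1" f] by (simp only: borel_measurable_dA_eq)

lemma holomorphic_on_measurable_dA:
  "f holomorphic_on ball 0 1 \<Longrightarrow> f \<in> borel_measurable dA"
  by (intro continuous_on_measurable_dA holomorphic_on_imp_continuous_on)

lemma integrable_dA_iff:
  fixes f :: "complex \<Rightarrow> 'b::{banach, second_countable_topology}"
  shows "integrable dA f \<longleftrightarrow> set_integrable lborel (ball 0 1) f"
proof -
  have "integrable dA f \<longleftrightarrow> integrable (restrict_space lborel (ball 0 1)) f"
  proof (cases "f \<in> borel_measurable (restrict_space lborel (ball 0 1))")
    case True
    then have "integrable dA f \<longleftrightarrow> integrable (restrict_space lborel (ball 0 1)) (\<lambda>x. (1 / pi) *\<^sub>R f x)"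
      unfolding dA_def by (subst integrable_density) auto
    also have "\<dots> \<longleftrightarrow> integrable (restrict_space lborel (ball 0 1)) f"
      using Bochner_Integration.integrable_scaleR_right[of pi "restrict_space lborel (ball 0 1)" "\<lambda>x. (1 / pi) *\<^sub>R f x"]
        Bochner_Integration.integrable_scaleR_right[of "1 / pi" "restrict_space lborel (ball 0 1)" f] by auto
    finally show ?thesis .
  next
    case False
    moreover have "f \<notin> borel_measurable dA" using False by (simp add: dA_def)
    ultimately show ?thesis using borel_measurable_integrable by blast
  qed
  then show ?thesis by (simp add: integrable_restrict_space set_integrable_def)
qed

lemma LINT_dA:
  fixes f :: "complex \<Rightarrow> 'b::{banach, second_countable_topology}"
  shows "(LINT z|dA. f z) = (1 / pi) *\<^sub>R (LINT z:ball 0 1|lborel. f z)"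
proof -
  have "(LINT z|dA. f z) = (1 / pi) *\<^sub>R (LINT z|restrict_space lborel (ball 0 1). f z)"
  proof (cases "f \<in> borel_measurable (restrict_space lborel (ball 0 1))")
    case True
    then show ?thesis unfolding dA_def by (subst integral_density) auto
  next
    \<comment> \<open>A nonmeasurable f is integrable for neither measure, so both integrals have
      the default value 0.\<close>
    case False
    moreover have "f \<notin> borel_measurable dA" using False by (simp add: dA_def)
    ultimately show ?thesis by (metis borel_measurable_integrable not_integrable_integral_eq scaleR_zero_right)
  qed
  then show ?thesis by (simp add: integral_restrict_space set_lebesgue_integral_def)
qed

lemma dA_int_eq: "dA_int g = (LINT z|dA. g z)"
  by (simp add: dA_int_def LINT_dA scaleR_conv_of_real)

lemma bnorm_eq: "bnorm f = sqrt (LINT z|dA. (cmod (f z))\<^sup>2)"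
  by (simp add: bnorm_def LINT_dA)

lemma bergman_iff: "f \<in> bergman \<longleftrightarrow> f holomorphic_on ball 0 1 \<and> integrable dA (\<lambda>z. (cmod (f z))\<^sup>2)"
  by (simp add: bergman_def integrable_dA_iff)

lemma measurable_dA_rotation:
  assumes "cmod \<omega> = 1"
  shows "(\<lambda>z. \<omega> * z) \<in> measurable dA dA"
proof -
  have "(\<lambda>z. \<omega> * z) \<in> measurable dA (restrict_space borel (ball 0 1))"
    using assms by (intro measurable_restrict_space2 measurable_dA_borel) (auto simp: norm_mult)
  then show ?thesis by (simp only: measurable_cong_sets[OF refl sets_dA])
qed

lemma distr_dA_rotation:
  assumes "cmod \<omega> = 1"
  shows "distr dA dA (\<lambda>z. \<omega> * z) = dA"
proof (rule measure_eqI)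
  have p: "(\<lambda>z. \<omega> * z) \<in> borel_measurable borel" "distr lborel borel (\<lambda>z. \<omega> * z) = lborel"
    using preserves_area_rotation[OF assms] by (auto simp: preserves_area_def)
  note m = measurable_dA_rotation[OF assms]
  fix A assume "A \<in> sets (distr dA dA (\<lambda>z. \<omega> * z))"
  then have A: "A \<in> sets dA" by simp
  then have A': "A \<in> sets borel" "A \<subseteq> ball 0 1" by (auto simp: sets_dA sets_restrict_space)
  have vim: "(\<lambda>z. \<omega> * z) -` A \<inter> space dA = (\<lambda>z. \<omega> * z) -` A"
    using A' assms by (auto simp: norm_mult subset_iff)
  have vs: "(\<lambda>z. \<omega> * z) -` A \<in> sets dA"
    using measurable_sets[OF m A] by (simp only: vim)
  have "emeasure (distr dA dA (\<lambda>z. \<omega> * z)) A = ennreal (1 / pi) * emeasure lborel ((\<lambda>z. \<omega> * z) -` A)"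
    using m A vs by (subst emeasure_distr) (auto simp only: vim emeasure_dA)
  also have "emeasure lborel ((\<lambda>z. \<omega> * z) -` A) = emeasure (distr lborel borel (\<lambda>z. \<omega> * z)) A"
    using p A' by (subst emeasure_distr) auto
  also have "ennreal (1 / pi) * \<dots> = emeasure dA A" by (simp add: p(2) emeasure_dA A)
  finally show "emeasure (distr dA dA (\<lambda>z. \<omega> * z)) A = emeasure dA A" .
qed simp

lemma LINT_dA_rotation:
  fixes f :: "complex \<Rightarrow> 'b::{banach, second_countable_topology}"
  assumes "cmod \<omega> = 1" "f \<in> borel_measurable dA"
  shows "(LINT z|dA. f (\<omega> * z)) = (LINT z|dA. f z)"
  using integral_distr[OF measurable_dA_rotation[OF assms(1)] assms(2)] by (simp add: distr_dA_rotation assms(1))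

lemma integrable_dA_rotation:
  fixes f :: "complex \<Rightarrow> 'b::{banach, second_countable_topology}"
  assumes "cmod \<omega> = 1" "integrable dA f"
  shows "integrable dA (\<lambda>z. f (\<omega> * z))"
  using integrable_distr[OF measurable_dA_rotation[OF assms(1)], of f] assms by (simp add: distr_dA_rotation)

text \<open>The disc of radius sqrt x has normalized area x, so the distribution functions agree.
  This takes the place of polar coordinates for radial integrands.\<close>

lemma distr_dA_norm_square:
  "distr dA borel (\<lambda>z. (cmod z)\<^sup>2) = uniform_measure lborel {0..1}"
proof (rule cdf_unique)
  have m: "(\<lambda>z. (cmod z)\<^sup>2) \<in> borel_measurable dA"
    by (intro measurable_dA_borel) measurable
  show "real_distribution (distr dA borel (\<lambda>z. (cmod z)\<^sup>2))"
    using m by (rule dA.real_distribution_distr)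
  show "real_distribution (uniform_measure lborel {0..1::real})"
    unfolding real_distribution_def real_distribution_axioms_def
    by (auto intro!: prob_space_uniform_measure)
  show "cdf (distr dA borel (\<lambda>z. (cmod z)\<^sup>2)) = cdf (uniform_measure lborel {0..1})"
  proof
    fix x :: real
    have L: "cdf (distr dA borel (\<lambda>z. (cmod z)\<^sup>2)) x = measure dA {z \<in> ball 0 1. (cmod z)\<^sup>2 \<le> x}"
      using m by (simp add: cdf_def measure_distr vimage_def Int_def conj_commute)
    have R: "cdf (uniform_measure lborel {0..1}) x = measure lborel ({0..1} \<inter> {..x})"
      by (simp add: cdf_def)
    consider "x < 0" | "0 \<le> x" "x < 1" | "1 \<le> x" by linarith
    then show "cdf (distr dA borel (\<lambda>z. (cmod z)\<^sup>2)) x = cdf (uniform_measure lborel {0..1}) x"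
    proof cases
      case 1
      then have "\<not> (cmod z)\<^sup>2 \<le> x" for z using zero_le_power2[of "cmod z"] by linarith
      then have "{z \<in> ball 0 1. (cmod z)\<^sup>2 \<le> x} = {}" by blast
      moreover have "{0..1} \<inter> {..x} = {}" using 1 by auto
      ultimately show ?thesis by (simp only: L R measure_empty)
    next
      case 2
      have iff: "(cmod z)\<^sup>2 \<le> x \<longleftrightarrow> cmod z \<le> sqrt x" for z
        by (metis abs_norm_cancel real_sqrt_abs real_sqrt_le_iff)
      have "sqrt x < 1" using 2 by simp
      then have lt: "cmod z < 1" if "cmod z \<le> sqrt x" for z using that by linarith
      then have "{z \<in> ball 0 1. (cmod z)\<^sup>2 \<le> x} = cball 0 (sqrt x)"
        unfolding iff by auto
      moreover have "cball (0::complex) (sqrt x) \<in> sets dA"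
        using lt by (intro sets_dA_I) auto
      ultimately have "measure dA {z \<in> ball 0 1. (cmod z)\<^sup>2 \<le> x} = x"
        using 2 by (simp add: measure_def emeasure_dA emeasure_cball unit_ball_vol_2 flip: ennreal_mult')
      moreover have "{0..1} \<inter> {..x} = {0..x}" using 2 by auto
      ultimately show ?thesis using 2 by (simp add: L R)
    next
      case 3
      have "(cmod z)\<^sup>2 \<le> x" if "cmod z < 1" for z
        using that 3 power_le_one[of "cmod z" 2] by simp
      then have "{z \<in> ball 0 1. (cmod z)\<^sup>2 \<le> x} = space dA" by auto
      moreover have "{0..1} \<inter> {..x} = {0..1}" using 3 by auto
      ultimately show ?thesis using dA.prob_space by (simp add: L R)
    qed
  qed
qed

lemma LINT_dA_radial_power:
  assumes "0 \<le> \<rho>" "\<rho> \<le> 1"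
  shows "(LINT z|dA. indicator (cball 0 \<rho>) z * (cmod z) ^ (2 * k)) = \<rho> ^ (2 * k + 2) / (real k + 1)"
proof -
  have m: "(\<lambda>z. (cmod z)\<^sup>2) \<in> borel_measurable dA"
    by (intro measurable_dA_borel) measurable
  define h where "h = (\<lambda>s::real. indicator {..\<rho>\<^sup>2} s * s ^ k)"
  have h: "h \<in> borel_measurable borel" by (simp add: h_def)
  have "(cmod z)\<^sup>2 \<le> \<rho>\<^sup>2 \<longleftrightarrow> cmod z \<le> \<rho>" for z
    using assms by (simp add: power2_le_iff_abs_le)
  then have "indicator (cball 0 \<rho>) z * (cmod z) ^ (2 * k) = h ((cmod z)\<^sup>2)" for z
    by (simp add: h_def indicator_def power_mult)
  then have eq: "(LINT z|dA. indicator (cball 0 \<rho>) z * (cmod z) ^ (2 * k)) = (LINT s|distr dA borel (\<lambda>z. (cmod z)\<^sup>2). h s)"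
    using m h by (simp add: integral_distr)
  have "uniform_measure lborel {0..1} = density lborel (\<lambda>s::real. ennreal (indicator {0..1} s))"
    by (simp add: uniform_measure_def ennreal_indicator divide_ennreal_def)
  then have "(LINT s|distr dA borel (\<lambda>z. (cmod z)\<^sup>2). h s) = (LINT s|lborel. indicator {0..1} s *\<^sub>R h s)"
    unfolding distr_dA_norm_square using h by (simp add: integral_density)
  also have "\<dots> = (LINT s|lborel. s ^ k * indicator {0..\<rho>\<^sup>2} s)"
    using power_le_one[of \<rho> 2] assms by (intro Bochner_Integration.integral_cong) (auto simp: h_def indicator_def)
  also have "\<dots> = ((\<rho>\<^sup>2) ^ Suc k - 0 ^ Suc k) / Suc k"
    by (rule integral_power) simp
  also have "\<dots> = \<rho> ^ (2 * k + 2) / (real k + 1)"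
    by (simp add: power_mult power2_eq_square add.commute)
  finally show ?thesis using eq by simp
qed

section \<open>Bergman space\<close>

lemma borel_measurable_cnj [measurable (raw)]:
  "f \<in> borel_measurable M \<Longrightarrow> (\<lambda>x. cnj (f x)) \<in> borel_measurable M"
  by (rule borel_measurable_continuous_on[of cnj]) (auto intro: continuous_intros)

definition sq_integrable :: "(complex \<Rightarrow> complex) set" where
  "sq_integrable = {f \<in> borel_measurable dA. integrable dA (\<lambda>z. (cmod (f z))\<^sup>2)}"

lemma sq_integrableD:
  assumes "f \<in> sq_integrable"
  shows "f \<in> borel_measurable dA" "integrable dA (\<lambda>z. (cmod (f z))\<^sup>2)"
  using assms by (auto simp: sq_integrable_def)

lemma norm_mult_le_sum_squares: "cmod a * cmod b \<le> (cmod a)\<^sup>2 + (cmod b)\<^sup>2"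
  using sum_squares_bound[of "cmod a" "cmod b"] zero_le_power2[of "cmod a"] zero_le_power2[of "cmod b"] by linarith

lemma cmod_add_squared_le: "(cmod (a + b))\<^sup>2 \<le> 2 * (cmod a)\<^sup>2 + 2 * (cmod b)\<^sup>2"
proof -
  have "(cmod (a + b))\<^sup>2 \<le> (cmod a + cmod b)\<^sup>2" by (intro power_mono norm_triangle_ineq) simp
  also have "\<dots> \<le> 2 * (cmod a)\<^sup>2 + 2 * (cmod b)\<^sup>2"
    using sum_squares_bound[of "cmod a" "cmod b"] by (simp add: power2_sum)
  finally show ?thesis .
qed

lemma sq_integrable_mult_cnj:
  assumes "f \<in> sq_integrable" "g \<in> sq_integrable"
  shows "integrable dA (\<lambda>z. f z * cnj (g z))"
proof (rule Bochner_Integration.integrable_bound)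
  note [measurable] = sq_integrableD(1)[OF assms(1)] sq_integrableD(1)[OF assms(2)]
  show "integrable dA (\<lambda>z. (cmod (f z))\<^sup>2 + (cmod (g z))\<^sup>2)"
    using assms by (intro Bochner_Integration.integrable_add sq_integrableD)
  show "(\<lambda>z. f z * cnj (g z)) \<in> borel_measurable dA" by measurable
  show "AE z in dA. norm (f z * cnj (g z)) \<le> norm ((cmod (f z))\<^sup>2 + (cmod (g z))\<^sup>2)"
    using norm_mult_le_sum_squares by (auto simp: norm_mult abs_of_nonneg)
qed

lemma sq_integrable_add:
  assumes "f \<in> sq_integrable" "g \<in> sq_integrable"
  shows "(\<lambda>z. f z + g z) \<in> sq_integrable"
proof -
  note [measurable] = sq_integrableD(1)[OF assms(1)] sq_integrableD(1)[OF assms(2)]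
  have "integrable dA (\<lambda>z. (cmod (f z + g z))\<^sup>2)"
  proof (rule Bochner_Integration.integrable_bound)
    show "integrable dA (\<lambda>z. 2 * (cmod (f z))\<^sup>2 + 2 * (cmod (g z))\<^sup>2)"
      using assms by (intro Bochner_Integration.integrable_add integrable_mult_right sq_integrableD)
    show "AE z in dA. norm ((cmod (f z + g z))\<^sup>2) \<le> norm (2 * (cmod (f z))\<^sup>2 + 2 * (cmod (g z))\<^sup>2)"
      using cmod_add_squared_le by (auto simp: abs_of_nonneg)
  qed measurable
  then show ?thesis by (simp add: sq_integrable_def)
qed

lemma sq_integrable_mult_bounded:
  assumes "\<phi> \<in> borel_measurable dA" "\<And>z. z \<in> ball 0 1 \<Longrightarrow> cmod (\<phi> z) \<le> M" "f \<in> sq_integrable"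
  shows "(\<lambda>z. \<phi> z * f z) \<in> sq_integrable"
proof -
  note [measurable] = assms(1) sq_integrableD(1)[OF assms(3)]
  have "integrable dA (\<lambda>z. (cmod (\<phi> z * f z))\<^sup>2)"
  proof (rule Bochner_Integration.integrable_bound)
    show "integrable dA (\<lambda>z. M\<^sup>2 * (cmod (f z))\<^sup>2)"
      using assms by (intro integrable_mult_right sq_integrableD)
    show "AE z in dA. norm ((cmod (\<phi> z * f z))\<^sup>2) \<le> norm (M\<^sup>2 * (cmod (f z))\<^sup>2)"
      using assms(2) by (auto simp: norm_mult power_mult_distrib intro!: mult_right_mono power_mono)
  qed measurable
  then show ?thesis by (simp add: sq_integrable_def)
qed

lemma sq_integrable_bounded:
  assumes "\<phi> \<in> borel_measurable dA" "\<And>z. z \<in> ball 0 1 \<Longrightarrow> cmod (\<phi> z) \<le> M"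
  shows "\<phi> \<in> sq_integrable"
proof -
  have "(\<lambda>_. 1) \<in> sq_integrable" by (simp add: sq_integrable_def)
  from sq_integrable_mult_bounded[OF assms this] show ?thesis by simp
qed

lemma binner_eq: "binner f g = (LINT z|dA. f z * cnj (g z))"
  by (simp add: binner_def dA_int_eq)

interpretation L2: semi_inner sq_integrable binner
proof
  show "(\<lambda>_. 0) \<in> sq_integrable" by (simp add: sq_integrable_def)
next
  fix f g assume "f \<in> sq_integrable" "g \<in> sq_integrable"
  then show "(\<lambda>x. f x + g x) \<in> sq_integrable" by (rule sq_integrable_add)
next
  fix f :: "complex \<Rightarrow> complex" and c assume "f \<in> sq_integrable"
  then show "(\<lambda>x. c * f x) \<in> sq_integrable"
    by (intro sq_integrable_mult_bounded[of "\<lambda>_. c" "cmod c"]) auto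
next
  fix f g h assume "f \<in> sq_integrable" "g \<in> sq_integrable" "h \<in> sq_integrable"
  then show "binner (\<lambda>x. f x + g x) h = binner f h + binner g h"
    by (simp add: binner_eq distrib_right sq_integrable_mult_cnj)
next
  fix f h :: "complex \<Rightarrow> complex" and c
  show "binner (\<lambda>x. c * f x) h = c * binner f h"
    by (simp add: binner_eq mult.assoc)
next
  fix f g assume fg: "f \<in> sq_integrable" "g \<in> sq_integrable"
  show "binner g f = cnj (binner f g)"
    unfolding binner_eq using Bochner_Integration.integral_cnj[of dA "\<lambda>z. f z * cnj (g z)"] by (simp add: mult.commute)
next
  fix f assume f: "f \<in> sq_integrable"
  have "binner f f = (LINT z|dA. complex_of_real ((cmod (f z))\<^sup>2))"
    unfolding binner_eq by (simp only: complex_norm_square)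
  also have "\<dots> = of_real (LINT z|dA. (cmod (f z))\<^sup>2)" by (rule integral_complex_of_real)
  finally show "0 \<le> Re (binner f f)" by simp
qed

lemma L2_nsq: "L2.nsq f = (LINT z|dA. (cmod (f z))\<^sup>2)"
proof -
  have "binner f f = (LINT z|dA. complex_of_real ((cmod (f z))\<^sup>2))"
    unfolding binner_eq by (simp only: complex_norm_square)
  also have "\<dots> = of_real (LINT z|dA. (cmod (f z))\<^sup>2)" by (rule integral_complex_of_real)
  finally show ?thesis by (simp add: L2.nsq_def)
qed

lemma bnorm_nsq: "bnorm f = sqrt (L2.nsq f)"
  by (simp add: bnorm_eq L2_nsq)

lemma L2_nsq_cong: "(\<And>z. z \<in> ball 0 1 \<Longrightarrow> f z = g z) \<Longrightarrow> L2.nsq f = L2.nsq g"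
  unfolding L2_nsq by (rule Bochner_Integration.integral_cong) auto

lemma binner_cong:
  "(\<And>z. z \<in> ball 0 1 \<Longrightarrow> f z = f' z) \<Longrightarrow> (\<And>z. z \<in> ball 0 1 \<Longrightarrow> g z = g' z) \<Longrightarrow> binner f g = binner f' g'"
  unfolding binner_eq by (rule Bochner_Integration.integral_cong) auto

lemma bergman_sq_integrable: "f \<in> bergman \<Longrightarrow> f \<in> sq_integrable"
  by (auto simp: bergman_iff sq_integrable_def holomorphic_on_measurable_dA)

lemma bergman_holomorphic: "f \<in> bergman \<Longrightarrow> f holomorphic_on ball 0 1"
  by (simp add: bergman_iff)

lemma bergmanI: "f holomorphic_on ball 0 1 \<Longrightarrow> f \<in> sq_integrable \<Longrightarrow> f \<in> bergman"
  by (simp add: bergman_iff sq_integrable_def)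

interpretation bergman: semi_inner bergman binner
proof (rule L2.semi_inner_subspace)
  show "(\<lambda>_. 0) \<in> bergman" by (intro bergmanI L2.V_zero) auto
  show "(\<lambda>x. f x + g x) \<in> bergman" if "f \<in> bergman" "g \<in> bergman" for f g
    by (rule bergmanI[OF holomorphic_on_add L2.V_add]; intro bergman_holomorphic bergman_sq_integrable that)
  show "(\<lambda>x. c * f x) \<in> bergman" if "f \<in> bergman" for f c
    by (rule bergmanI[OF holomorphic_on_mult[OF holomorphic_on_const] L2.V_scale];
        intro bergman_holomorphic bergman_sq_integrable that)
qed (auto intro: bergman_sq_integrable)

section \<open>Mass on smaller discs and Taylor coefficients\<close>

definition msq :: "real \<Rightarrow> (complex \<Rightarrow> complex) \<Rightarrow> real" where
  "msq \<rho> f = (LINT z|dA. indicator (cball 0 \<rho>) z * (cmod (f z))\<^sup>2)"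

lemma indicator_cball_measurable [measurable]: "(indicator (cball 0 \<rho>) :: complex \<Rightarrow> 'b::{zero_neq_one,second_countable_topology,real_normed_vector}) \<in> borel_measurable dA"
  by (intro measurable_dA_borel borel_measurable_indicator borel_closed closed_cball)

lemma monomial_measurable: "(\<lambda>z. z ^ j * cnj (z ^ k)) \<in> borel_measurable dA"
  by (intro measurable_dA_borel borel_measurable_continuous_onI continuous_intros)

lemma cnj_monomial_measurable: "(\<lambda>z. cnj (z ^ k)) \<in> borel_measurable dA"
  by (intro measurable_dA_borel borel_measurable_continuous_onI continuous_intros)

lemma integrable_indicator_cball:
  fixes f :: "complex \<Rightarrow> real"
  assumes "integrable dA f"
  shows "integrable dA (\<lambda>z. indicator (cball 0 \<rho>) z * f z)"
proof (rule Bochner_Integration.integrable_bound[OF assms])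
  show "(\<lambda>z. indicator (cball 0 \<rho>) z * f z) \<in> borel_measurable dA"
    using borel_measurable_integrable[OF assms] by measurable
qed (auto simp: indicator_def)

lemma msq_le_nsq: assumes "f \<in> sq_integrable" shows "msq \<rho> f \<le> L2.nsq f"
  unfolding msq_def L2_nsq using sq_integrableD[OF assms]
  by (intro integral_mono integrable_indicator_cball) (auto simp: indicator_def)

lemma bounded_integrable_dA:
  fixes f :: "complex \<Rightarrow> 'b::{banach, second_countable_topology}"
  assumes "f \<in> borel_measurable dA" "\<And>z. z \<in> ball 0 1 \<Longrightarrow> norm (f z) \<le> B"
  shows "integrable dA f"
  using assms by (intro dA.integrable_const_bound[of _ B]) auto

text \<open>Off the diagonal, a rotation whose |j - k|-th power is -1 preserves the measure and
  changes the sign of the integrand, so the integral vanishes.\<close>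

lemma LINT_monomials:
  assumes "0 \<le> \<rho>" "\<rho> \<le> 1"
  shows "(LINT z|dA. indicator (cball 0 \<rho>) z * (z ^ j * cnj (z ^ k))) =
    (if j = k then of_real (\<rho> ^ (2 * k + 2) / (real k + 1)) else 0)"
proof (cases "j = k")
  case True
  have "z ^ k * cnj (z ^ k) = complex_of_real (cmod z ^ (2 * k))" for z
    by (metis complex_norm_square norm_power power_even_eq)
  then have "(LINT z|dA. indicator (cball 0 \<rho>) z * (z ^ j * cnj (z ^ k))) =
      (LINT z|dA. complex_of_real (indicator (cball 0 \<rho>) z * (cmod z) ^ (2 * k)))"
    using True by (intro Bochner_Integration.integral_cong) (auto simp: indicator_def)
  also have "\<dots> = of_real (\<rho> ^ (2 * k + 2) / (real k + 1))"
    by (subst integral_complex_of_real) (simp only: LINT_dA_radial_power[OF assms])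
  finally show ?thesis using True by simp
next
  case False
  define d where "d = (if j > k then j - k else k - j)"
  define \<omega> where "\<omega> = cis (pi / real d)"
  have d: "d > 0" using False by (auto simp: d_def)
  have w: "cmod \<omega> = 1" by (simp add: \<omega>_def)
  have wc: "\<omega> * cnj \<omega> = 1" using complex_norm_square[of \<omega>] w by simp
  have wd: "\<omega> ^ d = -1" unfolding \<omega>_def Complex.DeMoivre using d by simp
  have wcd: "cnj \<omega> ^ d = -1" using arg_cong[OF wd, of cnj] by simp
  have e: "\<omega> ^ j * cnj (\<omega> ^ k) = -1"
  proof (cases "j > k")
    case True
    then have "\<omega> ^ j = \<omega> ^ d * \<omega> ^ k" by (simp add: d_def flip: power_add)
    then have "\<omega> ^ j * cnj (\<omega> ^ k) = \<omega> ^ d * (\<omega> * cnj \<omega>) ^ k" by (simp add: power_mult_distrib)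
    then show ?thesis by (simp add: wc wd)
  next
    case F: False
    then have "\<omega> ^ k = \<omega> ^ d * \<omega> ^ j" by (simp add: d_def flip: power_add)
    then have "\<omega> ^ j * cnj (\<omega> ^ k) = cnj \<omega> ^ d * (\<omega> * cnj \<omega>) ^ j" by (simp add: power_mult_distrib)
    then show ?thesis by (simp add: wc wcd)
  qed
  define F where "F = (\<lambda>z::complex. indicator (cball 0 \<rho>) z * (z ^ j * cnj (z ^ k)))"
  have m: "F \<in> borel_measurable dA" unfolding F_def
    by (intro borel_measurable_times indicator_cball_measurable monomial_measurable)
  have "F (\<omega> * z) = - F z" for z
  proof -
    have "F (\<omega> * z) = indicator (cball 0 \<rho>) z * ((\<omega> ^ j * cnj (\<omega> ^ k)) * (z ^ j * cnj (z ^ k)))"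
      by (simp add: F_def indicator_def norm_mult w power_mult_distrib)
    then show ?thesis by (simp only: e) (simp add: F_def)
  qed
  then have "(LINT z|dA. F z) = - (LINT z|dA. F z)"
    using LINT_dA_rotation[OF w m] by simp
  then have "(LINT z|dA. F z) = 0" by simp
  then show ?thesis using False by (simp add: F_def)
qed

lemma binner_monomials:
  "binner (\<lambda>z. z ^ j) (\<lambda>z. z ^ k) = (if j = k then of_real (1 / (real k + 1)) else 0)"
proof -
  have "binner (\<lambda>z. z ^ j) (\<lambda>z. z ^ k) = (LINT z|dA. indicator (cball 0 1) z * (z ^ j * cnj (z ^ k)))"
    unfolding binner_eq by (intro Bochner_Integration.integral_cong) (auto simp: indicator_def)
  then show ?thesis by (subst (asm) LINT_monomials) auto
qed

lemma monomial_bergman: "(\<lambda>z. z ^ k) \<in> bergman"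
proof (rule bergmanI)
  show "(\<lambda>z. z ^ k) \<in> sq_integrable"
    by (rule sq_integrable_bounded[of _ 1]) (auto simp: norm_power intro!: measurable_dA_borel power_le_one)
qed (intro holomorphic_intros)

lemma LINT_poly_monomial:
  assumes "0 \<le> \<rho>" "\<rho> \<le> 1"
  shows "(LINT z|dA. indicator (cball 0 \<rho>) z * ((\<Sum>j<n. a j * z ^ j) * cnj (z ^ k))) =
    (if k < n then a k * of_real (\<rho> ^ (2 * k + 2) / (real k + 1)) else 0)"
proof -
  have i: "integrable dA (\<lambda>z. indicator (cball 0 \<rho>) z * (z ^ j * cnj (z ^ k)))" for j
  proof (rule bounded_integrable_dA)
    show "(\<lambda>z. indicator (cball 0 \<rho>) z * (z ^ j * cnj (z ^ k))) \<in> borel_measurable dA"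
      by (intro borel_measurable_times indicator_cball_measurable monomial_measurable)
    show "norm (indicator (cball 0 \<rho>) z * (z ^ j * cnj (z ^ k))) \<le> 1" if "z \<in> ball 0 1" for z :: complex
      using that by (auto simp: indicator_def norm_mult norm_power intro!: mult_le_one power_le_one)
  qed
  have "(LINT z|dA. indicator (cball 0 \<rho>) z * ((\<Sum>j<n. a j * z ^ j) * cnj (z ^ k))) =
      (LINT z|dA. (\<Sum>j<n. a j * (indicator (cball 0 \<rho>) z * (z ^ j * cnj (z ^ k)))))"
    by (intro Bochner_Integration.integral_cong refl) (simp add: sum_distrib_left sum_distrib_right mult_ac)
  also have "\<dots> = (\<Sum>j<n. a j * (LINT z|dA. indicator (cball 0 \<rho>) z * (z ^ j * cnj (z ^ k))))"
    using i by (subst Bochner_Integration.integral_sum) auto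
  also have "\<dots> = (\<Sum>j<n. if j = k then a k * of_real (\<rho> ^ (2 * k + 2) / (real k + 1)) else 0)"
    by (intro sum.cong refl) (simp add: LINT_monomials[OF assms] del: complex_cnj_power)
  also have "\<dots> = (if k < n then a k * of_real (\<rho> ^ (2 * k + 2) / (real k + 1)) else 0)" by simp
  finally show ?thesis .
qed

lemma msq_poly:
  assumes "0 \<le> \<rho>" "\<rho> \<le> 1"
  shows "msq \<rho> (\<lambda>z. \<Sum>j<n. a j * z ^ j) = (\<Sum>k<n. (cmod (a k))\<^sup>2 * \<rho> ^ (2 * k + 2) / (real k + 1))"
proof -
  define p where "p = (\<lambda>z. \<Sum>j<n. a j * z ^ j)"
  have pm: "p \<in> borel_measurable dA" unfolding p_def by (intro measurable_dA_borel) measurable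
  have i: "integrable dA (\<lambda>z. indicator (cball 0 \<rho>) z * (p z * cnj (z ^ k)))" for k
  proof (rule bounded_integrable_dA)
    show "(\<lambda>z. indicator (cball 0 \<rho>) z * (p z * cnj (z ^ k))) \<in> borel_measurable dA"
      by (intro borel_measurable_times indicator_cball_measurable pm cnj_monomial_measurable)
    fix z :: complex assume z: "z \<in> ball 0 1"
    have "norm (p z) \<le> (\<Sum>j<n. cmod (a j))" unfolding p_def
      using z by (intro sum_norm_le) (auto simp: norm_mult norm_power intro!: mult_left_le power_le_one)
    then show "norm (indicator (cball 0 \<rho>) z * (p z * cnj (z ^ k))) \<le> (\<Sum>j<n. cmod (a j))"
      using z by (auto simp: indicator_def norm_mult norm_power intro!: order_trans[OF mult_left_le] power_le_one sum_nonneg)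
  qed
  have "complex_of_real (msq \<rho> p) = (LINT z|dA. complex_of_real (indicator (cball 0 \<rho>) z * (cmod (p z))\<^sup>2))"
    unfolding msq_def by (rule integral_complex_of_real[symmetric])
  also have "\<dots> = (LINT z|dA. (\<Sum>k<n. cnj (a k) * (indicator (cball 0 \<rho>) z * (p z * cnj (z ^ k)))))"
  proof (intro Bochner_Integration.integral_cong refl)
    fix z
    have "complex_of_real ((cmod (p z))\<^sup>2) = p z * cnj (p z)" by (rule complex_norm_square)
    also have "cnj (p z) = (\<Sum>k<n. cnj (a k) * cnj (z ^ k))" by (simp add: p_def)
    finally show "complex_of_real (indicator (cball 0 \<rho>) z * (cmod (p z))\<^sup>2) =
        (\<Sum>k<n. cnj (a k) * (indicator (cball 0 \<rho>) z * (p z * cnj (z ^ k))))"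
      by (simp add: sum_distrib_left mult_ac indicator_def)
  qed
  also have "\<dots> = (\<Sum>k<n. cnj (a k) * (LINT z|dA. indicator (cball 0 \<rho>) z * (p z * cnj (z ^ k))))"
    using i by (subst Bochner_Integration.integral_sum) auto
  also have "\<dots> = (\<Sum>k<n. cnj (a k) * (a k * of_real (\<rho> ^ (2 * k + 2) / (real k + 1))))"
    unfolding p_def by (intro sum.cong refl) (subst LINT_poly_monomial[OF assms], simp)
  also have "\<dots> = (\<Sum>k<n. complex_of_real ((cmod (a k))\<^sup>2 * \<rho> ^ (2 * k + 2) / (real k + 1)))"
  proof (intro sum.cong refl)
    fix k
    have "cnj (a k) * a k = complex_of_real ((cmod (a k))\<^sup>2)" by (subst complex_norm_square) (simp add: mult.commute)
    then show "cnj (a k) * (a k * of_real (\<rho> ^ (2 * k + 2) / (real k + 1))) = complex_of_real ((cmod (a k))\<^sup>2 * \<rho> ^ (2 * k + 2) / (real k + 1))"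
      by (simp add: mult.assoc[symmetric])
  qed
  finally have "complex_of_real (msq \<rho> p) = complex_of_real (\<Sum>k<n. (cmod (a k))\<^sup>2 * \<rho> ^ (2 * k + 2) / (real k + 1))"
    by (simp only: of_real_sum)
  then show ?thesis unfolding p_def by (simp only: of_real_eq_iff)
qed

text \<open>The bound is uniform in n, as dominated convergence requires: convergence at a radius
  \<rho>' > \<rho> implies absolute convergence at \<rho>.\<close>

lemma powser_cball_bound:
  fixes a :: "nat \<Rightarrow> complex"
  assumes S: "\<And>z. z \<in> ball 0 1 \<Longrightarrow> (\<lambda>k. a k * z ^ k) sums f z" and r: "0 \<le> \<rho>" "\<rho> < 1"
  shows "\<exists>B. \<forall>z\<in>cball 0 \<rho>. \<forall>n. cmod (\<Sum>j<n. a j * z ^ j) \<le> B"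
proof -
  obtain \<rho>' where r': "\<rho> < \<rho>'" "\<rho>' < 1" using dense r by blast
  have "summable (\<lambda>k. a k * (of_real \<rho>') ^ k)"
    using S[of "of_real \<rho>'"] r r' by (auto simp: sums_iff)
  then have s: "summable (\<lambda>k. norm (a k * (of_real \<rho>) ^ k))"
    by (rule powser_insidea) (use r r' in auto)
  have "cmod (\<Sum>j<n. a j * z ^ j) \<le> (\<Sum>k. norm (a k * (of_real \<rho>) ^ k))" if "z \<in> cball 0 \<rho>" for z n
  proof -
    have "cmod (\<Sum>j<n. a j * z ^ j) \<le> (\<Sum>j<n. norm (a j * (of_real \<rho>) ^ j))"
      using that r by (intro sum_norm_le) (auto simp: norm_mult norm_power intro!: mult_left_mono power_mono)
    also have "\<dots> \<le> (\<Sum>k. norm (a k * (of_real \<rho>) ^ k))"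
      by (rule sum_le_suminf[OF s]) auto
    finally show ?thesis .
  qed
  then show ?thesis by blast
qed

lemma powser_holomorphic:
  assumes "\<And>z. z \<in> ball 0 1 \<Longrightarrow> (\<lambda>k. a k * z ^ k) sums f z"
  shows "f holomorphic_on ball 0 1"
  by (rule power_series_holomorphic[of 0 1 a]) (use assms in auto)

text \<open>Parseval's identity on a disc strictly inside the unit disc, where partial sums are
  bounded even for functions of infinite norm. The second part recovers each coefficient from a
  moment of f.\<close>

lemma msq_powser:
  assumes S: "\<And>z. z \<in> ball 0 1 \<Longrightarrow> (\<lambda>k. a k * z ^ k) sums f z" and r: "0 \<le> \<rho>" "\<rho> < 1"
  shows "(\<lambda>k. (cmod (a k))\<^sup>2 * \<rho> ^ (2 * k + 2) / (real k + 1)) sums msq \<rho> f"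
    and "(LINT z|dA. indicator (cball 0 \<rho>) z * (f z * cnj (z ^ k))) = a k * of_real (\<rho> ^ (2 * k + 2) / (real k + 1))"
proof -
  obtain B where B: "\<And>z n. z \<in> cball 0 \<rho> \<Longrightarrow> cmod (\<Sum>j<n. a j * z ^ j) \<le> B"
    using powser_cball_bound[OF S r] by blast
  have fm: "f \<in> borel_measurable dA"
    by (intro holomorphic_on_measurable_dA powser_holomorphic[of a]) (use S in auto)
  have lim: "(\<lambda>n. \<Sum>j<n. a j * z ^ j) \<longlonglongrightarrow> f z" if "z \<in> ball 0 1" for z
    using S[OF that] by (simp add: sums_def)
  have m: "(\<lambda>z. \<Sum>j<n. a j * z ^ j) \<in> borel_measurable dA" for n
    by (intro measurable_dA_borel) measurable
  have "(\<lambda>n. msq \<rho> (\<lambda>z. \<Sum>j<n. a j * z ^ j)) \<longlonglongrightarrow> msq \<rho> f"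
    unfolding msq_def
  proof (rule integral_dominated_convergence[where w = "\<lambda>_. B\<^sup>2"])
    show "(\<lambda>z. indicator (cball 0 \<rho>) z * (cmod (f z))\<^sup>2) \<in> borel_measurable dA"
      using fm by measurable
    show "(\<lambda>z. indicator (cball 0 \<rho>) z * (cmod (\<Sum>j<n. a j * z ^ j))\<^sup>2) \<in> borel_measurable dA" for n
      using m by measurable
    show "AE z in dA. (\<lambda>n. indicator (cball 0 \<rho>) z * (cmod (\<Sum>j<n. a j * z ^ j))\<^sup>2)
        \<longlonglongrightarrow> indicator (cball 0 \<rho>) z * (cmod (f z))\<^sup>2"
      by (intro AE_I2 tendsto_intros lim) simp
    show "AE z in dA. norm (indicator (cball 0 \<rho>) z * (cmod (\<Sum>j<n. a j * z ^ j))\<^sup>2) \<le> B\<^sup>2" for n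
      using B by (auto simp: indicator_def intro!: power_mono)
  qed simp
  then show "(\<lambda>k. (cmod (a k))\<^sup>2 * \<rho> ^ (2 * k + 2) / (real k + 1)) sums msq \<rho> f"
    using r by (simp add: sums_def msq_poly)
  have "(\<lambda>n. LINT z|dA. indicator (cball 0 \<rho>) z * ((\<Sum>j<n. a j * z ^ j) * cnj (z ^ k)))
      \<longlonglongrightarrow> (LINT z|dA. indicator (cball 0 \<rho>) z * (f z * cnj (z ^ k)))"
  proof (rule integral_dominated_convergence[where w = "\<lambda>_. \<bar>B\<bar>"])
    note c = cnj_monomial_measurable
    show "(\<lambda>z. indicator (cball 0 \<rho>) z * (f z * cnj (z ^ k))) \<in> borel_measurable dA"
      by (intro borel_measurable_times indicator_cball_measurable fm c)
    show "(\<lambda>z. indicator (cball 0 \<rho>) z * ((\<Sum>j<n. a j * z ^ j) * cnj (z ^ k))) \<in> borel_measurable dA" for n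
      by (intro borel_measurable_times indicator_cball_measurable m c)
    show "AE z in dA. (\<lambda>n. indicator (cball 0 \<rho>) z * ((\<Sum>j<n. a j * z ^ j) * cnj (z ^ k)))
        \<longlonglongrightarrow> indicator (cball 0 \<rho>) z * (f z * cnj (z ^ k))"
      by (intro AE_I2 tendsto_mult tendsto_const lim) simp
    show "AE z in dA. norm (indicator (cball 0 \<rho>) z * ((\<Sum>j<n. a j * z ^ j) * cnj (z ^ k))) \<le> \<bar>B\<bar>" for n
    proof (rule AE_I2)
      fix z assume "z \<in> space dA"
      then have z: "cmod z \<le> 1" by simp
      show "norm (indicator (cball 0 \<rho>) z * ((\<Sum>j<n. a j * z ^ j) * cnj (z ^ k))) \<le> \<bar>B\<bar>"
      proof (cases "z \<in> cball 0 \<rho>")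
        case True
        have "cmod (\<Sum>j<n. a j * z ^ j) * cmod z ^ k \<le> \<bar>B\<bar> * 1"
          using B[OF True, of n] z by (intro mult_mono power_le_one) auto
        then show ?thesis using True by (simp add: norm_mult norm_power)
      qed simp
    qed
  qed simp
  moreover have "(\<lambda>n. LINT z|dA. indicator (cball 0 \<rho>) z * ((\<Sum>j<n. a j * z ^ j) * cnj (z ^ k)))
      \<longlonglongrightarrow> a k * of_real (\<rho> ^ (2 * k + 2) / (real k + 1))"
  proof (rule tendsto_eventually)
    show "\<forall>\<^sub>F n in sequentially. (LINT z|dA. indicator (cball 0 \<rho>) z * ((\<Sum>j<n. a j * z ^ j) * cnj (z ^ k))) =
        a k * of_real (\<rho> ^ (2 * k + 2) / (real k + 1))"
      using eventually_gt_at_top[of k] by eventually_elim (subst LINT_poly_monomial, use r in auto)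
  qed
  ultimately show "(LINT z|dA. indicator (cball 0 \<rho>) z * (f z * cnj (z ^ k))) = a k * of_real (\<rho> ^ (2 * k + 2) / (real k + 1))"
    by (rule LIMSEQ_unique)
qed

definition tcoeff :: "(complex \<Rightarrow> complex) \<Rightarrow> nat \<Rightarrow> complex" where
  "tcoeff f k = (deriv ^^ k) f 0 / fact k"

lemma tcoeff_sums:
  assumes "f holomorphic_on ball 0 1" "z \<in> ball 0 1"
  shows "(\<lambda>k. tcoeff f k * z ^ k) sums f z"
  using holomorphic_power_series[OF assms] by (simp add: tcoeff_def)

text \<open>Any single radius determines the coefficients through the moments; 1/2 is an arbitrary
  choice.\<close>

lemma tcoeff_unique:
  assumes S: "\<And>z. z \<in> ball 0 1 \<Longrightarrow> (\<lambda>k. a k * z ^ k) sums f z"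
  shows "tcoeff f k = a k"
proof -
  have h: "f holomorphic_on ball 0 1" by (rule powser_holomorphic[OF S])
  have "tcoeff f k * of_real ((1/2) ^ (2 * k + 2) / (real k + 1)) = a k * of_real ((1/2) ^ (2 * k + 2) / (real k + 1))"
    using msq_powser(2)[OF tcoeff_sums[OF h], of "1/2" k] msq_powser(2)[OF S, of "1/2" k] by simp
  moreover have "complex_of_real ((1/2) ^ (2 * k + 2) / (real k + 1)) \<noteq> 0"
    unfolding of_real_eq_0_iff using of_nat_0_le_iff[of k, where ?'a = real] by (simp del: of_nat_0_le_iff)
  ultimately show ?thesis by (simp only: mult_cancel_right) simp
qed

lemma tcoeff_lincomb:
  fixes f :: "nat \<Rightarrow> complex \<Rightarrow> complex"
  assumes "\<And>i. i < n \<Longrightarrow> f i holomorphic_on ball 0 1"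
  shows "tcoeff (\<lambda>z. \<Sum>i<n. c i * f i z) k = (\<Sum>i<n. c i * tcoeff (f i) k)"
proof (rule tcoeff_unique)
  fix z :: complex assume z: "z \<in> ball 0 1"
  have "(\<lambda>k. \<Sum>i<n. c i * (tcoeff (f i) k * z ^ k)) sums (\<Sum>i<n. c i * f i z)"
    using assms z by (intro sums_sum sums_mult tcoeff_sums) auto
  then show "(\<lambda>k. (\<Sum>i<n. c i * tcoeff (f i) k) * z ^ k) sums (\<Sum>i<n. c i * f i z)"
    by (simp add: sum_distrib_right mult.assoc)
qed

text \<open>An exhaustion of the disc; the shift by two keeps the first radius positive, because
  radii also occur as denominators.\<close>

lemma inner_radii: "0 < 1 - 1 / real (Suc (Suc n))" "1 - 1 / real (Suc (Suc n)) < 1"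
  "(\<lambda>n. 1 - 1 / real (Suc (Suc n))) \<longlonglongrightarrow> 1"
proof -
  show "0 < 1 - 1 / real (Suc (Suc n))" "1 - 1 / real (Suc (Suc n)) < 1" by auto
  show "(\<lambda>n. 1 - 1 / real (Suc (Suc n))) \<longlonglongrightarrow> 1" by real_asymp
qed

lemma indicator_inner_radii_tendsto:
  fixes z :: complex
  assumes "z \<in> ball 0 1"
  shows "\<forall>\<^sub>F n in sequentially. z \<in> cball 0 (1 - 1 / real (Suc (Suc n)))"
proof -
  have "\<forall>\<^sub>F n in sequentially. cmod z < 1 - 1 / real (Suc (Suc n))"
    by (rule order_tendstoD(1)[OF inner_radii(3)]) (use assms in simp)
  then show ?thesis by eventually_elim auto
qed

lemma msq_tendsto_nsq:
  assumes "f \<in> sq_integrable"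
  shows "(\<lambda>n. msq (1 - 1 / real (Suc (Suc n))) f) \<longlonglongrightarrow> L2.nsq f"
  unfolding msq_def L2_nsq
proof (rule integral_dominated_convergence[where w = "\<lambda>z. (cmod (f z))\<^sup>2"])
  note [measurable] = sq_integrableD(1)[OF assms]
  show "(\<lambda>z. (cmod (f z))\<^sup>2) \<in> borel_measurable dA" by measurable
  show "(\<lambda>z. indicator (cball 0 (1 - 1 / real (Suc (Suc n)))) z * (cmod (f z))\<^sup>2) \<in> borel_measurable dA" for n
    by measurable
  show "integrable dA (\<lambda>z. (cmod (f z))\<^sup>2)" using assms by (rule sq_integrableD)
  show "AE z in dA. (\<lambda>n. indicator (cball 0 (1 - 1 / real (Suc (Suc n)))) z * (cmod (f z))\<^sup>2) \<longlonglongrightarrow> (cmod (f z))\<^sup>2"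
  proof (rule AE_I2, rule tendsto_eventually)
    fix z assume "z \<in> space dA"
    then have "z \<in> ball 0 1" by simp
    from indicator_inner_radii_tendsto[OF this]
    show "\<forall>\<^sub>F n in sequentially. indicator (cball 0 (1 - 1 / real (Suc (Suc n)))) z * (cmod (f z))\<^sup>2 = (cmod (f z))\<^sup>2"
      by eventually_elim simp
  qed
qed (auto simp: indicator_def)

text \<open>Monotone convergence over the exhaustion. Projections and Montel limits enter the
  Bergman space in this way, since their mass is first controlled on smaller discs only.\<close>

lemma bergman_if_msq_bounded:
  assumes h: "f holomorphic_on ball 0 1" and B: "\<And>\<rho>. 0 < \<rho> \<Longrightarrow> \<rho> < 1 \<Longrightarrow> msq \<rho> f \<le> B"
  shows "f \<in> bergman" "L2.nsq f \<le> B"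
proof -
  have m[measurable]: "f \<in> borel_measurable dA" using h by (rule holomorphic_on_measurable_dA)
  define R where "R = (\<lambda>n. 1 - 1 / real (Suc (Suc n)))"
  have R: "0 < R n" "R n < 1" for n unfolding R_def by (rule inner_radii)+
  have incR: "R i \<le> R j" if "i \<le> j" for i j
    using that unfolding R_def by (intro diff_mono divide_left_mono) auto
  have int: "integrable dA (\<lambda>z. indicator (cball 0 (R n)) z * (cmod (f z))\<^sup>2)" for n
  proof -
    have "continuous_on (cball 0 (R n)) f"
      using R[of n] by (intro continuous_on_subset[OF holomorphic_on_imp_continuous_on[OF h]]) auto
    then have "bounded (f ` cball 0 (R n))"
      by (intro compact_imp_bounded compact_continuous_image) auto
    then obtain K where K: "\<And>z. z \<in> cball 0 (R n) \<Longrightarrow> cmod (f z) \<le> K"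
      unfolding bounded_iff by blast
    show ?thesis
    proof (rule bounded_integrable_dA)
      show "norm (indicator (cball 0 (R n)) z * (cmod (f z))\<^sup>2) \<le> K\<^sup>2" for z
        using K[of z] by (auto simp: indicator_def intro!: power_mono)
    qed measurable
  qed
  have inc: "msq (R i) f \<le> msq (R j) f" if "i \<le> j" for i j
    unfolding msq_def using incR[OF that] by (intro integral_mono int) (auto simp: indicator_def)
  have bd: "bdd_above (range (\<lambda>n. msq (R n) f))"
    using B R by (intro bdd_aboveI[of _ B]) auto
  have lim: "(\<lambda>n. msq (R n) f) \<longlonglongrightarrow> (SUP n. msq (R n) f)"
    using inc bd by (intro LIMSEQ_incseq_SUP) (auto simp: incseq_def)
  have hb: "has_bochner_integral dA (\<lambda>z. (cmod (f z))\<^sup>2) (SUP n. msq (R n) f)"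
  proof (rule has_bochner_integral_monotone_convergence)
    show "integrable dA (\<lambda>z. indicator (cball 0 (R n)) z * (cmod (f z))\<^sup>2)" for n by (rule int)
    show "AE z in dA. incseq (\<lambda>n. indicator (cball 0 (R n)) z * (cmod (f z))\<^sup>2)"
    proof (intro AE_I2 monoI mult_right_mono)
      fix z :: complex and i j :: nat assume "i \<le> j"
      from incR[OF this] show "(indicator (cball 0 (R i)) z :: real) \<le> indicator (cball 0 (R j)) z"
        by (auto simp: indicator_def)
    qed simp
    show "AE z in dA. (\<lambda>n. indicator (cball 0 (R n)) z * (cmod (f z))\<^sup>2) \<longlonglongrightarrow> (cmod (f z))\<^sup>2"
    proof (rule AE_I2, rule tendsto_eventually)
      fix z assume "z \<in> space dA"
      then have "z \<in> ball 0 1" by simp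
      from indicator_inner_radii_tendsto[OF this]
      show "\<forall>\<^sub>F n in sequentially. indicator (cball 0 (R n)) z * (cmod (f z))\<^sup>2 = (cmod (f z))\<^sup>2"
        unfolding R_def by eventually_elim simp
    qed
    show "(\<lambda>n. LINT z|dA. indicator (cball 0 (R n)) z * (cmod (f z))\<^sup>2) \<longlonglongrightarrow> (SUP n. msq (R n) f)"
      using lim by (simp add: msq_def)
  qed measurable
  then show "f \<in> bergman" using h by (simp add: bergman_iff has_bochner_integral_iff)
  have "L2.nsq f = (SUP n. msq (R n) f)" using hb by (simp add: L2_nsq has_bochner_integral_iff)
  also have "\<dots> \<le> B" using B R by (intro cSUP_least) auto
  finally show "L2.nsq f \<le> B" .
qed

text \<open>Termwise in Parseval's identity: passing from \<rho>' to \<rho> multiplies the k-th term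
  by (\<rho>/\<rho>')^(2k+2), which for k \<ge> N is at most its value at k = N.\<close>

lemma msq_le_of_vanishing:
  assumes h: "f holomorphic_on ball 0 1" and v: "\<And>k. k < N \<Longrightarrow> tcoeff f k = 0"
    and r: "0 \<le> \<rho>" "\<rho> \<le> \<rho>'" "0 < \<rho>'" "\<rho>' < 1"
  shows "msq \<rho> f \<le> (\<rho> / \<rho>') ^ (2 * N + 2) * msq \<rho>' f"
proof (rule sums_le)
  show "(\<lambda>k. (cmod (tcoeff f k))\<^sup>2 * \<rho> ^ (2 * k + 2) / (real k + 1)) sums msq \<rho> f"
    using r by (intro msq_powser tcoeff_sums h) auto
  show "(\<lambda>k. (\<rho> / \<rho>') ^ (2 * N + 2) * ((cmod (tcoeff f k))\<^sup>2 * \<rho>' ^ (2 * k + 2) / (real k + 1))) sums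
      ((\<rho> / \<rho>') ^ (2 * N + 2) * msq \<rho>' f)"
    using r by (intro sums_mult msq_powser tcoeff_sums h) auto
  fix k
  show "(cmod (tcoeff f k))\<^sup>2 * \<rho> ^ (2 * k + 2) / (real k + 1) \<le>
      (\<rho> / \<rho>') ^ (2 * N + 2) * ((cmod (tcoeff f k))\<^sup>2 * \<rho>' ^ (2 * k + 2) / (real k + 1))"
  proof (cases "k < N")
    case True
    then show ?thesis using v by simp
  next
    case False
    have "\<rho> ^ (2 * k + 2) = (\<rho> / \<rho>') ^ (2 * k + 2) * \<rho>' ^ (2 * k + 2)"
      using r by (simp add: power_divide)
    also have "\<dots> \<le> (\<rho> / \<rho>') ^ (2 * N + 2) * \<rho>' ^ (2 * k + 2)"
      using r False by (intro mult_right_mono power_decreasing) auto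
    finally have "(cmod (tcoeff f k))\<^sup>2 / (real k + 1) * \<rho> ^ (2 * k + 2) \<le>
        (cmod (tcoeff f k))\<^sup>2 / (real k + 1) * ((\<rho> / \<rho>') ^ (2 * N + 2) * \<rho>' ^ (2 * k + 2))"
      by (intro mult_left_mono) auto
    then show ?thesis by (simp only: times_divide_eq_left times_divide_eq_right mult_ac)
  qed
qed

text \<open>The limiting case of the previous estimate as \<rho>' increases to 1.\<close>

lemma msq_le_nsq_of_vanishing:
  assumes f: "f \<in> bergman" and v: "\<And>k. k < N \<Longrightarrow> tcoeff f k = 0" and r: "0 \<le> \<rho>" "\<rho> < 1"
  shows "msq \<rho> f \<le> \<rho> ^ (2 * N + 2) * L2.nsq f"
proof (rule LIMSEQ_le)
  show "(\<lambda>n. msq \<rho> f) \<longlonglongrightarrow> msq \<rho> f" by simp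
  show "(\<lambda>n. (\<rho> / (1 - 1 / real (Suc (Suc n)))) ^ (2 * N + 2) * msq (1 - 1 / real (Suc (Suc n))) f)
      \<longlonglongrightarrow> \<rho> ^ (2 * N + 2) * L2.nsq f"
    using tendsto_mult[OF tendsto_power[OF tendsto_divide[OF tendsto_const inner_radii(3)]] msq_tendsto_nsq[OF bergman_sq_integrable[OF f]], of \<rho> "2 * N + 2"]
    by simp
  have "\<forall>\<^sub>F n in sequentially. \<rho> < 1 - 1 / real (Suc (Suc n))"
    by (rule order_tendstoD(1)[OF inner_radii(3) r(2)])
  then have "\<forall>\<^sub>F n in sequentially. msq \<rho> f \<le> (\<rho> / (1 - 1 / real (Suc (Suc n)))) ^ (2 * N + 2) * msq (1 - 1 / real (Suc (Suc n))) f"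
  proof eventually_elim
    case (elim n)
    then show ?case using inner_radii(1,2)[of n] r
      by (intro msq_le_of_vanishing[OF bergman_holomorphic[OF f] v]) auto
  qed
  then show "\<exists>M. \<forall>n\<ge>M. msq \<rho> f \<le> (\<rho> / (1 - 1 / real (Suc (Suc n)))) ^ (2 * N + 2) * msq (1 - 1 / real (Suc (Suc n))) f"
    by (simp add: eventually_sequentially)
qed

text \<open>The converse estimate for degree below n: the exponents 2k + 2 that occur in Parseval's
  identity are at most 2n.\<close>

lemma msq_poly_ge:
  assumes r: "0 \<le> \<rho>" "\<rho> \<le> 1"
  shows "msq \<rho> (\<lambda>z. \<Sum>j<n. a j * z ^ j) \<ge> \<rho> ^ (2 * n) * msq 1 (\<lambda>z. \<Sum>j<n. a j * z ^ j)"
proof -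
  have "\<rho> ^ (2 * n) * (\<Sum>k<n. (cmod (a k))\<^sup>2 * 1 ^ (2 * k + 2) / (real k + 1)) \<le>
      (\<Sum>k<n. (cmod (a k))\<^sup>2 * \<rho> ^ (2 * k + 2) / (real k + 1))"
    unfolding sum_distrib_left
  proof (rule sum_mono)
    fix k assume "k \<in> {..<n}"
    then have "\<rho> ^ (2 * n) \<le> \<rho> ^ (2 * k + 2)" using r by (intro power_decreasing) auto
    then have "(cmod (a k))\<^sup>2 / (real k + 1) * \<rho> ^ (2 * n) \<le> (cmod (a k))\<^sup>2 / (real k + 1) * \<rho> ^ (2 * k + 2)"
      by (intro mult_left_mono) auto
    then show "\<rho> ^ (2 * n) * ((cmod (a k))\<^sup>2 * 1 ^ (2 * k + 2) / (real k + 1)) \<le> (cmod (a k))\<^sup>2 * \<rho> ^ (2 * k + 2) / (real k + 1)"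
      by (simp add: mult_ac)
  qed
  then show ?thesis using r by (simp add: msq_poly)
qed

lemma msq_1: "msq 1 f = L2.nsq f"
  unfolding msq_def L2_nsq by (rule Bochner_Integration.integral_cong) (auto simp: indicator_def)

text \<open>A single term of Parseval's identity, with the radius tending to 1.\<close>

lemma tcoeff_bound:
  assumes f: "f \<in> bergman"
  shows "(cmod (tcoeff f k))\<^sup>2 \<le> (real k + 1) * L2.nsq f"
proof (rule LIMSEQ_le)
  show "(\<lambda>n. (cmod (tcoeff f k))\<^sup>2 * (1 - 1 / real (Suc (Suc n))) ^ (2 * k + 2)) \<longlonglongrightarrow> (cmod (tcoeff f k))\<^sup>2"
    using tendsto_mult[OF tendsto_const tendsto_power[OF inner_radii(3)], of "(cmod (tcoeff f k))\<^sup>2" "2 * k + 2"] by simp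
  show "(\<lambda>n. (real k + 1) * L2.nsq f) \<longlonglongrightarrow> (real k + 1) * L2.nsq f" by simp
  have "(cmod (tcoeff f k))\<^sup>2 * \<rho> ^ (2 * k + 2) \<le> (real k + 1) * L2.nsq f" if "0 < \<rho>" "\<rho> < 1" for \<rho>
  proof -
    have s: "(\<lambda>k. (cmod (tcoeff f k))\<^sup>2 * \<rho> ^ (2 * k + 2) / (real k + 1)) sums msq \<rho> f"
      using that by (intro msq_powser tcoeff_sums bergman_holomorphic[OF f]) auto
    have "(\<Sum>k\<in>{k}. (cmod (tcoeff f k))\<^sup>2 * \<rho> ^ (2 * k + 2) / (real k + 1)) \<le> msq \<rho> f"
      unfolding sums_unique[OF s] using s that by (intro sum_le_suminf) (auto simp: sums_iff)
    also have "\<dots> \<le> L2.nsq f" by (intro msq_le_nsq bergman_sq_integrable f)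
    finally show ?thesis by (simp add: field_simps)
  qed
  then show "\<exists>N. \<forall>n\<ge>N. (cmod (tcoeff f k))\<^sup>2 * (1 - 1 / real (Suc (Suc n))) ^ (2 * k + 2) \<le> (real k + 1) * L2.nsq f"
    using inner_radii(1,2) by blast
qed

text \<open>Coarser than the reproducing kernel estimate: sqrt (k + 1) is enlarged to k + 1 so that
  the majorant is the derivative of the geometric series. It serves for local boundedness and to see
  that a function of norm zero vanishes on the disc.\<close>

lemma bergman_pointwise_bound:
  assumes f: "f \<in> bergman" and z: "z \<in> ball 0 1"
  shows "cmod (f z) \<le> sqrt (L2.nsq f) / (1 - cmod z)\<^sup>2"
proof -
  have b: "cmod (tcoeff f k) \<le> sqrt (L2.nsq f) * real (Suc k)" for k
  proof (rule power2_le_imp_le)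
    have "(cmod (tcoeff f k))\<^sup>2 \<le> (real k + 1) * L2.nsq f" by (rule tcoeff_bound[OF f])
    also have "\<dots> \<le> (real (Suc k))\<^sup>2 * L2.nsq f"
      using L2.nsq_nonneg[OF bergman_sq_integrable[OF f]]
      by (intro mult_right_mono) (auto simp: power2_eq_square algebra_simps)
    finally show "(cmod (tcoeff f k))\<^sup>2 \<le> (sqrt (L2.nsq f) * real (Suc k))\<^sup>2"
      using L2.nsq_nonneg[OF bergman_sq_integrable[OF f]] by (simp add: power_mult_distrib mult.commute)
    show "0 \<le> sqrt (L2.nsq f) * real (Suc k)" using L2.nsq_nonneg[OF bergman_sq_integrable[OF f]] by simp
  qed
  have g: "(\<lambda>n. of_nat (Suc n) * cmod z ^ n) sums (1 / (1 - cmod z)\<^sup>2)"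
    using z by (intro geometric_deriv_sums) simp
  have g': "(\<lambda>n. sqrt (L2.nsq f) * (of_nat (Suc n) * cmod z ^ n)) sums (sqrt (L2.nsq f) * (1 / (1 - cmod z)\<^sup>2))"
    by (rule sums_mult[OF g])
  have n: "norm (tcoeff f k * z ^ k) \<le> sqrt (L2.nsq f) * (of_nat (Suc k) * cmod z ^ k)" for k
  proof -
    have "norm (tcoeff f k * z ^ k) \<le> (sqrt (L2.nsq f) * real (Suc k)) * cmod z ^ k"
      unfolding norm_mult norm_power by (rule mult_right_mono[OF b]) simp
    then show ?thesis by (simp only: mult.assoc)
  qed
  have "norm (\<Sum>k. tcoeff f k * z ^ k) \<le> (\<Sum>k. sqrt (L2.nsq f) * (of_nat (Suc k) * cmod z ^ k))"
    by (rule norm_suminf_le[OF n sums_summable[OF g']])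
  then show ?thesis
    using sums_unique[OF tcoeff_sums[OF bergman_holomorphic[OF f] z]] sums_unique[OF g'] by simp
qed

section \<open>Toeplitz operators with symbols vanishing at the boundary\<close>

definition bproj :: "(complex \<Rightarrow> complex) \<Rightarrow> complex \<Rightarrow> complex" where
  "bproj g = (\<lambda>z. dA_int (\<lambda>w. g w / (1 - z * cnj w)\<^sup>2))"

lemma toeplitz_eq_bproj: "toeplitz \<phi> f = bproj (\<lambda>w. \<phi> w * f w)"
  by (simp add: toeplitz_def bproj_def)

lemma sq_integrable_integrable: assumes "g \<in> sq_integrable" shows "integrable dA g"
proof -
  have "(\<lambda>_. 1) \<in> sq_integrable" by (simp add: sq_integrable_def)
  from sq_integrable_mult_cnj[OF assms this] show ?thesis by simp
qed

text \<open>The kernel is expanded as the sum of (k + 1) (z * cnj w)^k and integrated termwise, with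
  the summable majorant (k + 1) |z|^k |g|. All properties of the projection are read off this
  series.\<close>

lemma bproj_sums:
  assumes g: "g \<in> sq_integrable" and z: "z \<in> ball 0 1"
  shows "(\<lambda>k. (of_nat (Suc k) * binner g (\<lambda>w. w ^ k)) * z ^ k) sums bproj g z"
proof -
  define f where "f = (\<lambda>k w. (of_nat (Suc k) * z ^ k) * (g w * cnj (w ^ k)))"
  have gi: "integrable dA (\<lambda>w. norm (g w))" using sq_integrable_integrable[OF g] by (rule integrable_norm)
  have i: "integrable dA (f k)" for k
    unfolding f_def by (intro integrable_mult_right sq_integrable_mult_cnj g bergman_sq_integrable monomial_bergman)
  have fw: "f k w = g w * (of_nat (Suc k) * (z * cnj w) ^ k)" for k w
    by (simp add: f_def power_mult_distrib)
  have small: "norm (z * cnj w) < 1" if "w \<in> ball 0 1" for w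
    using z that mult_strict_mono'[of "cmod z" 1 "cmod w" 1] by (simp add: norm_mult)
  have s: "(\<lambda>k. f k w) sums (g w / (1 - z * cnj w)\<^sup>2)" if "w \<in> ball 0 1" for w
    unfolding fw using sums_mult[OF geometric_deriv_sums[OF small[OF that]], of "g w"] by simp
  have nb: "norm (f k w) \<le> (real (Suc k) * cmod z ^ k) * norm (g w)" if "w \<in> ball 0 1" for k w
  proof -
    have "norm (f k w) = (real (Suc k) * cmod z ^ k * norm (g w)) * cmod w ^ k"
      unfolding f_def by (simp only: norm_mult norm_power norm_of_nat complex_mod_cnj mult.assoc)
    also have "\<dots> \<le> (real (Suc k) * cmod z ^ k * norm (g w)) * 1"
      using that by (intro mult_left_mono power_le_one) auto
    finally show ?thesis by simp
  qed
  have gs: "summable (\<lambda>k. real (Suc k) * cmod z ^ k)"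
    using geometric_deriv_sums[of "cmod z"] z by (auto simp: sums_iff)
  have "(\<lambda>k. integral\<^sup>L dA (f k)) sums (LINT w|dA. (\<Sum>k. f k w))"
  proof (rule sums_integral[OF i])
    show "AE w in dA. summable (\<lambda>k. norm (f k w))"
    proof (rule AE_I2)
      fix w assume "w \<in> space dA"
      then have w: "w \<in> ball 0 1" by simp
      show "summable (\<lambda>k. norm (f k w))"
        by (rule summable_comparison_test'[OF summable_mult2[OF gs, of "norm (g w)"], of 0]) (use nb[OF w] in simp)
    qed
    show "summable (\<lambda>k. LINT w|dA. norm (f k w))"
    proof (rule summable_comparison_test'[OF summable_mult2[OF gs, of "LINT w|dA. norm (g w)"], of 0])
      fix k
      have "(LINT w|dA. norm (f k w)) \<le> (LINT w|dA. (real (Suc k) * cmod z ^ k) * norm (g w))"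
        by (rule integral_mono[OF integrable_norm[OF i] integrable_mult_right[OF gi]]) (use nb in auto)
      also have "\<dots> = (real (Suc k) * cmod z ^ k) * (LINT w|dA. norm (g w))" by simp
      finally show "norm (LINT w|dA. norm (f k w)) \<le> (real (Suc k) * cmod z ^ k) * (LINT w|dA. norm (g w))"
        by (simp add: Bochner_Integration.integral_nonneg)
    qed
  qed
  also have "(LINT w|dA. (\<Sum>k. f k w)) = bproj g z"
    unfolding bproj_def dA_int_eq using s
    by (intro Bochner_Integration.integral_cong) (auto simp: sums_iff)
  also have "(\<lambda>k. integral\<^sup>L dA (f k)) = (\<lambda>k. (of_nat (Suc k) * binner g (\<lambda>w. w ^ k)) * z ^ k)"
    unfolding f_def binner_eq by (rule ext, subst integral_mult_right_zero) (simp only: mult_ac)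
  finally show ?thesis .
qed

text \<open>The functions sqrt (k + 1) w^k are orthonormal, and h is the projection of g onto the
  span of those with k < n.\<close>

lemma Bessel_monomials:
  assumes g: "g \<in> sq_integrable"
  shows "(\<Sum>k<n. real (Suc k) * (cmod (binner g (\<lambda>w. w ^ k)))\<^sup>2) \<le> L2.nsq g"
proof -
  define b where "b = (\<lambda>k. binner g (\<lambda>w. w ^ k))"
  define c where "c = (\<lambda>k. of_nat (Suc k) * b k)"
  define h where "h = (\<lambda>w. \<Sum>k<n. c k * w ^ k)"
  define S where "S = (\<Sum>k<n. real (Suc k) * (cmod (b k))\<^sup>2)"
  have E: "(\<lambda>w. w ^ k) \<in> sq_integrable" for k by (intro bergman_sq_integrable monomial_bergman)
  have hV: "h \<in> sq_integrable" unfolding h_def by (rule L2.V_lincomb) (rule E)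
  have t: "cnj (c k) * b k = of_real (real (Suc k) * (cmod (b k))\<^sup>2)" for k
  proof -
    have "cnj (b k) * b k = of_real ((cmod (b k))\<^sup>2)" by (subst complex_norm_square) (rule mult.commute)
    then show ?thesis by (simp add: c_def mult.assoc)
  qed
  have gh: "binner g h = of_real S"
    unfolding h_def S_def of_real_sum
    by (subst L2.lincomb_right[OF E g]) (auto intro!: sum.cong simp: t[unfolded b_def] b_def)
  have Eh: "binner (\<lambda>w. w ^ k) h = cnj (b k)" if "k < n" for k
  proof -
    have "binner (\<lambda>w. w ^ k) h = (\<Sum>j<n. cnj (c j) * binner (\<lambda>w. w ^ k) (\<lambda>w. w ^ j))"
      unfolding h_def by (rule L2.lincomb_right[OF E E])
    also have "\<dots> = (\<Sum>j<n. if j = k then cnj (c k) / of_nat (Suc k) else 0)"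
      by (intro sum.cong refl) (auto simp: binner_monomials)
    also have "\<dots> = cnj (b k)" using that by (simp add: c_def del: of_nat_Suc)
    finally show ?thesis .
  qed
  have hh: "binner h h = of_real S"
  proof -
    have "binner h h = (\<Sum>k<n. c k * binner (\<lambda>w. w ^ k) h)"
      by (subst (1) h_def) (rule L2.lincomb_left[OF E hV])
    also have "\<dots> = (\<Sum>k<n. cnj (cnj (c k) * b k))"
      by (intro sum.cong refl) (simp add: Eh)
    finally show ?thesis by (simp only: t complex_cnj_complex_of_real S_def of_real_sum)
  qed
  have "L2.nsq (\<lambda>x. g x + (-1) * h x) = L2.nsq g + 2 * Re (cnj (-1) * binner g h) + (cmod (-1))\<^sup>2 * L2.nsq h"
    by (rule L2.nsq_add_scale[OF g hV])
  also have "L2.nsq h = S" using hh by (simp add: L2.nsq_def)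
  finally have "L2.nsq (\<lambda>x. g x + (-1) * h x) = L2.nsq g - S" by (simp add: gh)
  moreover have "0 \<le> L2.nsq (\<lambda>x. g x + (-1) * h x)"
    by (intro L2.nsq_nonneg L2.V_add L2.V_scale g hV)
  ultimately show ?thesis by (simp add: S_def b_def)
qed

text \<open>The k-th Parseval term of the series on the disc of radius \<rho> is \<rho>^(2k+2) times
  the k-th Bessel term of g, so Bessel's inequality bounds the mass on every smaller disc.\<close>

lemma bproj_bergman:
  assumes g: "g \<in> sq_integrable"
  shows "bproj g \<in> bergman" "L2.nsq (bproj g) \<le> L2.nsq g"
proof -
  have h: "bproj g holomorphic_on ball 0 1"
    by (rule powser_holomorphic[OF bproj_sums[OF g]])
  have m: "msq \<rho> (bproj g) \<le> L2.nsq g" if "0 < \<rho>" "\<rho> < 1" for \<rho>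
  proof (rule LIMSEQ_le_const2[OF _ exI, rule_format])
    have "(\<lambda>k. (cmod (of_nat (Suc k) * binner g (\<lambda>w. w ^ k)))\<^sup>2 * \<rho> ^ (2 * k + 2) / (real k + 1)) sums msq \<rho> (bproj g)"
      using that by (intro msq_powser bproj_sums[OF g]) auto
    then show "(\<lambda>n. \<Sum>k<n. (cmod (of_nat (Suc k) * binner g (\<lambda>w. w ^ k)))\<^sup>2 * \<rho> ^ (2 * k + 2) / (real k + 1)) \<longlonglongrightarrow> msq \<rho> (bproj g)"
      by (simp only: sums_def)
    fix n
    have "(\<Sum>k<n. (cmod (of_nat (Suc k) * binner g (\<lambda>w. w ^ k)))\<^sup>2 * \<rho> ^ (2 * k + 2) / (real k + 1))
        \<le> (\<Sum>k<n. real (Suc k) * (cmod (binner g (\<lambda>w. w ^ k)))\<^sup>2)"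
    proof (rule sum_mono)
      fix k
      have "(cmod (of_nat (Suc k) * binner g (\<lambda>w. w ^ k)))\<^sup>2 * \<rho> ^ (2 * k + 2) / (real k + 1) =
          real (Suc k) * (cmod (binner g (\<lambda>w. w ^ k)))\<^sup>2 * \<rho> ^ (2 * k + 2)"
        by (simp add: norm_mult power_mult_distrib power2_eq_square add.commute del: of_nat_Suc flip: of_nat_Suc)
      also have "\<dots> \<le> real (Suc k) * (cmod (binner g (\<lambda>w. w ^ k)))\<^sup>2 * 1"
        using that by (intro mult_left_mono power_le_one) auto
      finally show "(cmod (of_nat (Suc k) * binner g (\<lambda>w. w ^ k)))\<^sup>2 * \<rho> ^ (2 * k + 2) / (real k + 1)
        \<le> real (Suc k) * (cmod (binner g (\<lambda>w. w ^ k)))\<^sup>2" by simp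
    qed
    also have "\<dots> \<le> L2.nsq g" by (rule Bessel_monomials[OF g])
    finally show "(\<Sum>k<n. (cmod (of_nat (Suc k) * binner g (\<lambda>w. w ^ k)))\<^sup>2 * \<rho> ^ (2 * k + 2) / (real k + 1)) \<le> L2.nsq g" .
  qed
  show "bproj g \<in> bergman" "L2.nsq (bproj g) \<le> L2.nsq g"
    by (rule bergman_if_msq_bounded[OF h m]; assumption)+
qed

lemma binner_bproj_monomial:
  assumes g: "g \<in> sq_integrable"
  shows "binner (bproj g) (\<lambda>w. w ^ k) = binner g (\<lambda>w. w ^ k)"
proof -
  define R where "R = (\<lambda>n. 1 - 1 / real (Suc (Suc n)))"
  have P: "bproj g \<in> sq_integrable" by (intro bergman_sq_integrable bproj_bergman g)
  have E: "(\<lambda>w. w ^ k) \<in> sq_integrable" by (intro bergman_sq_integrable monomial_bergman)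
  have "(\<lambda>n. LINT z|dA. indicator (cball 0 (R n)) z * (bproj g z * cnj (z ^ k))) \<longlonglongrightarrow> (LINT z|dA. bproj g z * cnj (z ^ k))"
  proof (rule integral_dominated_convergence[where w = "\<lambda>z. norm (bproj g z * cnj (z ^ k))"])
    have m: "(\<lambda>z. bproj g z * cnj (z ^ k)) \<in> borel_measurable dA"
      by (intro borel_measurable_times cnj_monomial_measurable sq_integrableD[OF P])
    show "(\<lambda>z. bproj g z * cnj (z ^ k)) \<in> borel_measurable dA" by (rule m)
    show "(\<lambda>z. indicator (cball 0 (R n)) z * (bproj g z * cnj (z ^ k))) \<in> borel_measurable dA" for n
      by (intro borel_measurable_times indicator_cball_measurable cnj_monomial_measurable sq_integrableD[OF P])
    show "integrable dA (\<lambda>z. norm (bproj g z * cnj (z ^ k)))"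
      by (intro integrable_norm sq_integrable_mult_cnj P E)
    show "AE z in dA. norm (indicator (cball 0 (R n)) z * (bproj g z * cnj (z ^ k))) \<le> norm (bproj g z * cnj (z ^ k))" for n
      by (rule AE_I2) (auto simp: indicator_def)
    show "AE z in dA. (\<lambda>n. indicator (cball 0 (R n)) z * (bproj g z * cnj (z ^ k))) \<longlonglongrightarrow> bproj g z * cnj (z ^ k)"
    proof (rule AE_I2, rule tendsto_eventually)
      fix z assume "z \<in> space dA"
      then have "z \<in> ball 0 1" by simp
      from indicator_inner_radii_tendsto[OF this]
      show "\<forall>\<^sub>F n in sequentially. indicator (cball 0 (R n)) z * (bproj g z * cnj (z ^ k)) = bproj g z * cnj (z ^ k)"
        unfolding R_def by eventually_elim simp
    qed
  qed
  moreover have "(LINT z|dA. indicator (cball 0 (R n)) z * (bproj g z * cnj (z ^ k))) = binner g (\<lambda>w. w ^ k) * of_real (R n ^ (2 * k + 2))" for n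
  proof -
    have "(LINT z|dA. indicator (cball 0 (R n)) z * (bproj g z * cnj (z ^ k))) =
        (of_nat (Suc k) * binner g (\<lambda>w. w ^ k)) * of_real (R n ^ (2 * k + 2) / (real k + 1))"
      using inner_radii(1,2)[of n] by (intro msq_powser(2)[OF bproj_sums[OF g]]) (auto simp: R_def)
    also have "real k + 1 = real (Suc k)" by simp
    also have "(of_nat (Suc k) * binner g (\<lambda>w. w ^ k)) * of_real (R n ^ (2 * k + 2) / real (Suc k)) =
        binner g (\<lambda>w. w ^ k) * of_real (R n ^ (2 * k + 2))"
      by (simp del: of_nat_Suc power_Suc add: field_simps)
    finally show ?thesis .
  qed
  ultimately have "(\<lambda>n. binner g (\<lambda>w. w ^ k) * of_real (R n ^ (2 * k + 2))) \<longlonglongrightarrow> binner (bproj g) (\<lambda>w. w ^ k)"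
    by (simp add: binner_eq)
  moreover have "(\<lambda>n. binner g (\<lambda>w. w ^ k) * of_real (R n ^ (2 * k + 2))) \<longlonglongrightarrow> binner g (\<lambda>w. w ^ k) * of_real (1 ^ (2 * k + 2))"
    unfolding R_def by (intro tendsto_intros inner_radii(3))
  ultimately show ?thesis using LIMSEQ_unique by force
qed

lemma poly_bergman: "(\<lambda>z. \<Sum>k<n. c k * z ^ k) \<in> bergman"
  by (rule bergman.V_lincomb) (rule monomial_bergman)

lemma binner_bproj_poly:
  assumes g: "g \<in> sq_integrable"
  shows "binner (bproj g) (\<lambda>z. \<Sum>k<n. c k * z ^ k) = binner g (\<lambda>z. \<Sum>k<n. c k * z ^ k)"
proof -
  have E: "(\<lambda>w. w ^ k) \<in> sq_integrable" for k by (intro bergman_sq_integrable monomial_bergman)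
  have P: "bproj g \<in> sq_integrable" by (intro bergman_sq_integrable bproj_bergman g)
  show ?thesis by (simp only: L2.lincomb_right[OF E g] L2.lincomb_right[OF E P] binner_bproj_monomial[OF g])
qed

lemma bproj_add:
  assumes f: "f \<in> sq_integrable" and g: "g \<in> sq_integrable" and z: "z \<in> ball 0 1"
  shows "bproj (\<lambda>w. f w + g w) z = bproj f z + bproj g z"
proof -
  have E: "(\<lambda>w. w ^ k) \<in> sq_integrable" for k by (intro bergman_sq_integrable monomial_bergman)
  have "(\<lambda>k. (of_nat (Suc k) * binner (\<lambda>w. f w + g w) (\<lambda>w. w ^ k)) * z ^ k) sums (bproj f z + bproj g z)"
    using sums_add[OF bproj_sums[OF f z] bproj_sums[OF g z]]
    by (simp only: L2.add_left[OF f g E] distrib_left distrib_right)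
  then show ?thesis by (rule sums_unique2[OF bproj_sums[OF L2.V_add[OF f g] z]])
qed

lemma bproj_scale:
  assumes f: "f \<in> sq_integrable" and z: "z \<in> ball 0 1"
  shows "bproj (\<lambda>w. c * f w) z = c * bproj f z"
proof -
  have E: "(\<lambda>w. w ^ k) \<in> sq_integrable" for k by (intro bergman_sq_integrable monomial_bergman)
  have "(\<lambda>k. (of_nat (Suc k) * binner (\<lambda>w. c * f w) (\<lambda>w. w ^ k)) * z ^ k) sums (c * bproj f z)"
    using sums_mult[OF bproj_sums[OF f z], of c]
    by (simp only: L2.scale_left[OF f E] mult_ac)
  then show ?thesis by (rule sums_unique2[OF bproj_sums[OF L2.V_scale[OF f] z]])
qed

text \<open>Links the nonvanishing demanded of eigenvectors at some point of the disc with the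
  positive norm demanded in \<open>compact_form\<close>.\<close>

lemma bergman_nsq_pos_iff:
  assumes "f \<in> bergman"
  shows "0 < L2.nsq f \<longleftrightarrow> (\<exists>z\<in>ball 0 1. f z \<noteq> 0)"
proof
  assume p: "0 < L2.nsq f"
  show "\<exists>z\<in>ball 0 1. f z \<noteq> 0"
  proof (rule ccontr)
    assume "\<not> ?thesis"
    then have "L2.nsq f = L2.nsq (\<lambda>_. 0)" by (intro L2_nsq_cong) auto
    then show False using p by (simp add: L2_nsq)
  qed
next
  assume "\<exists>z\<in>ball 0 1. f z \<noteq> 0"
  then obtain z where z: "z \<in> ball 0 1" "f z \<noteq> 0" by blast
  have "L2.nsq f \<noteq> 0"
    using bergman_pointwise_bound[OF assms z(1)] z(2) by auto
  then show "0 < L2.nsq f" using L2.nsq_nonneg[OF bergman_sq_integrable[OF assms]] by simp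
qed

section \<open>Normal families in the Bergman space\<close>

lemma msq_dominated_tendsto:
  assumes "\<And>n. h n \<in> borel_measurable dA" "g \<in> borel_measurable dA"
    and "\<And>z. z \<in> ball 0 1 \<Longrightarrow> (\<lambda>n. h n z) \<longlonglongrightarrow> g z"
    and "\<And>n z. z \<in> ball 0 1 \<Longrightarrow> z \<in> cball 0 \<rho> \<Longrightarrow> cmod (h n z) \<le> B"
  shows "(\<lambda>n. msq \<rho> (h n)) \<longlonglongrightarrow> msq \<rho> g"
  unfolding msq_def
proof (rule integral_dominated_convergence[where w = "\<lambda>_. B\<^sup>2"])
  note [measurable] = assms(1,2)
  show "(\<lambda>z. indicator (cball 0 \<rho>) z * (cmod (g z))\<^sup>2) \<in> borel_measurable dA" by measurable
  show "(\<lambda>z. indicator (cball 0 \<rho>) z * (cmod (h n z))\<^sup>2) \<in> borel_measurable dA" for n by measurable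
  show "AE z in dA. (\<lambda>n. indicator (cball 0 \<rho>) z * (cmod (h n z))\<^sup>2) \<longlonglongrightarrow> indicator (cball 0 \<rho>) z * (cmod (g z))\<^sup>2"
    by (intro AE_I2 tendsto_intros assms(3)) simp
  show "AE z in dA. norm (indicator (cball 0 \<rho>) z * (cmod (h n z))\<^sup>2) \<le> B\<^sup>2" for n
    using assms(4) by (intro AE_I2) (auto simp: indicator_def intro!: power_mono)
qed simp

text \<open>Weak compactness of the unit ball in concrete form: a subsequence converges in mean
  square on every smaller disc, while mass may still escape to the boundary. A symbol that tends to
  0 there makes the escaping mass harmless.\<close>

lemma bergman_Montel:
  assumes f: "\<And>k::nat. f k \<in> bergman" "\<And>k. L2.nsq (f k) \<le> 1"
  obtains r g where "strict_mono (r :: nat \<Rightarrow> nat)" "g \<in> bergman" "L2.nsq g \<le> 1"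
    "\<And>\<rho>. 0 < \<rho> \<Longrightarrow> \<rho> < 1 \<Longrightarrow> (\<lambda>k. msq \<rho> (\<lambda>z. f (r k) z - g z)) \<longlonglongrightarrow> 0"
proof -
  define H where "H = {h \<in> bergman. L2.nsq h \<le> 1}"
  have pb: "cmod (h z) \<le> 1 / (1 - \<rho>)\<^sup>2" if "h \<in> H" "z \<in> cball 0 \<rho>" "\<rho> < 1" for h z \<rho>
  proof -
    have z: "z \<in> ball 0 1" using that by auto
    have "cmod (h z) \<le> sqrt (L2.nsq h) / (1 - cmod z)\<^sup>2"
      using that z by (intro bergman_pointwise_bound) (auto simp: H_def)
    also have "\<dots> \<le> 1 / (1 - \<rho>)\<^sup>2"
      using that by (intro frac_le power_mono) (auto simp: H_def)
    finally show ?thesis .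
  qed
  have bd: "\<exists>B. \<forall>h\<in>H. \<forall>z\<in>K. cmod (h z) \<le> B" if K: "compact K" "K \<subseteq> ball 0 1" for K
  proof (cases "K = {}")
    case False
    then obtain w where w: "w \<in> K" "\<And>z. z \<in> K \<Longrightarrow> cmod z \<le> cmod w"
      using continuous_attains_sup[OF K(1) False, of cmod] by (auto intro: continuous_intros)
    have "\<forall>h\<in>H. \<forall>z\<in>K. cmod (h z) \<le> 1 / (1 - cmod w)\<^sup>2"
      using w K by (intro ballI pb) auto
    then show ?thesis by blast
  qed auto
  obtain g r where g: "g holomorphic_on ball 0 1" and r: "strict_mono (r :: nat \<Rightarrow> nat)"
    and lim: "\<And>z. z \<in> ball 0 1 \<Longrightarrow> (\<lambda>n. f (r n) z) \<longlonglongrightarrow> g z"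
  proof (rule Montel[of "ball 0 1" H f])
    show "h holomorphic_on ball 0 1" if "h \<in> H" for h
      using that by (auto simp: H_def bergman_holomorphic)
    show "range f \<subseteq> H" using f by (auto simp: H_def)
  qed (auto simp: bd)
  have fH: "f k \<in> H" for k using f by (simp add: H_def)
  have fm: "f k \<in> borel_measurable dA" for k by (intro sq_integrableD bergman_sq_integrable f)
  have gm: "g \<in> borel_measurable dA" by (rule holomorphic_on_measurable_dA[OF g])
  \<comment> \<open>The norm bound passes to the limit on each smaller disc, and from there to the
    whole disc.\<close>
  have "msq \<rho> g \<le> 1" if "0 < \<rho>" "\<rho> < 1" for \<rho>
  proof (rule LIMSEQ_le_const2)
    show "(\<lambda>n. msq \<rho> (f (r n))) \<longlonglongrightarrow> msq \<rho> g"
      by (rule msq_dominated_tendsto[OF fm gm lim pb[OF fH]]) (use that in auto)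
    show "\<exists>N. \<forall>n\<ge>N. msq \<rho> (f (r n)) \<le> 1"
      using msq_le_nsq[OF bergman_sq_integrable[OF f(1)]] f(2) order_trans by blast
  qed
  from bergman_if_msq_bounded[OF g this] have gb: "g \<in> bergman" "L2.nsq g \<le> 1" by blast+
  then have gH: "g \<in> H" by (simp add: H_def)
  have "(\<lambda>k. msq \<rho> (\<lambda>z. f (r k) z - g z)) \<longlonglongrightarrow> 0" if "0 < \<rho>" "\<rho> < 1" for \<rho>
  proof -
    have "(\<lambda>k. msq \<rho> (\<lambda>z. f (r k) z - g z)) \<longlonglongrightarrow> msq \<rho> (\<lambda>_. 0)"
    proof (rule msq_dominated_tendsto)
      show "(\<lambda>z. f (r n) z - g z) \<in> borel_measurable dA" for n
        using fm[of "r n"] gm by measurable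
      show "(\<lambda>n. f (r n) z - g z) \<longlonglongrightarrow> 0" if "z \<in> ball 0 1" for z
        using lim[OF that] by (rule LIM_zero)
      show "cmod (f (r n) z - g z) \<le> 1 / (1 - \<rho>)\<^sup>2 + 1 / (1 - \<rho>)\<^sup>2" if "z \<in> cball 0 \<rho>" for n z
        using pb[OF fH that \<open>\<rho> < 1\<close>, of "r n"] pb[OF gH that \<open>\<rho> < 1\<close>] norm_triangle_ineq4[of "f (r n) z" "g z"] by linarith
    qed simp
    then show ?thesis by (simp add: msq_def)
  qed
  then show ?thesis using that r gb by blast
qed

section \<open>Compactness and singular value bounds\<close>

locale vanishing_symbol =
  fixes \<phi> :: "complex \<Rightarrow> complex" and M :: real
  assumes meas: "\<phi> \<in> borel_measurable dA"
    and bound: "\<And>z. z \<in> ball 0 1 \<Longrightarrow> cmod (\<phi> z) \<le> M"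
    and decay: "\<And>\<eta>. 0 < \<eta> \<Longrightarrow> \<exists>\<rho>. 0 < \<rho> \<and> \<rho> < 1 \<and> (\<forall>z. \<rho> < cmod z \<longrightarrow> cmod z < 1 \<longrightarrow> cmod (\<phi> z) \<le> \<eta>)"
begin

definition form :: "(complex \<Rightarrow> complex) \<Rightarrow> (complex \<Rightarrow> complex) \<Rightarrow> complex" where
  "form f g = binner (toeplitz \<phi> f) (toeplitz \<phi> g)"

lemma mult_sq_integrable: "f \<in> sq_integrable \<Longrightarrow> (\<lambda>z. \<phi> z * f z) \<in> sq_integrable"
  by (rule sq_integrable_mult_bounded[OF meas bound])

lemma toeplitz_bergman: "f \<in> bergman \<Longrightarrow> toeplitz \<phi> f \<in> bergman"
  unfolding toeplitz_eq_bproj by (intro bproj_bergman mult_sq_integrable bergman_sq_integrable)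

lemma nsq_toeplitz_le: "f \<in> bergman \<Longrightarrow> L2.nsq (toeplitz \<phi> f) \<le> L2.nsq (\<lambda>z. \<phi> z * f z)"
  unfolding toeplitz_eq_bproj by (intro bproj_bergman mult_sq_integrable bergman_sq_integrable)

lemma toeplitz_add:
  "f \<in> bergman \<Longrightarrow> g \<in> bergman \<Longrightarrow> z \<in> ball 0 1 \<Longrightarrow>
    toeplitz \<phi> (\<lambda>w. f w + g w) z = toeplitz \<phi> f z + toeplitz \<phi> g z"
  unfolding toeplitz_eq_bproj distrib_left by (intro bproj_add mult_sq_integrable bergman_sq_integrable)

lemma toeplitz_scale:
  assumes "f \<in> bergman" "z \<in> ball 0 1"
  shows "toeplitz \<phi> (\<lambda>w. c * f w) z = c * toeplitz \<phi> f z"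
  using bproj_scale[OF mult_sq_integrable[OF bergman_sq_integrable[OF assms(1)]] assms(2), of c]
  by (simp add: toeplitz_eq_bproj mult.left_commute)

text \<open>Split at |z| = \<rho>: the symbol is at most M inside and at most \<eta> outside. This
  serves both for compactness and for the upper bound of the singular values.\<close>

lemma nsq_mult_le:
  assumes f: "f \<in> sq_integrable" and e: "\<And>z. \<rho> < cmod z \<Longrightarrow> cmod z < 1 \<Longrightarrow> cmod (\<phi> z) \<le> \<eta>"
  shows "L2.nsq (\<lambda>z. \<phi> z * f z) \<le> M\<^sup>2 * msq \<rho> f + \<eta>\<^sup>2 * L2.nsq f"
proof -
  note i = sq_integrableD(2)[OF f]
  have "L2.nsq (\<lambda>z. \<phi> z * f z) \<le>
      (LINT z|dA. M\<^sup>2 * (indicator (cball 0 \<rho>) z * (cmod (f z))\<^sup>2) + \<eta>\<^sup>2 * (cmod (f z))\<^sup>2)"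
    unfolding L2_nsq
  proof (rule integral_mono)
    show "integrable dA (\<lambda>z. (cmod (\<phi> z * f z))\<^sup>2)" by (intro sq_integrableD mult_sq_integrable f)
    show "integrable dA (\<lambda>z. M\<^sup>2 * (indicator (cball 0 \<rho>) z * (cmod (f z))\<^sup>2) + \<eta>\<^sup>2 * (cmod (f z))\<^sup>2)"
      by (intro Bochner_Integration.integrable_add integrable_mult_right integrable_indicator_cball i)
    fix z assume "z \<in> space dA"
    then have z: "cmod z < 1" by simp
    show "(cmod (\<phi> z * f z))\<^sup>2 \<le> M\<^sup>2 * (indicator (cball 0 \<rho>) z * (cmod (f z))\<^sup>2) + \<eta>\<^sup>2 * (cmod (f z))\<^sup>2"
    proof (cases "z \<in> cball 0 \<rho>")
      case True
      have "(cmod (\<phi> z * f z))\<^sup>2 \<le> M\<^sup>2 * (cmod (f z))\<^sup>2"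
        unfolding norm_mult power_mult_distrib using bound z by (intro mult_right_mono power_mono) auto
      then show ?thesis using True by (simp add: add_increasing2)
    next
      case False
      then have "(cmod (\<phi> z * f z))\<^sup>2 \<le> \<eta>\<^sup>2 * (cmod (f z))\<^sup>2"
        unfolding norm_mult power_mult_distrib using e z by (intro mult_right_mono power_mono) auto
      then show ?thesis using False by simp
    qed
  qed
  also have "\<dots> = M\<^sup>2 * msq \<rho> f + \<eta>\<^sup>2 * L2.nsq f"
    unfolding msq_def L2_nsq using i integrable_indicator_cball[OF i, of \<rho>]
    by (simp add: Bochner_Integration.integral_add)
  finally show ?thesis .
qed

text \<open>At radius 1 the outer region is empty, so \<eta> = 0 is allowed.\<close>

lemma nsq_mult_le_bound:
  assumes f: "f \<in> sq_integrable"
  shows "L2.nsq (\<lambda>z. \<phi> z * f z) \<le> M\<^sup>2 * L2.nsq f"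
  using nsq_mult_le[OF f, of 1 0] msq_1 by simp

lemma semi_inner_form: "semi_inner bergman form"
proof
  fix f g h assume "f \<in> bergman" "g \<in> bergman" "h \<in> bergman"
  then show "form (\<lambda>x. f x + g x) h = form f h + form g h"
    unfolding form_def
    by (subst bergman.add_left[symmetric]) (auto intro!: binner_cong toeplitz_add toeplitz_bergman)
next
  fix f h :: "complex \<Rightarrow> complex" and c assume "f \<in> bergman" "h \<in> bergman"
  then show "form (\<lambda>x. c * f x) h = c * form f h"
    unfolding form_def
    by (subst bergman.scale_left[symmetric]) (auto intro!: binner_cong toeplitz_scale toeplitz_bergman)
next
  fix f g assume "f \<in> bergman" "g \<in> bergman"
  then show "form g f = cnj (form f g)"
    unfolding form_def by (intro bergman.commute toeplitz_bergman)
next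
  fix f assume "f \<in> bergman"
  then show "0 \<le> Re (form f f)"
    unfolding form_def by (intro bergman.nonneg toeplitz_bergman)
qed (auto intro: bergman.V_zero bergman.V_add bergman.V_scale)

lemma form_nsq: "semi_inner.nsq form f = L2.nsq (toeplitz \<phi> f)"
  using semi_inner.nsq_def[OF semi_inner_form] by (simp add: form_def L2.nsq_def)

sublocale T: compact_form bergman binner form "M\<^sup>2"
proof -
  interpret b: semi_inner bergman form by (rule semi_inner_form)
  show "compact_form bergman binner form (M\<^sup>2)"
  proof
    fix f assume f: "f \<in> bergman"
    show "b.nsq f \<le> M\<^sup>2 * L2.nsq f"
      unfolding form_nsq using nsq_toeplitz_le[OF f] nsq_mult_le_bound[OF bergman_sq_integrable[OF f]] by linarith
  next
    fix f :: "nat \<Rightarrow> complex \<Rightarrow> complex"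
    assume f: "\<And>k. f k \<in> bergman" "\<And>k. L2.nsq (f k) \<le> 1"
    obtain r g where r: "strict_mono (r :: nat \<Rightarrow> nat)" and g: "g \<in> bergman" "L2.nsq g \<le> 1"
      and lim: "\<And>\<rho>. 0 < \<rho> \<Longrightarrow> \<rho> < 1 \<Longrightarrow> (\<lambda>k. msq \<rho> (\<lambda>z. f (r k) z - g z)) \<longlonglongrightarrow> 0"
      by (rule bergman_Montel[of f, OF f]) (rule that; assumption)
    have d: "(\<lambda>z. f k z - g z) \<in> bergman" for k by (intro bergman.V_diff f g)
    have d4: "L2.nsq (\<lambda>z. f k z - g z) \<le> 4" for k
      using bergman.nsq_diff_le[OF f(1)[of k] g(1)] f(2)[of k] g(2) by linarith
    have "(\<lambda>k. b.nsq (\<lambda>x. f (r k) x - g x)) \<longlonglongrightarrow> 0"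
    proof (rule LIMSEQ_I)
      fix \<epsilon> :: real assume e: "0 < \<epsilon>"
      \<comment> \<open>Differences of elements of the unit ball have square norm at most 2 + 2 = 4,
        so the outer part contributes at most \<epsilon> / 2.\<close>
      define \<eta> where "\<eta> = sqrt (\<epsilon> / 8)"
      have eta: "0 < \<eta>" "\<eta>\<^sup>2 * 4 = \<epsilon> / 2" using e by (auto simp: \<eta>_def)
      obtain \<rho> where rho: "0 < \<rho>" "\<rho> < 1" "\<forall>z. \<rho> < cmod z \<longrightarrow> cmod z < 1 \<longrightarrow> cmod (\<phi> z) \<le> \<eta>"
        using decay[OF eta(1)] by blast
      have "(\<lambda>k. M\<^sup>2 * msq \<rho> (\<lambda>z. f (r k) z - g z)) \<longlonglongrightarrow> M\<^sup>2 * 0"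
        by (intro tendsto_mult tendsto_const lim rho)
      then have "\<forall>\<^sub>F k in sequentially. M\<^sup>2 * msq \<rho> (\<lambda>z. f (r k) z - g z) < \<epsilon> / 2"
        by (rule order_tendstoD) (use e in simp)
      then obtain N where N: "\<And>k. k \<ge> N \<Longrightarrow> M\<^sup>2 * msq \<rho> (\<lambda>z. f (r k) z - g z) < \<epsilon> / 2"
        by (auto simp: eventually_sequentially)
      show "\<exists>N. \<forall>k\<ge>N. norm (b.nsq (\<lambda>x. f (r k) x - g x) - 0) < \<epsilon>"
      proof (intro exI allI impI)
        fix k assume k: "k \<ge> N"
        have "b.nsq (\<lambda>x. f (r k) x - g x) \<le> L2.nsq (\<lambda>z. \<phi> z * (f (r k) z - g z))"
          unfolding form_nsq by (rule nsq_toeplitz_le[OF d])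
        also have "\<dots> \<le> M\<^sup>2 * msq \<rho> (\<lambda>z. f (r k) z - g z) + \<eta>\<^sup>2 * L2.nsq (\<lambda>z. f (r k) z - g z)"
          by (rule nsq_mult_le[OF bergman_sq_integrable[OF d]]) (use rho in blast)
        also have "\<dots> \<le> M\<^sup>2 * msq \<rho> (\<lambda>z. f (r k) z - g z) + \<eta>\<^sup>2 * 4"
          by (intro add_left_mono mult_left_mono d4) simp
        also have "\<dots> < \<epsilon>" using N[OF k] eta by linarith
        finally show "norm (b.nsq (\<lambda>x. f (r k) x - g x) - 0) < \<epsilon>"
          using b.nsq_nonneg[OF d] by simp
      qed
    qed
    then show "\<exists>r g. strict_mono r \<and> g \<in> bergman \<and> L2.nsq g \<le> 1 \<and> (\<lambda>k. b.nsq (\<lambda>x. f (r k) x - g x)) \<longlonglongrightarrow> 0"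
      using r g by blast
  qed
qed

lemma compact_toeplitz: "compact_bergman_op (toeplitz \<phi>)"
  unfolding compact_bergman_op_def
proof (intro conjI ballI allI impI)
  fix f assume "f \<in> bergman" then show "toeplitz \<phi> f \<in> bergman" by (rule toeplitz_bergman)
next
  fix f :: "nat \<Rightarrow> complex \<Rightarrow> complex"
  assume "\<forall>k. f k \<in> bergman \<and> bnorm (f k) \<le> 1"
  then have f: "\<And>k. f k \<in> bergman" "\<And>k. L2.nsq (f k) \<le> 1" by (auto simp: bnorm_nsq)
  obtain r g where r: "strict_mono (r :: nat \<Rightarrow> nat)" and g: "g \<in> bergman"
    and lim: "(\<lambda>k. T.b.nsq (\<lambda>x. f (r k) x - g x)) \<longlonglongrightarrow> 0"
    using T.compact[of f, OF f] by (elim exE conjE) (rule that)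
  show "\<exists>r::nat \<Rightarrow> nat. strict_mono r \<and> (\<forall>e::real>0. \<exists>N::nat. \<forall>m\<ge>N. \<forall>k\<ge>N. bnorm (\<lambda>z. toeplitz \<phi> (f (r m)) z - toeplitz \<phi> (f (r k)) z) < e)"
  proof (intro exI[of _ r] conjI r allI impI)
    fix e :: real assume e: "0 < e"
    have "\<forall>\<^sub>F k in sequentially. T.b.nsq (\<lambda>x. f (r k) x - g x) < e\<^sup>2 / 4"
      by (rule order_tendstoD(2)[OF lim]) (use e in simp)
    then obtain N where N: "\<And>k. k \<ge> N \<Longrightarrow> T.b.nsq (\<lambda>x. f (r k) x - g x) < e\<^sup>2 / 4"
      by (auto simp: eventually_sequentially)
    show "\<exists>N::nat. \<forall>m\<ge>N. \<forall>k\<ge>N. bnorm (\<lambda>z. toeplitz \<phi> (f (r m)) z - toeplitz \<phi> (f (r k)) z) < e"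
    proof (intro exI allI impI)
      fix m k assume mk: "m \<ge> N" "k \<ge> N"
      have V: "(\<lambda>x. f (r m) x - g x) \<in> bergman" "(\<lambda>x. f (r k) x - g x) \<in> bergman"
        by (intro bergman.V_diff f g)+
      \<comment> \<open>Linearity of the kernel integral is available for z in the disc, which is
        all that the norm sees.\<close>
      have "L2.nsq (\<lambda>z. toeplitz \<phi> (f (r m)) z - toeplitz \<phi> (f (r k)) z) = L2.nsq (toeplitz \<phi> (\<lambda>w. f (r m) w + (-1) * f (r k) w))"
      proof (rule L2_nsq_cong)
        fix z :: complex assume z: "z \<in> ball 0 1"
        show "toeplitz \<phi> (f (r m)) z - toeplitz \<phi> (f (r k)) z = toeplitz \<phi> (\<lambda>w. f (r m) w + (-1) * f (r k) w) z"
          by (simp only: toeplitz_add[OF f(1) bergman.V_scale[OF f(1)] z] toeplitz_scale[OF f(1) z]) simp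
      qed
      also have "\<dots> = T.b.nsq (\<lambda>x. (f (r m) x - g x) - (f (r k) x - g x))"
        unfolding form_nsq by simp
      also have "\<dots> \<le> 2 * T.b.nsq (\<lambda>x. f (r m) x - g x) + 2 * T.b.nsq (\<lambda>x. f (r k) x - g x)"
        by (rule T.b.nsq_diff_le[OF V])
      also have "\<dots> < e\<^sup>2" using N[OF mk(1)] N[OF mk(2)] by linarith
      finally show "bnorm (\<lambda>z. toeplitz \<phi> (f (r m)) z - toeplitz \<phi> (f (r k)) z) < e"
        unfolding bnorm_nsq using e by (intro real_less_lsqrt) auto
    qed
  qed
qed

lemma eigvec_iff: "eigvec_TsT (toeplitz \<phi>) s f \<longleftrightarrow> T.eigpair s f"
  unfolding eigvec_TsT_def T.eigpair_def using bergman_nsq_pos_iff[of f] by (auto simp: form_def)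

text \<open>Upper half of the min-max principle: vanishing of the first n - 1 Taylor coefficients
  amounts to n - 1 linear conditions, so the span of n independent eigenvectors contains a nonzero
  function to which both estimates apply.\<close>

lemma eig_count_le:
  assumes n: "1 \<le> n" and c: "eig_count_ge (toeplitz \<phi>) t n"
    and U: "\<And>f. f \<in> bergman \<Longrightarrow> (\<And>k. k < n - 1 \<Longrightarrow> tcoeff f k = 0) \<Longrightarrow> L2.nsq (toeplitz \<phi> f) \<le> \<tau> * L2.nsq f"
  shows "t \<le> \<tau>"
proof -
  obtain f s where f: "\<And>i. i < n \<Longrightarrow> T.eigpair (s i) (f i) \<and> s i \<ge> t"
    and ind: "\<And>c. \<forall>z\<in>ball 0 1. (\<Sum>i<n. c i * f i z) = 0 \<Longrightarrow> \<forall>i<n. c i = 0"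
    using c unfolding eig_count_ge_def eigvec_iff by (elim exE conjE) (rule that, auto)
  have fb: "f i \<in> bergman" if "i < n" for i using f[OF that] by (simp add: T.eigpair_def)
  obtain c where c: "\<exists>i\<in>{..<n}. c i \<noteq> 0" "\<forall>k<n - 1. (\<Sum>i<n. c i * tcoeff (f i) k) = 0"
    using homogeneous_system_nontrivial[of "{..<n}" "n - 1" "\<lambda>k i. tcoeff (f i) k"] n by auto
  define F where "F = (\<lambda>z. \<Sum>i<n. c i * f i z)"
  have FV: "F \<in> bergman" unfolding F_def by (rule bergman.V_lincomb) (auto intro: fb)
  have "tcoeff F k = 0" if "k < n - 1" for k
    unfolding F_def using c that by (subst tcoeff_lincomb) (auto intro: fb bergman_holomorphic)
  then have "L2.nsq (toeplitz \<phi> F) \<le> \<tau> * L2.nsq F" by (rule U[OF FV])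
  moreover have "t * L2.nsq F \<le> L2.nsq (toeplitz \<phi> F)"
    unfolding F_def form_nsq[symmetric] by (rule T.eigen_span_lower[OF f])
  moreover have "0 < L2.nsq F"
    unfolding bergman_nsq_pos_iff[OF FV] using ind[of c] c(1) by (auto simp: F_def)
  ultimately show ?thesis by (meson mult_le_cancel_right not_less order_trans)
qed

lemma sing_val_le:
  assumes "1 \<le> n" "0 \<le> \<tau>"
    and "\<And>f. f \<in> bergman \<Longrightarrow> (\<And>k. k < n - 1 \<Longrightarrow> tcoeff f k = 0) \<Longrightarrow> L2.nsq (toeplitz \<phi> f) \<le> \<tau> * L2.nsq f"
  shows "sing_val (toeplitz \<phi>) n \<le> sqrt \<tau>"
  unfolding sing_val_def lambda_TsT_def
proof (intro real_sqrt_le_mono cSup_least)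
  fix t assume "t \<in> {t. 0 < t \<and> eig_count_ge (toeplitz \<phi>) t n} \<union> {0}"
  then show "t \<le> \<tau>" using eig_count_le[OF assms(1) _ assms(3)] assms(2) by auto
qed simp

text \<open>The assumption 1 \<le> n supplies at least one eigenvector, whose eigenvalue is at most
  M^2; for n = 0 every positive t would be counted.\<close>

lemma bdd_above_eig_count:
  assumes n: "1 \<le> n"
  shows "bdd_above ({t. 0 < t \<and> eig_count_ge (toeplitz \<phi>) t n} \<union> {0})"
proof (rule bdd_aboveI[of _ "M\<^sup>2"])
  fix u assume "u \<in> {t. 0 < t \<and> eig_count_ge (toeplitz \<phi>) t n} \<union> {0}"
  then consider "u = 0" | "eig_count_ge (toeplitz \<phi>) u n" by auto
  then show "u \<le> M\<^sup>2"
  proof cases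
    case 2
    then obtain f s where "\<forall>i<n. s i \<ge> u \<and> T.eigpair (s i) (f i)"
      unfolding eig_count_ge_def eigvec_iff by blast
    then have "s 0 \<ge> u" "T.eigpair (s 0) (f 0)" using n by auto
    then show ?thesis using T.eigpair_le[of "s 0" "f 0"] by linarith
  qed simp
qed

lemma sing_val_nonneg: "1 \<le> n \<Longrightarrow> 0 \<le> sing_val (toeplitz \<phi>) n"
  unfolding sing_val_def lambda_TsT_def real_sqrt_ge_0_iff
  by (rule cSup_upper[OF _ bdd_above_eig_count]) auto

text \<open>The eigenvectors built from the test space are pairwise orthogonal, and this gives the
  linear independence that the multiplicity count demands. For t = 0 nothing has to be built, since
  0 is put into the set by definition.\<close>

lemma sing_val_ge:
  assumes n: "1 \<le> n" and t: "0 \<le> t"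
    and v: "\<And>i. i < n \<Longrightarrow> v i \<in> bergman"
    and pos: "\<And>c. (\<exists>i<n. c i \<noteq> 0) \<Longrightarrow> L2.nsq (\<lambda>x. \<Sum>i<n. c i * v i x) > 0"
    and low: "\<And>c. L2.nsq (toeplitz \<phi> (\<lambda>x. \<Sum>i<n. c i * v i x)) \<ge> t * L2.nsq (\<lambda>x. \<Sum>i<n. c i * v i x)"
  shows "sing_val (toeplitz \<phi>) n \<ge> sqrt t"
proof -
  define S where "S = {t. 0 < t \<and> eig_count_ge (toeplitz \<phi>) t n} \<union> {0}"
  have bdd: "bdd_above S" unfolding S_def by (rule bdd_above_eig_count[OF n])
  have "t \<in> S"
  proof (cases "t = 0")
    case False
    then have t': "0 < t" using t by simp
    have "\<exists>e s. (\<forall>i<n. T.eigpair (s i) (e i) \<and> t \<le> s i) \<and> (\<forall>i<n. \<forall>j<n. i \<noteq> j \<longrightarrow> binner (e i) (e j) = 0)"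
    proof (rule T.eigpairs_exist[of n v t])
      show "t * L2.nsq (\<lambda>x. \<Sum>i<n. c i * v i x) \<le> T.b.nsq (\<lambda>x. \<Sum>i<n. c i * v i x)" for c
        unfolding form_nsq by (rule low)
    qed (fact v pos t')+
    then obtain e s where e: "\<forall>i<n. T.eigpair (s i) (e i) \<and> s i \<ge> t"
      and o: "\<forall>i<n. \<forall>j<n. i \<noteq> j \<longrightarrow> binner (e i) (e j) = 0"
      by (elim exE conjE) (rule that)
    have eb: "e i \<in> bergman" if "i < n" for i using e that by (simp add: T.eigpair_def)
    have "\<forall>i<n. c i = 0" if z: "\<forall>z\<in>ball 0 1. (\<Sum>i<n. c i * e i z) = 0" for c :: "nat \<Rightarrow> complex"
    proof (intro allI impI)
      fix j assume j: "j < n"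
      have "0 = binner (\<lambda>_. 0) (e j)" using bergman.zero_left[OF eb[OF j]] by simp
      also have "\<dots> = binner (\<lambda>z. \<Sum>i<n. c i * e i z) (e j)" using z by (intro binner_cong) auto
      also have "\<dots> = (\<Sum>i<n. c i * binner (e i) (e j))" by (rule bergman.lincomb_left) (auto intro: eb j)
      also have "\<dots> = (\<Sum>i<n. if i = j then c j * binner (e j) (e j) else 0)"
        using o j by (intro sum.cong) auto
      also have "\<dots> = c j * of_real (L2.nsq (e j))" using j bergman.ip_self[OF eb[OF j]] by simp
      finally show "c j = 0" using e j by (auto simp: T.eigpair_def)
    qed
    then have "eig_count_ge (toeplitz \<phi>) t n"
      unfolding eig_count_ge_def eigvec_iff using e by (intro exI[of _ e] exI[of _ s]) auto
    then show ?thesis using t' by (simp add: S_def)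
  qed (simp add: S_def)
  then have "t \<le> Sup S" using bdd by (rule cSup_upper)
  then show ?thesis unfolding sing_val_def lambda_TsT_def S_def by (rule real_sqrt_le_mono)
qed

end

section \<open>Polynomials concentrated near a boundary point\<close>

lemma cmod_cis_minus_1_le: "cmod (cis a - 1) \<le> \<bar>a\<bar>"
proof -
  have "cmod (cis a - 1) = 2 * \<bar>sin (a / 2)\<bar>"
    using dist_exp_i_1[of a] by (simp add: cis_conv_exp)
  also have "\<dots> \<le> \<bar>a\<bar>" using abs_sin_x_le_abs_x[of "a / 2"] by simp
  finally show ?thesis .
qed

lemma rotation_near_1:
  assumes y: "cmod y = 1" and K: "0 < K"
  shows "\<exists>k<K. cmod (cis (2 * pi / real K) ^ k * y - 1) \<le> 2 * pi / real K"
proof -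
  define t where "t = Arg2pi y"
  have t: "0 \<le> t" "t < 2 * pi" "y = cis t"
    using Arg2pi[of y] y by (auto simp: t_def is_Arg_def cis_conv_exp)
  \<comment> \<open>The real number of steps of size 2 \<pi> / K from the angle t up to 2 \<pi>.
    Taking \<open>\<lceil>a\<rceil> - 1\<close> steps stops strictly short of 2 \<pi>, so that k < K
    also when t = 0 and a = K.\<close>
  define a where "a = real K * (2 * pi - t) / (2 * pi)"
  have "0 < a" using K t by (simp add: a_def)
  have "real K * (2 * pi - t) \<le> real K * (2 * pi)" using t by (intro mult_left_mono) auto
  then have "a \<le> real K" by (simp add: a_def field_simps)
  define k where "k = nat (\<lceil>a\<rceil> - 1)"
  have k: "real k < a" "a \<le> real k + 1"
    using \<open>0 < a\<close> unfolding k_def by linarith+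
  have "k < K" using k \<open>a \<le> real K\<close> by linarith
  have aK: "a * (2 * pi / real K) = 2 * pi - t" using K by (simp add: a_def)
  have 1: "real k * (2 * pi / real K) < 2 * pi - t"
    unfolding aK[symmetric] using k K by (intro mult_strict_right_mono) auto
  have 2: "2 * pi - t \<le> (real k + 1) * (2 * pi / real K)"
    unfolding aK[symmetric] using k K by (intro mult_right_mono) auto
  have "cis (2 * pi / real K) ^ k * y = cis (real k * (2 * pi / real K) + t - 2 * pi)"
    unfolding t(3) Complex.DeMoivre cis_mult by (simp add: cis_divide[symmetric])
  then have "cmod (cis (2 * pi / real K) ^ k * y - 1) \<le> \<bar>real k * (2 * pi / real K) + t - 2 * pi\<bar>"
    using cmod_cis_minus_1_le by simp
  also have "\<dots> \<le> 2 * pi / real K" using 1 2[unfolded distrib_right mult_1] by linarith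
  finally show ?thesis using \<open>k < K\<close> by blast
qed

text \<open>The parallelogram law for 1 and x. It converts distance from 1 into the size of 1 + x,
  on which the bump is built.\<close>

lemma cmod_1_plus_squared:
  assumes "cmod x = 1"
  shows "(cmod (1 + x))\<^sup>2 = 4 - (cmod (x - 1))\<^sup>2"
proof -
  have "(Re x)\<^sup>2 + (Im x)\<^sup>2 = 1" using assms by (simp add: cmod_def)
  then show ?thesis unfolding cmod_power2 by (simp add: power2_eq_square algebra_simps)
qed

lemma integrable_bounded_mult:
  fixes f g :: "complex \<Rightarrow> real"
  assumes "integrable dA g" "f \<in> borel_measurable dA" "\<And>z. z \<in> ball 0 1 \<Longrightarrow> \<bar>f z\<bar> \<le> B"
  shows "integrable dA (\<lambda>z. f z * g z)"
proof (rule Bochner_Integration.integrable_bound)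
  show "integrable dA (\<lambda>z. B * g z)" using assms by (intro integrable_mult_right)
  show "(\<lambda>z. f z * g z) \<in> borel_measurable dA"
    using assms(2) borel_measurable_integrable[OF assms(1)] by measurable
  show "AE z in dA. norm (f z * g z) \<le> norm (B * g z)"
  proof (rule AE_I2)
    fix z assume "z \<in> space dA"
    then have "\<bar>f z\<bar> \<le> B" using assms(3) by simp
    then show "norm (f z * g z) \<le> norm (B * g z)"
      by (auto simp: abs_mult intro!: mult_right_mono)
  qed
qed

section \<open>Test polynomials\<close>

lemma poly_eq_sum_lessThan:
  fixes p :: "complex poly"
  assumes "degree p < N"
  shows "poly p z = (\<Sum>i<N. coeff p i * z ^ i)"
proof -
  have "poly p z = (\<Sum>i\<le>degree p. coeff p i * z ^ i)" by (rule poly_altdef)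
  also have "\<dots> = (\<Sum>i<N. coeff p i * z ^ i)"
    using assms by (intro sum.mono_neutral_left) (auto simp: coeff_eq_0)
  finally show ?thesis .
qed

lemma poly_fun_bergman: "poly p \<in> bergman"
proof -
  have "poly p = (\<lambda>z. \<Sum>i<Suc (degree p). coeff p i * z ^ i)"
    by (intro ext poly_eq_sum_lessThan) simp
  then show ?thesis using poly_bergman[of "coeff p" "Suc (degree p)"] by (simp only:)
qed

lemma tcoeff_poly: "tcoeff (poly p) k = coeff p k"
proof (rule tcoeff_unique)
  fix z :: complex
  show "(\<lambda>k. coeff p k * z ^ k) sums poly p z"
    unfolding poly_altdef by (rule sums_finite) (auto simp: coeff_eq_0)
qed

lemma nsq_poly_pos: assumes "p \<noteq> 0" shows "0 < L2.nsq (poly p)"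
proof -
  have "finite {z. poly p z = 0}" using assms by (rule poly_roots_finite)
  moreover have "infinite (ball (0::complex) 1)" by (rule uncountable_infinite) (simp add: uncountable_ball)
  ultimately have "\<not> ball 0 1 \<subseteq> {z. poly p z = 0}" using finite_subset by blast
  then show ?thesis using bergman_nsq_pos_iff[OF poly_fun_bergman] by auto
qed

text \<open>A peak function: for |\<zeta>| = 1 the base (1 + cnj \<zeta> z) / 2 has modulus 1 at
  \<zeta> and less elsewhere on the closed disc.\<close>

definition bump :: "complex \<Rightarrow> nat \<Rightarrow> complex poly" where
  "bump \<zeta> L = [:1/2, cnj \<zeta> / 2:] ^ L"

text \<open>This is z^(K m) q(z^K) with deg q < n; the coefficients of q are the argument c, so the
  n-dimensional test space is parametrized linearly.\<close>

definition gap_poly :: "nat \<Rightarrow> nat \<Rightarrow> nat \<Rightarrow> (nat \<Rightarrow> complex) \<Rightarrow> complex poly" where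
  "gap_poly K m n c = (\<Sum>j<n. monom (c j) (K * (j + m)))"

lemma poly_bump: "poly (bump \<zeta> L) z = ((1 + cnj \<zeta> * z) / 2) ^ L"
  by (simp add: bump_def algebra_simps add_divide_distrib)

lemma poly_gap_poly: "poly (gap_poly K m n c) z = (\<Sum>j<n. c j * z ^ (K * (j + m)))"
  by (simp add: gap_poly_def poly_sum poly_monom)

lemma degree_bump_gap_poly: "degree (bump \<zeta> L * gap_poly K m n c) \<le> L + K * (n + m)"
proof -
  have "degree (bump \<zeta> L) \<le> L"
    unfolding bump_def using degree_power_le[of "[:1/2, cnj \<zeta> / 2:]" L] degree_pCons_le[of "1/2" "[:cnj \<zeta> / 2:]"]
    by (intro order_trans[OF degree_power_le]) auto
  moreover have "degree (gap_poly K m n c) \<le> K * (n + m)"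
    unfolding gap_poly_def
    by (intro degree_sum_le) (auto intro!: order_trans[OF degree_monom_le] mult_left_mono)
  ultimately show ?thesis using degree_mult_le[of "bump \<zeta> L" "gap_poly K m n c"] by linarith
qed

lemma coeff_gap_poly:
  assumes "0 < K"
  shows "j < n \<Longrightarrow> coeff (gap_poly K m n c) (K * (j + m)) = c j"
    and "i < K * m \<Longrightarrow> coeff (gap_poly K m n c) i = 0"
proof -
  assume j: "j < n"
  have "coeff (gap_poly K m n c) (K * (j + m)) = (\<Sum>i<n. if i = j then c i else 0)"
    unfolding gap_poly_def coeff_sum using assms by (intro sum.cong) auto
  then show "coeff (gap_poly K m n c) (K * (j + m)) = c j" using j by simp
next
  assume i: "i < K * m"
  have "K * (j + m) \<noteq> i" for j using i by (simp add: distrib_left)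
  then show "coeff (gap_poly K m n c) i = 0" unfolding gap_poly_def coeff_sum by (intro sum.neutral) auto
qed

lemma gap_poly_rotate:
  assumes "\<omega> ^ K = 1"
  shows "poly (gap_poly K m n c) (\<omega> * z) = poly (gap_poly K m n c) z"
  using assms by (simp add: poly_gap_poly power_mult_distrib power_mult)

lemma bump_nonzero: "bump \<zeta> L \<noteq> 0"
  by (simp add: bump_def)

text \<open>The modulus of \<^term>\<open>gap_poly K m n c\<close> is invariant under rotations by \<open>2\<pi>/K\<close>, so its mass
  cannot avoid the arc on which the bump is large; the factor \<open>z^(K * m)\<close> makes the mass near the origin,
  where the bump does not discriminate between directions, negligible.\<close>

lemma mass_concentration:
  fixes \<Phi> :: "complex \<Rightarrow> real" and \<zeta> :: complex
  assumes m: "\<Phi> \<in> borel_measurable dA"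
    and \<Phi>01: "\<And>z. z \<in> ball 0 1 \<Longrightarrow> 0 \<le> \<Phi> z \<and> \<Phi> z \<le> 1"
    and rad: "\<And>\<omega> z. cmod \<omega> = 1 \<Longrightarrow> \<Phi> (\<omega> * z) = \<Phi> z"
    and low: "\<And>\<rho>. 0 < \<rho> \<Longrightarrow> \<rho> < 1 \<Longrightarrow> \<exists>d>0. \<forall>z\<in>cball 0 \<rho>. d \<le> \<Phi> z"
    and \<zeta>: "cmod \<zeta> = 1" and \<eta>: "0 < \<eta>" "\<eta> \<le> 1" and \<epsilon>: "0 < \<epsilon>"
  shows "\<exists>K L m. 0 < K \<and> (\<forall>n c. let f = poly (bump \<zeta> L * gap_poly K m n c) in
    (LINT z|dA. indicator {z. \<eta> < cmod (sgn z - \<zeta>)} z * (\<Phi> z * (cmod (f z))\<^sup>2)) \<le>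
      \<epsilon> * (LINT z|dA. \<Phi> z * (cmod (f z))\<^sup>2))"
proof -
  \<comment> \<open>By \<open>cmod_1_plus_squared\<close> these are the values of |1 + x| for x on
    the circle at distance \<eta> / 2 and \<eta> from 1.\<close>
  define s1 s2 where "s1 = sqrt (4 - (\<eta> / 2)\<^sup>2)" and "s2 = sqrt (4 - \<eta>\<^sup>2)"
  have e2: "0 < \<eta>\<^sup>2" "\<eta>\<^sup>2 \<le> 1" using \<eta> by (auto intro: power_le_one)
  have s12: "0 \<le> s2" "s2 < s1" "s1 \<le> 2"
  proof -
    show "0 \<le> s2" "s2 < s1" using e2 by (auto simp: s1_def s2_def power_divide)
    show "s1 \<le> 2" unfolding s1_def by (rule real_le_lsqrt) auto
  qed
  \<comment> \<open>Moving z off the circle by \<kappa> changes |1 + cnj \<zeta> z| by at most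
    \<kappa>; a third of the gap leaves B2 < B1 after this loss on both sides.\<close>
  define \<kappa> where "\<kappa> = (s1 - s2) / 3"
  have kap: "0 < \<kappa>" "\<kappa> < 1" using s12 by (auto simp: \<kappa>_def)
  define \<rho> where "\<rho> = 1 - \<kappa>"
  have rho: "0 < \<rho>" "\<rho> < 1" using kap by (auto simp: \<rho>_def)
  define B1 B2 where "B1 = (s1 - \<kappa>) / 2" and "B2 = (s2 + \<kappa>) / 2"
  have B: "0 < B2" "B2 < B1" using s12 kap by (auto simp: B1_def B2_def \<kappa>_def field_simps)
  \<comment> \<open>So fine that on the circle every orbit of the rotation by 2 \<pi> / K comes
    within \<eta> / 2 of \<zeta>.\<close>
  obtain K :: nat where K0: "4 * pi / \<eta> < real K" using reals_Archimedean2 by blast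
  have K: "0 < K" "2 * pi / real K \<le> \<eta> / 2"
  proof -
    have "0 < 4 * pi / \<eta>" using \<eta> by simp
    then show "0 < K" using K0 by (simp del: zero_less_divide_iff)
    then show "2 * pi / real K \<le> \<eta> / 2" using K0 \<eta> by (simp add: field_simps)
  qed
  \<comment> \<open>K pays for summing over the K rotations, and 2 for the two contributions to the
    mass off the arc, from the inner disc and from the annulus.\<close>
  define \<epsilon>' where "\<epsilon>' = \<epsilon> / (2 * real K)"
  have eps': "0 < \<epsilon>'" using \<epsilon> K by (simp add: \<epsilon>'_def)
  have "(\<lambda>L. ((B2 / B1)\<^sup>2) ^ L) \<longlonglongrightarrow> 0"
    using B by (intro LIMSEQ_realpow_zero) (auto simp: power_less_one_iff)
  then have "\<forall>\<^sub>F L in sequentially. ((B2 / B1)\<^sup>2) ^ L < \<epsilon>'" by (rule order_tendstoD(2)) (rule eps')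
  then obtain L where L: "((B2 / B1)\<^sup>2) ^ L < \<epsilon>'" by (auto simp: eventually_sequentially)
  define \<beta>1 \<beta>2 where "\<beta>1 = (B1 ^ L)\<^sup>2" and "\<beta>2 = (B2 ^ L)\<^sup>2"
  have b1: "0 < \<beta>1" using B by (simp add: \<beta>1_def)
  have "\<beta>2 / \<beta>1 < \<epsilon>'"
    using L by (simp add: \<beta>1_def \<beta>2_def power_divide power_mult[symmetric] mult.commute)
  then have b2: "\<beta>2 \<le> \<epsilon>' * \<beta>1" using b1 by (simp add: field_simps)
  \<comment> \<open>An intermediate radius: the mass in radius \<rho> is compared with that in
    radius \<rho>', where \<Phi> is bounded below by d.\<close>
  define \<rho>' where "\<rho>' = (1 + \<rho>) / 2"
  have rho': "\<rho> < \<rho>'" "\<rho>' < 1" "0 < \<rho>'" using rho by (auto simp: \<rho>'_def)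
  obtain d where d: "0 < d" "\<And>z. z \<in> cball 0 \<rho>' \<Longrightarrow> d \<le> \<Phi> z" using low rho' by blast
  \<comment> \<open>The 1/2 absorbs X into the left side of
    \<open>X \<le> \<theta>0 * (X + Y)\<close>; the other term makes the result at most \<epsilon>'
    * \<beta>1 * Y. Through \<beta>1 this depends on L, hence m is chosen after L.\<close>
  define \<theta>0 where "\<theta>0 = min (1/2) (\<epsilon>' * \<beta>1 / 2)"
  have th0: "0 < \<theta>0" using eps' b1 by (simp add: \<theta>0_def)
  have "(\<lambda>j. (\<rho> / \<rho>') ^ j / d) \<longlonglongrightarrow> 0 / d"
    using rho rho' d by (intro tendsto_divide tendsto_const LIMSEQ_realpow_zero) auto
  then have "\<forall>\<^sub>F j in sequentially. (\<rho> / \<rho>') ^ j / d < \<theta>0" by (rule order_tendstoD(2)) (use th0 in simp)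
  then obtain m where mm: "\<And>j. m \<le> j \<Longrightarrow> (\<rho> / \<rho>') ^ j / d < \<theta>0" by (auto simp: eventually_sequentially)
  have "m \<le> 2 * (K * m) + 2" using K by (cases K) auto
  from mm[OF this] have \<theta>: "(\<rho> / \<rho>') ^ (2 * (K * m) + 2) / d \<le> \<theta>0" by simp
  define \<omega> where "\<omega> = cis (2 * pi / real K)"
  have w: "cmod (\<omega> ^ k) = 1" for k by (simp add: \<omega>_def norm_power)
  have wK: "\<omega> ^ K = 1" unfolding \<omega>_def Complex.DeMoivre using K by simp
  define Out where "Out = {z. \<eta> < cmod (sgn z - \<zeta>)}"
  define b where "b = poly (bump \<zeta> L)"
  have b_eq: "cmod (b z) = (cmod (1 + cnj \<zeta> * z) / 2) ^ L" for z
    by (simp add: b_def poly_bump norm_power norm_divide)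
  have zsplit: "cnj \<zeta> * z = of_real (cmod z) * (cnj \<zeta> * sgn z)" for z :: complex
    by (simp add: sgn_eq)
  have x_dist: "cmod (cnj \<zeta> * v - 1) = cmod (v - \<zeta>)" for v
  proof -
    have "cnj \<zeta> * (v - \<zeta>) = cnj \<zeta> * v - 1"
      using complex_norm_square[of \<zeta>] \<zeta> by (simp add: algebra_simps)
    then have "cmod (cnj \<zeta> * v - 1) = cmod (cnj \<zeta>) * cmod (v - \<zeta>)" by (metis norm_mult)
    then show ?thesis using \<zeta> by simp
  qed
  have b_le1: "cmod (b z) \<le> 1" if "z \<in> ball 0 1" for z
  proof -
    have "cmod (1 + cnj \<zeta> * z) \<le> 1 + cmod z"
      using norm_triangle_ineq[of 1 "cnj \<zeta> * z"] \<zeta> by (simp add: norm_mult)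
    then show ?thesis unfolding b_eq using that by (intro power_le_one) auto
  qed
  have near: "\<bar>cmod (1 + cnj \<zeta> * z) - cmod (1 + cnj \<zeta> * sgn z)\<bar> \<le> \<kappa>" if "z \<in> ball 0 1" "z \<notin> cball 0 \<rho>" for z
  proof -
    have z0: "z \<noteq> 0" using that rho by auto
    have "(1 + cnj \<zeta> * z) - (1 + cnj \<zeta> * sgn z) = of_real (cmod z - 1) * (cnj \<zeta> * sgn z)"
      by (subst zsplit) (simp add: algebra_simps)
    then have "cmod ((1 + cnj \<zeta> * z) - (1 + cnj \<zeta> * sgn z)) = \<bar>cmod z - 1\<bar>"
      using \<zeta> z0 by (simp only: norm_mult norm_of_real complex_mod_cnj) (simp add: norm_sgn)
    then have "\<bar>cmod (1 + cnj \<zeta> * z) - cmod (1 + cnj \<zeta> * sgn z)\<bar> \<le> \<bar>cmod z - 1\<bar>"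
      using norm_triangle_ineq3[of "1 + cnj \<zeta> * z" "1 + cnj \<zeta> * sgn z"] by simp
    then show ?thesis using that by (simp add: \<rho>_def)
  qed
  have unit: "cmod (cnj \<zeta> * sgn z) = 1" if "z \<notin> cball 0 \<rho>" for z :: complex
    using that rho \<zeta> by (auto simp: norm_mult norm_sgn)
  have b_out: "(cmod (b z))\<^sup>2 \<le> \<beta>2" if "z \<in> ball 0 1" "z \<notin> cball 0 \<rho>" "z \<in> Out" for z
  proof -
    have "(cmod (1 + cnj \<zeta> * sgn z))\<^sup>2 = 4 - (cmod (sgn z - \<zeta>))\<^sup>2"
      using cmod_1_plus_squared[OF unit[OF that(2)]] by (simp only: x_dist)
    also have "\<dots> \<le> 4 - \<eta>\<^sup>2" using that(3) \<eta> by (auto simp: Out_def intro!: power_mono)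
    finally have "cmod (1 + cnj \<zeta> * sgn z) \<le> s2" unfolding s2_def by (rule real_le_rsqrt)
    then have "cmod (1 + cnj \<zeta> * z) / 2 \<le> B2" using near[OF that(1,2)] by (simp add: B2_def)
    then show ?thesis unfolding b_eq \<beta>2_def by (intro power_mono) auto
  qed
  have b_in: "\<exists>k<K. \<beta>1 \<le> (cmod (b (\<omega> ^ k * z)))\<^sup>2" if z: "z \<in> ball 0 1" "z \<notin> cball 0 \<rho>" for z
  proof -
    obtain k where k: "k < K" "cmod (\<omega> ^ k * (cnj \<zeta> * sgn z) - 1) \<le> \<eta> / 2"
      using rotation_near_1[OF unit[OF z(2)] K(1)] K(2) order_trans unfolding \<omega>_def by blast
    define y where "y = \<omega> ^ k * z"
    have y: "y \<in> ball 0 1" "y \<notin> cball 0 \<rho>" using z w[of k] by (auto simp: y_def norm_mult)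
    have sy: "cnj \<zeta> * sgn y = \<omega> ^ k * (cnj \<zeta> * sgn z)"
      using w[of k] by (simp add: y_def sgn_mult sgn_eq[of "\<omega> ^ k"])
    have "4 - (\<eta> / 2)\<^sup>2 \<le> 4 - (cmod (cnj \<zeta> * sgn y - 1))\<^sup>2"
      unfolding sy using k(2) by (intro diff_mono power_mono) auto
    also have "\<dots> = (cmod (1 + cnj \<zeta> * sgn y))\<^sup>2"
      by (rule cmod_1_plus_squared[OF unit[OF y(2)], symmetric])
    finally have "s1 \<le> cmod (1 + cnj \<zeta> * sgn y)" unfolding s1_def by (rule real_le_lsqrt[rotated]) auto
    then have "B1 \<le> cmod (1 + cnj \<zeta> * y) / 2" using near[OF y] by (simp add: B1_def)
    then have "\<beta>1 \<le> (cmod (b y))\<^sup>2" unfolding b_eq \<beta>1_def using B by (intro power_mono) auto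
    then show ?thesis using k(1) by (auto simp: y_def)
  qed
  have "(LINT z|dA. indicator Out z * (\<Phi> z * (cmod (poly (bump \<zeta> L * gap_poly K m n c) z))\<^sup>2)) \<le>
      \<epsilon> * (LINT z|dA. \<Phi> z * (cmod (poly (bump \<zeta> L * gap_poly K m n c) z))\<^sup>2)" for n c
  proof -
    define q where "q = poly (gap_poly K m n c)"
    define W where "W = (\<lambda>z. \<Phi> z * (cmod (q z))\<^sup>2)"
    define D where "D = (\<lambda>z::complex. indicator (cball 0 \<rho>) z :: real)"
    have f_eq: "\<Phi> z * (cmod (poly (bump \<zeta> L * gap_poly K m n c) z))\<^sup>2 = (cmod (b z))\<^sup>2 * W z" for z
      by (simp add: b_def W_def q_def norm_mult power_mult_distrib)
    have qb: "q \<in> bergman" unfolding q_def by (rule poly_fun_bergman)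
    note qi = sq_integrableD(2)[OF bergman_sq_integrable[OF qb]]
    have Wi: "integrable dA W"
      unfolding W_def by (rule integrable_bounded_mult[OF qi m, of 1]) (use \<Phi>01 in auto)
    have W0: "0 \<le> W z" if "z \<in> ball 0 1" for z using \<Phi>01[OF that] by (simp add: W_def)
    have Om: "Out \<in> sets borel"
      unfolding Out_def sgn_div_norm by measurable
    have Omf: "(indicator Out :: complex \<Rightarrow> real) \<in> borel_measurable dA"
      by (intro measurable_dA_borel borel_measurable_indicator Om)
    have Dm: "D \<in> borel_measurable dA" unfolding D_def by (rule indicator_cball_measurable)
    have bm: "b \<in> borel_measurable dA" unfolding b_def
      by (intro sq_integrableD bergman_sq_integrable poly_fun_bergman)
    have b2m: "(\<lambda>z. (cmod (b z))\<^sup>2) \<in> borel_measurable dA" using bm by measurable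
    have b2le: "\<bar>(cmod (b z))\<^sup>2\<bar> \<le> 1" if "z \<in> ball 0 1" for z
      using b_le1[OF that] by (simp add: power_le_one)
    have bWi: "integrable dA (\<lambda>z. (cmod (b z))\<^sup>2 * W z)"
      by (rule integrable_bounded_mult[OF Wi b2m b2le])
    have DWi: "integrable dA (\<lambda>z. D z * W z)"
      by (rule integrable_bounded_mult[OF Wi Dm, of 1]) (auto simp: D_def indicator_def)
    have D'Wi: "integrable dA (\<lambda>z. (1 - D z) * W z)"
      using Bochner_Integration.integrable_diff[OF Wi DWi] by (simp add: left_diff_distrib)
    have ObWi: "integrable dA (\<lambda>z. indicator Out z * ((cmod (b z))\<^sup>2 * W z))"
      by (rule integrable_bounded_mult[OF bWi Omf, of 1]) (auto simp: indicator_def)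
    define X Y J where "X = (LINT z|dA. D z * W z)" and "Y = (LINT z|dA. (1 - D z) * W z)"
      and "J = (LINT z|dA. (cmod (b z))\<^sup>2 * W z)"
    have Y0: "0 \<le> Y" unfolding Y_def using W0
      by (intro Bochner_Integration.integral_nonneg mult_nonneg_nonneg) (auto simp: D_def indicator_def)
    have XY: "X + Y = (LINT z|dA. W z)"
      unfolding X_def Y_def by (subst Bochner_Integration.integral_add[OF DWi D'Wi, symmetric]) (simp add: algebra_simps)
    \<comment> \<open>Inside radius \<rho> only |b| \<le> 1 is available; in the annulus |b|^2 is at
      most \<beta>2 on \<open>Out\<close>.\<close>
    have out_le: "(LINT z|dA. indicator Out z * ((cmod (b z))\<^sup>2 * W z)) \<le> X + \<beta>2 * Y"
    proof -
      have "(LINT z|dA. indicator Out z * ((cmod (b z))\<^sup>2 * W z)) \<le> (LINT z|dA. D z * W z + \<beta>2 * ((1 - D z) * W z))"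
      proof (rule integral_mono[OF ObWi])
        show "integrable dA (\<lambda>z. D z * W z + \<beta>2 * ((1 - D z) * W z))"
          by (intro Bochner_Integration.integrable_add integrable_mult_right DWi D'Wi)
        fix z assume "z \<in> space dA"
        then have z: "z \<in> ball 0 1" by simp
        show "indicator Out z * ((cmod (b z))\<^sup>2 * W z) \<le> D z * W z + \<beta>2 * ((1 - D z) * W z)"
        proof (cases "z \<in> cball 0 \<rho>")
          case True
          have "(cmod (b z))\<^sup>2 * W z \<le> 1 * W z"
            using b2le[OF z] W0[OF z] by (intro mult_right_mono) auto
          then show ?thesis using True W0[OF z] by (auto simp: D_def indicator_def)
        next
          case False
          show ?thesis
          proof (cases "z \<in> Out")
            case True
            then show ?thesis using False b_out[OF z False True] W0[OF z] by (auto simp: D_def intro!: mult_right_mono)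
          next
            case F: False
            then show ?thesis using False W0[OF z] by (simp add: D_def \<beta>2_def)
          qed
        qed
      qed
      also have "\<dots> = X + \<beta>2 * Y"
        unfolding X_def Y_def using DWi D'Wi by (subst Bochner_Integration.integral_add) auto
      finally show ?thesis .
    qed
    \<comment> \<open>W is invariant under the rotations, so each of the K rotated bumps gives the
      same integral J; outside radius \<rho> the sum of their squared moduli is at least
      \<beta>1.\<close>
    have Jlow: "\<beta>1 * Y \<le> real K * J"
    proof -
      have Wrot: "W (\<omega> ^ k * z) = W z" for k z
      proof -
        have "(\<omega> ^ k) ^ K = 1" using wK by (metis power_mult mult.commute power_one)
        then show ?thesis unfolding W_def q_def by (simp only: rad[OF w] gap_poly_rotate)
      qed
      have Jk: "integrable dA (\<lambda>z. (cmod (b (\<omega> ^ k * z)))\<^sup>2 * W z)"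
        "(LINT z|dA. (cmod (b (\<omega> ^ k * z)))\<^sup>2 * W z) = J" for k
        using integrable_dA_rotation[OF w bWi, of k] LINT_dA_rotation[OF w borel_measurable_integrable[OF bWi], of k]
        by (simp_all add: Wrot J_def)
      have "\<beta>1 * Y = (LINT z|dA. \<beta>1 * ((1 - D z) * W z))" unfolding Y_def by simp
      also have "\<dots> \<le> (LINT z|dA. (\<Sum>k<K. (cmod (b (\<omega> ^ k * z)))\<^sup>2 * W z))"
      proof (rule integral_mono)
        show "integrable dA (\<lambda>z. \<beta>1 * ((1 - D z) * W z))" by (intro integrable_mult_right D'Wi)
        show "integrable dA (\<lambda>z. \<Sum>k<K. (cmod (b (\<omega> ^ k * z)))\<^sup>2 * W z)"
          by (intro Bochner_Integration.integrable_sum Jk)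
        fix z assume "z \<in> space dA"
        then have z: "z \<in> ball 0 1" by simp
        have nn: "0 \<le> (cmod (b (\<omega> ^ k * z)))\<^sup>2 * W z" for k using W0[OF z] by simp
        show "\<beta>1 * ((1 - D z) * W z) \<le> (\<Sum>k<K. (cmod (b (\<omega> ^ k * z)))\<^sup>2 * W z)"
        proof (cases "z \<in> cball 0 \<rho>")
          case True
          then show ?thesis using nn by (simp add: D_def sum_nonneg)
        next
          case False
          obtain k where k: "k < K" "\<beta>1 \<le> (cmod (b (\<omega> ^ k * z)))\<^sup>2" using b_in[OF z False] by blast
          have "\<beta>1 * ((1 - D z) * W z) = \<beta>1 * W z" using False by (simp add: D_def)
          also have "\<dots> \<le> (cmod (b (\<omega> ^ k * z)))\<^sup>2 * W z" using k W0[OF z] by (intro mult_right_mono) auto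
          also have "\<dots> \<le> (\<Sum>k<K. (cmod (b (\<omega> ^ k * z)))\<^sup>2 * W z)"
            by (rule member_le_sum) (use k nn in auto)
          finally show ?thesis .
        qed
      qed
      also have "\<dots> = (\<Sum>k<K. J)"
        by (subst Bochner_Integration.integral_sum) (use Jk in auto)
      finally show ?thesis by simp
    qed
    \<comment> \<open>Since q vanishes to order K * m at 0, its mass in radius \<rho> is a small
      part of that in radius \<rho>', which the \<Phi>-weighted mass controls up to the factor 1 /
      d.\<close>
    have Xle: "X \<le> \<theta>0 * (X + Y)"
    proof -
      have "X \<le> msq \<rho> q"
        unfolding X_def msq_def W_def D_def
      proof (rule integral_mono)
        show "integrable dA (\<lambda>z. indicator (cball 0 \<rho>) z * (\<Phi> z * (cmod (q z))\<^sup>2))"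
          using DWi by (simp add: D_def W_def)
        show "integrable dA (\<lambda>z. indicator (cball 0 \<rho>) z * (cmod (q z))\<^sup>2)"
          by (rule integrable_indicator_cball[OF qi])
        fix z assume "z \<in> space dA"
        then show "indicator (cball 0 \<rho>) z * (\<Phi> z * (cmod (q z))\<^sup>2) \<le> indicator (cball 0 \<rho>) z * (cmod (q z))\<^sup>2"
          using \<Phi>01[of z] by (intro mult_left_mono mult_left_le_one_le) auto
      qed
      also have "\<dots> \<le> (\<rho> / \<rho>') ^ (2 * (K * m) + 2) * msq \<rho>' q"
        using rho rho' K by (intro msq_le_of_vanishing bergman_holomorphic qb)
          (auto simp: q_def tcoeff_poly coeff_gap_poly)
      also have "(\<rho> / \<rho>') ^ (2 * (K * m) + 2) * msq \<rho>' q \<le> (\<rho> / \<rho>') ^ (2 * (K * m) + 2) * ((X + Y) / d)"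
      proof (rule mult_left_mono)
        have "msq \<rho>' q \<le> (LINT z|dA. W z / d)"
          unfolding msq_def
        proof (rule integral_mono)
          show "integrable dA (\<lambda>z. indicator (cball 0 \<rho>') z * (cmod (q z))\<^sup>2)"
            by (rule integrable_indicator_cball[OF qi])
          show "integrable dA (\<lambda>z. W z / d)" using Wi by simp
          fix z assume "z \<in> space dA"
          then have z: "z \<in> ball 0 1" by simp
          show "indicator (cball 0 \<rho>') z * (cmod (q z))\<^sup>2 \<le> W z / d"
          proof (cases "z \<in> cball 0 \<rho>'")
            case True
            then have "d * (cmod (q z))\<^sup>2 \<le> W z" unfolding W_def using d by (intro mult_right_mono) auto
            then show ?thesis using True d by (simp add: field_simps)
          next
            case False
            then show ?thesis using W0[OF z] d by simp
          qed
        qed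
        then show "msq \<rho>' q \<le> (X + Y) / d" unfolding XY by simp
        show "0 \<le> (\<rho> / \<rho>') ^ (2 * (K * m) + 2)" using rho rho' by simp
      qed
      also have "\<dots> = (\<rho> / \<rho>') ^ (2 * (K * m) + 2) / d * (X + Y)" by simp
      also have "\<dots> \<le> \<theta>0 * (X + Y)"
      proof (rule mult_right_mono[OF \<theta>])
        show "0 \<le> X + Y" unfolding XY using W0 by (intro Bochner_Integration.integral_nonneg) auto
      qed
      finally show ?thesis .
    qed
    have "X \<le> \<epsilon>' * \<beta>1 * Y"
    proof -
      have X0: "0 \<le> X" unfolding X_def using W0
        by (intro Bochner_Integration.integral_nonneg mult_nonneg_nonneg) (auto simp: D_def)
      have "\<theta>0 * X \<le> 1/2 * X" "\<theta>0 * Y \<le> \<epsilon>' * \<beta>1 / 2 * Y"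
        unfolding \<theta>0_def using X0 Y0 by (intro mult_right_mono; simp)+
      then show ?thesis using Xle by (simp add: distrib_left)
    qed
    then have "X + \<beta>2 * Y \<le> 2 * \<epsilon>' * (\<beta>1 * Y)"
      using mult_right_mono[OF b2 Y0] by (simp add: algebra_simps)
    also have "\<dots> \<le> 2 * \<epsilon>' * (real K * J)" using Jlow eps' by (intro mult_left_mono) auto
    also have "\<dots> = \<epsilon> * J" using K by (simp add: \<epsilon>'_def)
    finally show ?thesis unfolding f_eq J_def using out_le by linarith
  qed
  then show ?thesis using K(1) unfolding Out_def Let_def by blast
qed

section \<open>Logarithmically decaying symbols\<close>

lemma phi0_base_ge_1:
  fixes r :: real
  assumes "0 \<le> r" "r < 1"
  shows "1 \<le> 1 + ln (1 / (1 - r))"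
proof -
  have "1 \<le> 1 / (1 - r)" using assms by (subst le_divide_eq_1_pos) auto
  from ln_ge_zero[OF this] show ?thesis by linarith
qed

lemma phi0_pos:
  assumes "0 \<le> r" "r < 1"
  shows "0 < phi0 \<gamma> r"
proof -
  have "1 + ln (1 / (1 - r)) \<noteq> 0" using phi0_base_ge_1[OF assms] by linarith
  then show ?thesis by (simp add: phi0_def)
qed

lemma phi0_antimono:
  assumes "0 \<le> \<gamma>" "0 \<le> r" "r \<le> s" "s < 1"
  shows "phi0 \<gamma> s \<le> phi0 \<gamma> r"
proof -
  have "1 + ln (1 / (1 - r)) \<le> 1 + ln (1 / (1 - s))"
    using assms by (simp add: frac_le)
  moreover have b: "1 \<le> 1 + ln (1 / (1 - r))" using assms by (intro phi0_base_ge_1) auto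
  ultimately have "(1 + ln (1 / (1 - r))) powr \<gamma> \<le> (1 + ln (1 / (1 - s))) powr \<gamma>"
    using assms(1) by (intro powr_mono2) linarith+
  moreover have "0 < (1 + ln (1 / (1 - r))) powr \<gamma>" unfolding powr_gt_zero using b by linarith
  ultimately show ?thesis
    unfolding phi0_def by (intro divide_left_mono mult_pos_pos) auto
qed

lemma phi0_0: "phi0 \<gamma> 0 = 1"
  by (simp add: phi0_def)

lemma phi0_le_1: "0 \<le> \<gamma> \<Longrightarrow> 0 \<le> r \<Longrightarrow> r < 1 \<Longrightarrow> phi0 \<gamma> r \<le> 1"
  using phi0_antimono[of \<gamma> 0 r] by (simp add: phi0_0)

lemma phi0_tendsto_0:
  assumes "0 < \<gamma>" shows "(phi0 \<gamma> \<longlongrightarrow> 0) (at_left 1)"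
  unfolding phi0_def using assms by real_asymp

section \<open>Singular values for the logarithmic symbol\<close>

locale log_symbol =
  fixes \<gamma> :: real and \<phi>1 :: "complex \<Rightarrow> complex"
  assumes gamma: "0 < \<gamma>" and cont: "continuous_on (sphere 0 1) \<phi>1"
begin

definition M :: real where "M = (SUP z\<in>sphere 0 1. cmod (\<phi>1 z))"

lemma bdd_symbol: "bdd_above ((\<lambda>z. cmod (\<phi>1 z)) ` sphere 0 1)"
  by (intro bounded_imp_bdd_above compact_imp_bounded compact_continuous_image continuous_on_norm cont) simp

lemma symbol_le_M: "z \<in> sphere 0 1 \<Longrightarrow> cmod (\<phi>1 z) \<le> M"
  unfolding M_def by (rule cSUP_upper[OF _ bdd_symbol])

lemma M_attained: "\<exists>\<zeta>\<in>sphere 0 1. cmod (\<phi>1 \<zeta>) = M"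
proof -
  have "sphere (0::complex) 1 \<noteq> {}" by simp
  from continuous_attains_sup[OF compact_sphere this continuous_on_norm[OF cont]]
  obtain \<zeta> where z: "\<zeta> \<in> sphere 0 1" "\<And>w. w \<in> sphere 0 1 \<Longrightarrow> cmod (\<phi>1 w) \<le> cmod (\<phi>1 \<zeta>)"
    by blast
  have "M \<le> cmod (\<phi>1 \<zeta>)" unfolding M_def using z by (intro cSUP_least) auto
  then show ?thesis using z symbol_le_M by (intro bexI[of _ \<zeta>]) (auto intro: antisym)
qed

lemma M_nonneg: "0 \<le> M"
  using M_attained norm_ge_zero by metis

text \<open>\<^term>\<open>symb \<gamma> \<phi>1 0\<close> involves the value of \<^term>\<open>\<phi>1\<close> off the circle; it is replaced by \<open>0\<close>.\<close>

definition \<phi> :: "complex \<Rightarrow> complex" where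
  "\<phi> z = (if z = 0 then 0 else symb \<gamma> \<phi>1 z)"

lemma sgn_sphere: "z \<noteq> 0 \<Longrightarrow> sgn z \<in> sphere (0::complex) 1"
  by (simp add: norm_sgn)

lemma phi0_measurable: "(\<lambda>z. phi0 \<gamma> (cmod z)) \<in> borel_measurable dA"
  unfolding phi0_def by (intro measurable_dA_borel) measurable

lemma symbol_measurable: "\<phi> \<in> borel_measurable dA"
proof -
  have "continuous_on (- {0}) (\<lambda>z. \<phi>1 (sgn z))"
    by (rule continuous_on_compose2[OF cont]) (auto intro!: continuous_intros sgn_sphere simp: norm_sgn)
  then have "(\<lambda>z. indicator (- {0}) z *\<^sub>R \<phi>1 (sgn z)) \<in> borel_measurable borel"
    by (intro borel_measurable_continuous_on_indicator) auto
  then have "(\<lambda>z. indicator (- {0}) z *\<^sub>R \<phi>1 (sgn z)) \<in> borel_measurable dA" by (rule measurable_dA_borel)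
  then have "(\<lambda>z. (indicator (- {0}) z *\<^sub>R \<phi>1 (sgn z)) * complex_of_real (phi0 \<gamma> (cmod z))) \<in> borel_measurable dA"
    using phi0_measurable by measurable
  also have "(\<lambda>z. (indicator (- {0}) z *\<^sub>R \<phi>1 (sgn z)) * complex_of_real (phi0 \<gamma> (cmod z))) = \<phi>"
    by (auto simp: \<phi>_def symb_def indicator_def fun_eq_iff)
  finally show ?thesis .
qed

text \<open>One estimate for two purposes: r = 0 gives the global bound M, and r close to 1 gives
  the decay at the boundary.\<close>

lemma cmod_symbol_le:
  assumes "z \<in> ball 0 1" "r \<le> cmod z" "0 \<le> r"
  shows "cmod (\<phi> z) \<le> M * phi0 \<gamma> r"
proof (cases "z = 0")
  case True
  then show ?thesis using M_nonneg assms by (simp add: \<phi>_def phi0_0)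
next
  case False
  have "cmod (\<phi> z) = cmod (\<phi>1 (sgn z)) * phi0 \<gamma> (cmod z)"
    using False phi0_pos[of "cmod z" \<gamma>] assms by (simp add: \<phi>_def symb_def norm_mult)
  also have "\<dots> \<le> M * phi0 \<gamma> r"
    using assms gamma M_nonneg phi0_pos[of "cmod z" \<gamma>]
    by (intro mult_mono symbol_le_M sgn_sphere False phi0_antimono) auto
  finally show ?thesis .
qed

sublocale vanishing_symbol \<phi> M
proof
  show "\<phi> \<in> borel_measurable dA" by (rule symbol_measurable)
  show "cmod (\<phi> z) \<le> M" if "z \<in> ball 0 1" for z
    using cmod_symbol_le[OF that, of 0] by (simp add: phi0_0)
  fix \<eta> :: real assume e: "0 < \<eta>"
  have "((\<lambda>r. M * phi0 \<gamma> r) \<longlongrightarrow> M * 0) (at_left 1)"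
    by (intro tendsto_mult tendsto_const phi0_tendsto_0 gamma)
  then have "\<forall>\<^sub>F r in at_left 1. M * phi0 \<gamma> r < \<eta>" by (rule order_tendstoD(2)) (use e in simp)
  then have "\<forall>\<^sub>F r in at_left 1. M * phi0 \<gamma> r < \<eta> \<and> r \<in> {0<..<1}"
    by (intro eventually_conj eventually_at_left_real) auto
  then obtain \<rho> where r: "M * phi0 \<gamma> \<rho> < \<eta>" "0 < \<rho>" "\<rho> < 1"
    using eventually_happens[of _ "at_left (1::real)"] by fastforce
  have "cmod (\<phi> z) \<le> \<eta>" if "\<rho> < cmod z" "cmod z < 1" for z
    using cmod_symbol_le[of z \<rho>] that r by simp
  then show "\<exists>\<rho>. 0 < \<rho> \<and> \<rho> < 1 \<and> (\<forall>z. \<rho> < cmod z \<longrightarrow> cmod z < 1 \<longrightarrow> cmod (\<phi> z) \<le> \<eta>)"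
    using r by blast
qed

lemma toeplitz_symb: "toeplitz (symb \<gamma> \<phi>1) = toeplitz \<phi>"
proof (intro ext)
  fix f z
  have "(LINT w:ball 0 1|lborel. symb \<gamma> \<phi>1 w * f w / (1 - z * cnj w)\<^sup>2) = (LINT w:ball 0 1|lborel. \<phi> w * f w / (1 - z * cnj w)\<^sup>2)"
    unfolding set_lebesgue_integral_def
    by (rule integral_discrete_difference[of "{0}"]) (auto simp: \<phi>_def)
  then show "toeplitz (symb \<gamma> \<phi>1) f z = toeplitz \<phi> f z"
    by (simp add: toeplitz_def dA_int_def)
qed

lemma sing_val_upper:
  assumes n: "1 \<le> n" and r: "0 \<le> \<rho>" "\<rho> < 1"
  shows "sing_val (toeplitz \<phi>) n \<le> M * sqrt ((phi0 \<gamma> \<rho>)\<^sup>2 + \<rho> ^ (2 * n))"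
proof -
  have "sing_val (toeplitz \<phi>) n \<le> sqrt (M\<^sup>2 * ((phi0 \<gamma> \<rho>)\<^sup>2 + \<rho> ^ (2 * n)))"
  proof (rule sing_val_le[OF n])
    show "0 \<le> M\<^sup>2 * ((phi0 \<gamma> \<rho>)\<^sup>2 + \<rho> ^ (2 * n))" using r by simp
    fix f assume f: "f \<in> bergman" and v: "\<And>k. k < n - 1 \<Longrightarrow> tcoeff f k = 0"
    have "L2.nsq (toeplitz \<phi> f) \<le> L2.nsq (\<lambda>z. \<phi> z * f z)" by (rule nsq_toeplitz_le[OF f])
    also have "\<dots> \<le> M\<^sup>2 * msq \<rho> f + (M * phi0 \<gamma> \<rho>)\<^sup>2 * L2.nsq f"
      by (rule nsq_mult_le[OF bergman_sq_integrable[OF f]]) (use r in \<open>auto intro!: cmod_symbol_le\<close>)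
    also have "\<dots> \<le> M\<^sup>2 * (\<rho> ^ (2 * (n - 1) + 2) * L2.nsq f) + (M * phi0 \<gamma> \<rho>)\<^sup>2 * L2.nsq f"
      by (intro add_right_mono mult_left_mono msq_le_nsq_of_vanishing[OF f v r]) auto
    \<comment> \<open>Vanishing order n - 1 together with the shift by 2 from the area integral
      gives exactly the exponent 2n.\<close>
    also have "2 * (n - 1) + 2 = 2 * n" using n by simp
    finally show "L2.nsq (toeplitz \<phi> f) \<le> M\<^sup>2 * ((phi0 \<gamma> \<rho>)\<^sup>2 + \<rho> ^ (2 * n)) * L2.nsq f"
      by (simp add: algebra_simps power_mult_distrib)
  qed
  also have "\<dots> = M * sqrt ((phi0 \<gamma> \<rho>)\<^sup>2 + \<rho> ^ (2 * n))"
    using M_nonneg by (simp add: real_sqrt_mult)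
  finally show ?thesis .
qed

text \<open>C depends on \<epsilon> and the symbol but not on n or \<rho>: the bump, K and m are
  fixed first, so the n-dimensional test space has degree at most a constant times n.\<close>

lemma sing_val_lower:
  assumes \<epsilon>: "0 < \<epsilon>" "\<epsilon> < 1" and M: "0 < M"
  shows "\<exists>C. \<forall>n\<ge>1. \<forall>\<rho>. 0 \<le> \<rho> \<longrightarrow> \<rho> < 1 \<longrightarrow>
    (1 - \<epsilon>) * M * phi0 \<gamma> \<rho> * \<rho> ^ (C * n) \<le> sing_val (toeplitz \<phi>) n"
proof -
  obtain \<zeta> where z: "cmod \<zeta> = 1" "cmod (\<phi>1 \<zeta>) = M" using M_attained by auto
  \<comment> \<open>A unimodular factor that turns \<phi>1(\<zeta>) into M, so that real parts can
    be estimated.\<close>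
  define u where "u = cnj (\<phi>1 \<zeta>) / of_real M"
  have u1: "cmod u = 1" using z M by (simp add: u_def norm_divide)
  have uz: "u * \<phi>1 \<zeta> = of_real M"
  proof -
    have "cnj (\<phi>1 \<zeta>) * \<phi>1 \<zeta> = of_real M * of_real M"
      using complex_norm_square[of "\<phi>1 \<zeta>"] z(2) by (simp add: power2_eq_square mult.commute)
    then show ?thesis using M by (simp add: u_def)
  qed
  \<comment> \<open>The oscillation of \<phi>1 near \<zeta> loses M e and the mass off the arc loses
    2 M e; together this is M \<epsilon>.\<close>
  define e where "e = \<epsilon> / 3"
  have e: "0 < e" using \<epsilon> by (simp add: e_def)
  have "0 < M * e" using M e by simp
  then obtain \<eta>0 where eta0: "0 < \<eta>0" "\<And>w. w \<in> sphere 0 1 \<Longrightarrow> dist w \<zeta> < \<eta>0 \<Longrightarrow> dist (\<phi>1 w) (\<phi>1 \<zeta>) < M * e"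
    using cont z(1) unfolding continuous_on_iff by (metis mem_sphere_0)
  define \<eta> where "\<eta> = min 1 (\<eta>0 / 2)"
  have eta: "0 < \<eta>" "\<eta> \<le> 1" "\<eta> < \<eta>0" using eta0 by (auto simp: \<eta>_def)
  define Out where "Out = {z. \<eta> < cmod (sgn z - \<zeta>)}"
  define \<Phi> where "\<Phi> = (\<lambda>z::complex. phi0 \<gamma> (cmod z))"
  have Phi01: "0 \<le> \<Phi> z \<and> \<Phi> z \<le> 1" if "z \<in> ball 0 1" for z
    using that phi0_pos[of "cmod z" \<gamma>] phi0_le_1[of \<gamma> "cmod z"] gamma by (simp add: \<Phi>_def)
  have Phim: "\<Phi> \<in> borel_measurable dA" unfolding \<Phi>_def by (rule phi0_measurable)
  have Re_in: "Re (u * \<phi>1 w) \<ge> M * (1 - e)" if "w \<in> sphere 0 1" "cmod (w - \<zeta>) \<le> \<eta>" for w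
  proof -
    have "cmod (\<phi>1 w - \<phi>1 \<zeta>) < M * e" using eta0(2)[of w] that eta by (simp add: dist_norm)
    then have "cmod (u * (\<phi>1 w - \<phi>1 \<zeta>)) < M * e" using u1 by (simp add: norm_mult)
    then have "- (M * e) < Re (u * (\<phi>1 w - \<phi>1 \<zeta>))"
      using abs_Re_le_cmod[of "u * (\<phi>1 w - \<phi>1 \<zeta>)"] by linarith
    also have "u * (\<phi>1 w - \<phi>1 \<zeta>) = u * \<phi>1 w - of_real M" by (simp only: right_diff_distrib uz)
    finally show ?thesis by (simp add: algebra_simps)
  qed
  have Re_all: "Re (u * \<phi>1 w) \<ge> - M" if "w \<in> sphere 0 1" for w
    using abs_Re_le_cmod[of "u * \<phi>1 w"] symbol_le_M[OF that] u1 by (simp add: norm_mult)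
  obtain K L m where K: "0 < K" and conc: "\<And>n c. let f = poly (bump \<zeta> L * gap_poly K m n c) in
    (LINT z|dA. indicator Out z * (\<Phi> z * (cmod (f z))\<^sup>2)) \<le> e * (LINT z|dA. \<Phi> z * (cmod (f z))\<^sup>2)"
  proof -
    have "\<exists>K L m. 0 < K \<and> (\<forall>n c. let f = poly (bump \<zeta> L * gap_poly K m n c) in
      (LINT z|dA. indicator Out z * (\<Phi> z * (cmod (f z))\<^sup>2)) \<le> e * (LINT z|dA. \<Phi> z * (cmod (f z))\<^sup>2))"
      unfolding Out_def
    proof (rule mass_concentration[OF Phim Phi01 _ _ z(1) eta(1,2) e])
      show "\<Phi> (\<omega> * z) = \<Phi> z" if "cmod \<omega> = 1" for \<omega> z using that by (simp add: \<Phi>_def norm_mult)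
      show "\<exists>d>0. \<forall>z\<in>cball 0 \<rho>. d \<le> \<Phi> z" if "0 < \<rho>" "\<rho> < 1" for \<rho>
        using that gamma by (intro exI[of _ "phi0 \<gamma> \<rho>"]) (auto simp: \<Phi>_def intro!: phi0_pos phi0_antimono)
    qed
    then show ?thesis using that by blast
  qed
  \<comment> \<open>Twice a bound for (degree + 1) / n, where n \<ge> 1 absorbs the constants L, K m
    and 1.\<close>
  define C where "C = 2 * (L + K + K * m + 1)"
  have "(1 - \<epsilon>) * M * phi0 \<gamma> \<rho> * \<rho> ^ (C * n) \<le> sing_val (toeplitz \<phi>) n" if n: "1 \<le> n" and r: "0 \<le> \<rho>" "\<rho> < 1" for n \<rho>
  proof -
    define \<tau> where "\<tau> = (1 - \<epsilon>) * M * phi0 \<gamma> \<rho> * \<rho> ^ (C * n)"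
    have tau0: "0 \<le> \<tau>" using \<epsilon> M r phi0_pos[OF r, of \<gamma>] by (simp add: \<tau>_def)
    define v where "v = (\<lambda>j z. poly (bump \<zeta> L) z * z ^ (K * (j + m)))"
    have lin: "(\<lambda>z. \<Sum>j<n. c j * v j z) = poly (bump \<zeta> L * gap_poly K m n c)" for c
      by (auto simp: v_def poly_gap_poly sum_distrib_left fun_eq_iff intro!: sum.cong)
    have "sqrt (\<tau>\<^sup>2) \<le> sing_val (toeplitz \<phi>) n"
    proof (rule sing_val_ge[OF n, where v = v], goal_cases)
      case 1
      show ?case by simp
    next
      case (2 i)
      have "v i = poly (bump \<zeta> L * monom 1 (K * (i + m)))" by (auto simp: v_def poly_monom fun_eq_iff)
      then show ?case using poly_fun_bergman by simp
    next
      case (3 c)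
      then obtain i where i: "i < n" "c i \<noteq> 0" by blast
      then have "gap_poly K m n c \<noteq> 0" using coeff_gap_poly(1)[OF K i(1), of m c] by auto
      then show ?case unfolding lin by (intro nsq_poly_pos) (simp add: bump_nonzero)
    next
      case (4 c)
      define p where "p = bump \<zeta> L * gap_poly K m n c"
      define f where "f = poly p"
      define N where "N = L + K * (n + m) + 1"
      have fb: "f \<in> bergman" unfolding f_def by (rule poly_fun_bergman)
      note fi = sq_integrableD(2)[OF bergman_sq_integrable[OF fb]]
      have fN: "f = (\<lambda>z. \<Sum>i<N. coeff p i * z ^ i)"
        unfolding f_def N_def using degree_bump_gap_poly[of \<zeta> L K m n c]
        by (intro ext poly_eq_sum_lessThan) (simp add: p_def)
      define J where "J = (LINT z|dA. \<Phi> z * (cmod (f z))\<^sup>2)"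
      have Ji: "integrable dA (\<lambda>z. \<Phi> z * (cmod (f z))\<^sup>2)"
        by (rule integrable_bounded_mult[OF fi Phim, of 1]) (use Phi01 in auto)
      have Om: "Out \<in> sets borel" unfolding Out_def sgn_div_norm by measurable
      have Oi: "integrable dA (\<lambda>z. indicator Out z * (\<Phi> z * (cmod (f z))\<^sup>2))"
        by (rule integrable_bounded_mult[OF Ji measurable_dA_borel[OF borel_measurable_indicator[OF Om]], of 1])
          (simp add: indicator_def)
      have out: "(LINT z|dA. indicator Out z * (\<Phi> z * (cmod (f z))\<^sup>2)) \<le> e * J"
        using conc[of n c] by (simp add: Let_def J_def f_def p_def)
      have gs: "(\<lambda>z. \<phi> z * f z) \<in> sq_integrable" by (intro mult_sq_integrable bergman_sq_integrable fb)
      have Jlow: "phi0 \<gamma> \<rho> * \<rho> ^ (C * n) * L2.nsq f \<le> J"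
      proof -
        have "phi0 \<gamma> \<rho> * msq \<rho> f = (LINT z|dA. phi0 \<gamma> \<rho> * (indicator (cball 0 \<rho>) z * (cmod (f z))\<^sup>2))"
          by (simp add: msq_def)
        also have "\<dots> \<le> J" unfolding J_def
        proof (rule integral_mono)
          show "integrable dA (\<lambda>z. phi0 \<gamma> \<rho> * (indicator (cball 0 \<rho>) z * (cmod (f z))\<^sup>2))"
            by (intro integrable_mult_right integrable_indicator_cball fi)
          show "integrable dA (\<lambda>z. \<Phi> z * (cmod (f z))\<^sup>2)" by (rule Ji)
          fix z assume "z \<in> space dA"
          then have zb: "z \<in> ball 0 1" by simp
          show "phi0 \<gamma> \<rho> * (indicator (cball 0 \<rho>) z * (cmod (f z))\<^sup>2) \<le> \<Phi> z * (cmod (f z))\<^sup>2"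
          proof (cases "z \<in> cball 0 \<rho>")
            case True
            then have "phi0 \<gamma> \<rho> \<le> \<Phi> z" unfolding \<Phi>_def using gamma r by (intro phi0_antimono) auto
            then show ?thesis using True by (simp add: mult_right_mono)
          next
            case False
            then show ?thesis using Phi01[OF zb] by simp
          qed
        qed
        finally have 1: "phi0 \<gamma> \<rho> * msq \<rho> f \<le> J" .
        have "2 * N \<le> C * n"
        proof -
          have "2 * N \<le> 2 * (L * n + K * (n + m * n) + n)"
            using n unfolding N_def by (intro mult_left_mono add_mono mult_left_mono) auto
          then show ?thesis by (simp add: C_def algebra_simps)
        qed
        then have "\<rho> ^ (C * n) * L2.nsq f \<le> \<rho> ^ (2 * N) * L2.nsq f"
          using r by (intro mult_right_mono power_decreasing L2.nsq_nonneg bergman_sq_integrable fb) auto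
        also have "\<dots> \<le> msq \<rho> f"
          using msq_poly_ge[of \<rho> N "coeff p"] r unfolding fN[symmetric] msq_1 by simp
        finally have "phi0 \<gamma> \<rho> * (\<rho> ^ (C * n) * L2.nsq f) \<le> phi0 \<gamma> \<rho> * msq \<rho> f"
          using phi0_pos[OF r, of \<gamma>] by (intro mult_left_mono) auto
        then show ?thesis using 1 by (simp add: mult.assoc)
      qed
      \<comment> \<open>On the arc the real part of u \<phi>1 is at least M (1 - e), elsewhere at
        least -M; subtracting 2 M on \<open>Out\<close> from the first bound covers both
        cases.\<close>
      have Reint: "Re (u * binner (\<lambda>z. \<phi> z * f z) f) \<ge> M * (1 - e) * J - 2 * M * (e * J)"
      proof -
        have gi: "integrable dA (\<lambda>z. u * (\<phi> z * f z * cnj (f z)))"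
          by (intro integrable_mult_right sq_integrable_mult_cnj gs bergman_sq_integrable fb)
        have "M * (1 - e) * J - 2 * M * (e * J) \<le> M * (1 - e) * J - 2 * M * (LINT z|dA. indicator Out z * (\<Phi> z * (cmod (f z))\<^sup>2))"
          using out M by simp
        also have "\<dots> = (LINT z|dA. M * (1 - e) * (\<Phi> z * (cmod (f z))\<^sup>2) - 2 * M * (indicator Out z * (\<Phi> z * (cmod (f z))\<^sup>2)))"
          unfolding J_def using Ji Oi by (subst Bochner_Integration.integral_diff) auto
        also have "\<dots> \<le> (LINT z|dA. Re (u * (\<phi> z * f z * cnj (f z))))"
        proof (rule integral_mono_AE)
          show "integrable dA (\<lambda>z. M * (1 - e) * (\<Phi> z * (cmod (f z))\<^sup>2) - 2 * M * (indicator Out z * (\<Phi> z * (cmod (f z))\<^sup>2)))"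
            by (intro Bochner_Integration.integrable_diff integrable_mult_right Ji Oi)
          show "integrable dA (\<lambda>z. Re (u * (\<phi> z * f z * cnj (f z))))" by (intro integrable_Re gi)
          \<comment> \<open>At 0 the direction \<open>sgn 0 = 0\<close> is off the circle, so the
            comparison is made almost everywhere.\<close>
          have "{0} \<in> null_sets dA" by (intro null_setsI) (auto simp: emeasure_dA sets_dA_I)
          then have nz: "AE z in dA. z \<noteq> 0" using AE_not_in by fastforce
          show "AE z in dA. M * (1 - e) * (\<Phi> z * (cmod (f z))\<^sup>2) - 2 * M * (indicator Out z * (\<Phi> z * (cmod (f z))\<^sup>2))
              \<le> Re (u * (\<phi> z * f z * cnj (f z)))"
            using nz AE_space
          proof eventually_elim
            case (elim z)
            define X where "X = \<Phi> z * (cmod (f z))\<^sup>2"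
            have X0: "0 \<le> X" using elim Phi01[of z] by (simp add: X_def)
            have eq: "u * (\<phi> z * f z * cnj (f z)) = u * \<phi>1 (sgn z) * of_real X"
            proof -
              have "f z * cnj (f z) = of_real ((cmod (f z))\<^sup>2)" by (rule complex_norm_square[symmetric])
              then have "\<phi> z * f z * cnj (f z) = \<phi> z * of_real ((cmod (f z))\<^sup>2)" by (simp only: mult.assoc)
              then show ?thesis using elim by (simp add: X_def \<Phi>_def \<phi>_def symb_def mult_ac)
            qed
            have Re: "Re (u * (\<phi> z * f z * cnj (f z))) = Re (u * \<phi>1 (sgn z)) * X"
              unfolding eq by simp
            have "(M * (1 - e) - 2 * M * indicator Out z) * X \<le> Re (u * \<phi>1 (sgn z)) * X"
            proof (rule mult_right_mono[OF _ X0])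
              have s: "sgn z \<in> sphere 0 1" using elim by (intro sgn_sphere)
              show "M * (1 - e) - 2 * M * indicator Out z \<le> Re (u * \<phi>1 (sgn z))"
              proof (cases "z \<in> Out")
                case True
                have "0 \<le> M * e" using M e by simp
                then show ?thesis using True Re_all[OF s] by (simp add: algebra_simps)
              next
                case False
                then show ?thesis using Re_in[OF s] by (simp add: Out_def)
              qed
            qed
            then show ?case unfolding Re X_def[symmetric] by (simp add: algebra_simps)
          qed
        qed
        also have "\<dots> = Re (LINT z|dA. u * (\<phi> z * f z * cnj (f z)))" by (rule integral_Re[OF gi])
        also have "\<dots> = Re (u * binner (\<lambda>z. \<phi> z * f z) f)" by (simp add: binner_eq)
        finally show ?thesis .
      qed
      have "\<tau> * L2.nsq f = (1 - \<epsilon>) * M * (phi0 \<gamma> \<rho> * \<rho> ^ (C * n) * L2.nsq f)" by (simp add: \<tau>_def)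
      also have "\<dots> \<le> (1 - \<epsilon>) * M * J" using Jlow \<epsilon> M by (intro mult_left_mono) auto
      also have "\<dots> = M * (1 - e) * J - 2 * M * (e * J)" by (simp add: e_def algebra_simps)
      also have "\<dots> \<le> Re (u * binner (\<lambda>z. \<phi> z * f z) f)" by (rule Reint)
      also have "\<dots> \<le> cmod (u * binner (\<lambda>z. \<phi> z * f z) f)" by (rule complex_Re_le_cmod)
      also have "\<dots> = cmod (binner (toeplitz \<phi> f) f)"
        using binner_bproj_poly[OF gs, where n = N and c = "coeff p", folded fN] u1
        by (simp add: norm_mult toeplitz_eq_bproj)
      finally have "(\<tau> * L2.nsq f)\<^sup>2 \<le> (cmod (binner (toeplitz \<phi> f) f))\<^sup>2"
        using tau0 L2.nsq_nonneg[OF bergman_sq_integrable[OF fb]] by (intro power_mono) auto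
      also have "\<dots> \<le> L2.nsq (toeplitz \<phi> f) * L2.nsq f"
        by (rule bergman.Cauchy_Schwarz[OF toeplitz_bergman[OF fb] fb])
      finally have "(\<tau>\<^sup>2 * L2.nsq f) * L2.nsq f \<le> L2.nsq (toeplitz \<phi> f) * L2.nsq f"
        by (simp add: power2_eq_square mult_ac)
      then have "\<tau>\<^sup>2 * L2.nsq f \<le> L2.nsq (toeplitz \<phi> f)"
        using L2.nsq_nonneg[OF bergman_sq_integrable[OF fb]]
          L2.nsq_nonneg[OF bergman_sq_integrable[OF toeplitz_bergman[OF fb]]]
        by (cases "L2.nsq f = 0") (auto simp: mult_le_cancel_right)
      then show ?case unfolding lin by (simp add: f_def p_def)
    qed
    then show ?thesis using tau0 by (simp add: \<tau>_def)
  qed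
  then show ?thesis by blast
qed

lemma sing_val_asymptotics:
  "(\<lambda>n. (ln (real n + 1)) powr \<gamma> * sing_val (toeplitz \<phi>) n) \<longlonglongrightarrow> M"
proof (rule order_tendstoI)
  fix a assume a: "M < a"
  define \<rho> where "\<rho> = (\<lambda>n::nat. 1 - (ln (real n))\<^sup>2 / real n)"
  define U where "U = (\<lambda>n::nat. (ln (real n + 1)) powr \<gamma> * sqrt ((phi0 \<gamma> (\<rho> n))\<^sup>2 + exp (- 2 * (ln (real n))\<^sup>2)))"
  have "U \<longlonglongrightarrow> 1" unfolding U_def phi0_def \<rho>_def using gamma by real_asymp
  then have "(\<lambda>n. M * U n) \<longlonglongrightarrow> M * 1" by (intro tendsto_intros)
  then have "\<forall>\<^sub>F n in sequentially. M * U n < a" by (rule order_tendstoD(2)) (use a in simp)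
  moreover have "\<forall>\<^sub>F n in sequentially. 0 \<le> \<rho> n" unfolding \<rho>_def by real_asymp
  moreover have "\<forall>\<^sub>F n in sequentially. \<rho> n < 1" unfolding \<rho>_def by real_asymp
  ultimately show "\<forall>\<^sub>F n in sequentially. (ln (real n + 1)) powr \<gamma> * sing_val (toeplitz \<phi>) n < a"
    using eventually_ge_at_top[of 1]
  proof eventually_elim
    case (elim n)
    \<comment> \<open>The inequality 1 - x \<le> exp (-x) gives the bound exp (-2 (ln n)^2), which
      is smaller than every negative power of ln n, while ln (1 / (1 - \<rho>)) is still asymptotic
      to ln n.\<close>
    have "\<rho> n ^ (2 * n) \<le> exp (- ((ln (real n))\<^sup>2 / real n)) ^ (2 * n)"
      using elim exp_ge_add_one_self[of "- ((ln (real n))\<^sup>2 / real n)"] by (intro power_mono) (auto simp: \<rho>_def)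
    also have "\<dots> = exp (- 2 * (ln (real n))\<^sup>2)"
      using elim by (simp add: exp_of_nat_mult[symmetric])
    finally have "sqrt ((phi0 \<gamma> (\<rho> n))\<^sup>2 + \<rho> n ^ (2 * n)) \<le> sqrt ((phi0 \<gamma> (\<rho> n))\<^sup>2 + exp (- 2 * (ln (real n))\<^sup>2))"
      by simp
    then have "M * sqrt ((phi0 \<gamma> (\<rho> n))\<^sup>2 + \<rho> n ^ (2 * n)) \<le> M * sqrt ((phi0 \<gamma> (\<rho> n))\<^sup>2 + exp (- 2 * (ln (real n))\<^sup>2))"
      using M_nonneg by (rule mult_left_mono)
    then have "sing_val (toeplitz \<phi>) n \<le> M * sqrt ((phi0 \<gamma> (\<rho> n))\<^sup>2 + exp (- 2 * (ln (real n))\<^sup>2))"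
      using sing_val_upper[of n "\<rho> n"] elim by linarith
    then have "(ln (real n + 1)) powr \<gamma> * sing_val (toeplitz \<phi>) n \<le> (ln (real n + 1)) powr \<gamma> * (M * sqrt ((phi0 \<gamma> (\<rho> n))\<^sup>2 + exp (- 2 * (ln (real n))\<^sup>2)))"
      by (intro mult_left_mono) auto
    also have "\<dots> = M * U n" by (simp add: U_def)
    also have "\<dots> < a" by (rule elim)
    finally show ?case .
  qed
next
  fix a assume a: "a < M"
  show "\<forall>\<^sub>F n in sequentially. a < (ln (real n + 1)) powr \<gamma> * sing_val (toeplitz \<phi>) n"
  \<comment> \<open>For negative a nonnegativity of the singular values suffices. This settles M =
    0, so that M > 0 in the remaining case.\<close>
  proof (cases "a < 0")
    case True
    have "\<forall>\<^sub>F n in sequentially. 1 \<le> (n::nat)" by (rule eventually_ge_at_top)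
    then show ?thesis
    proof eventually_elim
      case (elim n)
      have "0 \<le> (ln (real n + 1)) powr \<gamma> * sing_val (toeplitz \<phi>) n"
        using sing_val_nonneg[OF elim] by (intro mult_nonneg_nonneg) auto
      then show ?case using True by linarith
    qed
  next
    case False
    then have Mp: "0 < M" using a by simp
    \<comment> \<open>Makes (1 - \<epsilon>) M the midpoint of a and M.\<close>
    define \<epsilon> where "\<epsilon> = (1 - a / M) / 2"
    have eps: "0 < \<epsilon>" "\<epsilon> < 1" using False a Mp by (auto simp: \<epsilon>_def field_simps)
    have less: "a < (1 - \<epsilon>) * M" using a Mp by (simp add: \<epsilon>_def field_simps)
    obtain C where C: "\<And>n \<rho>. 1 \<le> n \<Longrightarrow> 0 \<le> \<rho> \<Longrightarrow> \<rho> < 1 \<Longrightarrow>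
        (1 - \<epsilon>) * M * phi0 \<gamma> \<rho> * \<rho> ^ (C * n) \<le> sing_val (toeplitz \<phi>) n"
      using sing_val_lower[OF eps Mp] by blast
    define \<rho> where "\<rho> = (\<lambda>n::nat. 1 - 1 / (real n * ln (real n)))"
    define U where "U = (\<lambda>n::nat. (ln (real n + 1)) powr \<gamma> * phi0 \<gamma> (\<rho> n) * (1 - real C / ln (real n)))"
    have "U \<longlonglongrightarrow> 1" unfolding U_def phi0_def \<rho>_def using gamma by real_asymp
    then have "(\<lambda>n. (1 - \<epsilon>) * M * U n) \<longlonglongrightarrow> (1 - \<epsilon>) * M * 1" by (intro tendsto_intros)
    then have "\<forall>\<^sub>F n in sequentially. a < (1 - \<epsilon>) * M * U n" by (rule order_tendstoD(1)) (use less in simp)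
    moreover have "\<forall>\<^sub>F n in sequentially. 0 \<le> \<rho> n" unfolding \<rho>_def by real_asymp
    moreover have "\<forall>\<^sub>F n in sequentially. \<rho> n < 1" unfolding \<rho>_def by real_asymp
    ultimately show ?thesis using eventually_ge_at_top[of 2]
    proof eventually_elim
      case (elim n)
      \<comment> \<open>Bernoulli's inequality for the power C n of 1 - 1 / (n ln n) leaves 1 - C /
        ln n, so \<rho>^(C n) tends to 1 for every fixed C.\<close>
      have "1 + real (C * n) * (- (1 / (real n * ln (real n)))) \<le> (1 + - (1 / (real n * ln (real n)))) ^ (C * n)"
        by (rule Bernoulli_inequality) (use elim in \<open>auto simp: \<rho>_def\<close>)
      then have "1 - real C / ln (real n) \<le> \<rho> n ^ (C * n)"
        using elim by (simp add: \<rho>_def)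
      then have "(1 - \<epsilon>) * M * phi0 \<gamma> (\<rho> n) * (1 - real C / ln (real n)) \<le> (1 - \<epsilon>) * M * phi0 \<gamma> (\<rho> n) * \<rho> n ^ (C * n)"
        using eps Mp phi0_pos[of "\<rho> n" \<gamma>] elim by (intro mult_left_mono) auto
      also have "\<dots> \<le> sing_val (toeplitz \<phi>) n" using elim by (intro C) auto
      finally have "(ln (real n + 1)) powr \<gamma> * ((1 - \<epsilon>) * M * phi0 \<gamma> (\<rho> n) * (1 - real C / ln (real n)))
          \<le> (ln (real n + 1)) powr \<gamma> * sing_val (toeplitz \<phi>) n"
        by (intro mult_left_mono) auto
      moreover have "(ln (real n + 1)) powr \<gamma> * ((1 - \<epsilon>) * M * phi0 \<gamma> (\<rho> n) * (1 - real C / ln (real n))) = (1 - \<epsilon>) * M * U n"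
        by (simp add: U_def mult_ac)
      ultimately show ?case using elim(1) by linarith
    qed
  qed
qed

end

theorem theorem0p3:
  fixes \<gamma> :: real and \<phi>1 :: "complex \<Rightarrow> complex"
  assumes "\<gamma> > 0"
    and "continuous_on (sphere 0 1) \<phi>1"
  shows "compact_bergman_op (toeplitz (symb \<gamma> \<phi>1)) \<and>
         (\<lambda>n. (ln (real n + 1)) powr \<gamma> * sing_val (toeplitz (symb \<gamma> \<phi>1)) n)
           \<longlonglongrightarrow> (SUP z\<in>sphere 0 1. cmod (\<phi>1 z))"
proof -
  interpret log_symbol \<gamma> \<phi>1 by unfold_locales (fact assms)+
  show ?thesis
    using compact_toeplitz sing_val_asymptotics by (simp only: toeplitz_symb M_def)
qed

end
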